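(* Let $g_1(t) = (2t^2)^{2t^2}+2$, $g_2(t) = (2t^2)^2+1$, and $g(t) = 4(g_1(t))^{g_2(t)}$. For every natural number $t$, if $G$ is a rooted directed path graph and the grid rank of the adjacency matrix of $G$ along the order $\prec$ is at least $2 \cdot g(t)$, then $G$ contains a semi-induced transversal pair of half-graphs $T_t$ or a semi-induced generalized transversal pair of half-graphs $T_{t,2}$.
   Context: A rooted directed path graph $G$ has a tree model $(T,\{P_v : v \in V(G)\})$: $T$ is a rooted tree oriented away from the root (every node reachable from the root), each $P_v$ is a directed path of $T$, and $uw \in E(G)$ iff $V(P_u)\cap V(P_w)\neq\emptyset$. For a node $p$, $V_p=\{u : p \in V(P_u)\}$; the model is minimal if there are no adjacent nodes $p,p'$ with $V_p \subseteq V_{p'}$; a minimal tree model is fixed. Write $p \leq_T p'$ if $p$ is an ancestor of $p'$. For $v\in V(G)$, $\textsf{high}(v)$ and $\textsf{low}(v)$ are the nodes of $P_v$ closest to and furthest from the root. For a node $q$, $T_q$ is the subtree rooted at $q$. The order $\prec_{\mathrm{DFS}}$ on nodes of $T$ is the order in which nodes are processed by a depth-first search, where a node is processed once all other nodes of its subtree are visited; among siblings $x,y$, $T_x$ is explored before $T_y$ if the symmetric difference of $\{\textsf{high}(v) : \textsf{low}(v)\in V(T_x)\}$ and $\{\textsf{high}(v):\textsf{low}(v)\in V(T_y)\}$ has a $\leq_T$-minimum $\textsf{high}(v)$ with $\textsf{low}(v)\in V(T_x)$ (arbitrary otherwise). The total order $\prec$ on $V(G)$ is: $u \prec v$ if $\textsf{low}(u)\prec_{\mathrm{DFS}}\textsf{low}(v)$,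 or $\textsf{low}(u)=\textsf{low}(v)$ and $\textsf{high}(u)$ is a proper ancestor of $\textsf{high}(v)$ (remaining ties broken arbitrarily). A $k$-division of a matrix partitions rows and columns each into $k$ intervals of consecutive rows/columns; it is a rank-$k$ division if every one of the $k^2$ cells has at least $k$ distinct rows or at least $k$ distinct columns; the grid rank is the maximum $k$ admitting a rank-$k$ division. A generalized transversal pair $T_{t,\ell}$ consists of sets $A=\{a_{i,j}\}$, $B_0=\{b^0_{i,j}\},\dots,B_\ell=\{b^\ell_{i,j}\}$, $C=\{c_{i,j}\}$ ($i,j\in[t]$) with $a_{i,j}b^0_{i',j'}$ an edge iff $(i,j)\leq_{\mathrm{lex}}(i',j')$, $b^{k-1}_{i,j}b^k_{i',j'}$ an edge iff $(i,j)=(i',j')$ for $k\in[\ell]$, and $b^\ell_{i,j}c_{i',j'}$ an edge iff $(j,i)\leq_{\mathrm{lex}}(j',i')$; $T_t=T_{t,0}$. It is semi-induced if the graph contains these vertices with exactly these adjacencies between the specified consecutive sets, allowing arbitrary extra edges only between pairs of sets with no predefined edges. *)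

theory Defs
  imports "Graph_Theory.Graph_Theory" "Jordan_Normal_Form.DL_Submatrix" "HOL-Library.Disjoint_Sets"
begin

section \<open>Tree models\<close>

text \<open>
  Finite simple graphs are the symmetric, loop-free pair digraphs of the locale
  \<^locale>\<open>pair_graph\<close>; an edge \<open>uv\<close> is the presence of \<open>(u, v)\<close> in \<^const>\<open>parcs\<close>.

  The library's \<^const>\<open>tree\<close> only excludes directed cycles, so it also accepts
  acyclic digraphs whose underlying graph has cycles. We therefore use the
  definition of a finite rooted tree oriented away from its root as an arborescence.
\<close>

definition rooted_tree :: "'n pair_pre_digraph \<Rightarrow> 'n \<Rightarrow> bool" where
  "rooted_tree T r \<longleftrightarrow> pair_fin_digraph T \<and> r \<in> pverts T \<and>
     (\<forall>x\<in>pverts T. \<exists>!p. pre_digraph.awalk T r p x)"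

abbreviation ancestor :: "'n pair_pre_digraph \<Rightarrow> 'n \<Rightarrow> 'n \<Rightarrow> bool" where
  "ancestor T p q \<equiv> p \<rightarrow>\<^sup>*\<^bsub>T\<^esub> q"

definition subtree :: "'n pair_pre_digraph \<Rightarrow> 'n \<Rightarrow> 'n set" where
  "subtree T q = {x. ancestor T q x}"

text \<open>The path of a vertex is given as the nonempty list of its nodes in the direction of the arcs.\<close>

definition tree_model ::
    "'v pair_pre_digraph \<Rightarrow> 'n pair_pre_digraph \<Rightarrow> 'n \<Rightarrow> ('v \<Rightarrow> 'n list) \<Rightarrow> bool" where
  "tree_model G T r P \<longleftrightarrow> rooted_tree T r \<and> (\<forall>v\<in>pverts G. vpath (P v) T) \<and>
     (\<forall>u\<in>pverts G. \<forall>w\<in>pverts G. u \<noteq> w \<longrightarrow>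
        ((u, w) \<in> parcs G \<longleftrightarrow> set (P u) \<inter> set (P w) \<noteq> {}))"

definition bag :: "'v pair_pre_digraph \<Rightarrow> ('v \<Rightarrow> 'n list) \<Rightarrow> 'n \<Rightarrow> 'v set" where
  "bag G P p = {u \<in> pverts G. p \<in> set (P u)}"

definition minimal_tree_model ::
    "'v pair_pre_digraph \<Rightarrow> 'n pair_pre_digraph \<Rightarrow> 'n \<Rightarrow> ('v \<Rightarrow> 'n list) \<Rightarrow> bool" where
  "minimal_tree_model G T r P \<longleftrightarrow> tree_model G T r P \<and>
     (\<forall>(p, q)\<in>parcs T. \<not> bag G P p \<subseteq> bag G P q \<and> \<not> bag G P q \<subseteq> bag G P p)"

text \<open>
  Arcs point away from the root, so the first and last node of a path are the ones closest
  to and furthest from the root; see the two lemmas below.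
\<close>

definition high :: "('v \<Rightarrow> 'n list) \<Rightarrow> 'v \<Rightarrow> 'n" where
  "high P v = hd (P v)"

definition low :: "('v \<Rightarrow> 'n list) \<Rightarrow> 'v \<Rightarrow> 'n" where
  "low P v = last (P v)"

lemma vwalk_ancestor:
  assumes "vwalk xs (with_proj T)" "q \<in> set xs"
  shows "ancestor T (hd xs) q \<and> ancestor T q (last xs)"
  using assms
proof (induction xs arbitrary: q rule: vwalk_arcs.induct)
  case (3 x y xs)
  have w: "vwalk (y # xs) (with_proj T)" and xy: "ancestor T x y" and xx: "ancestor T x x"
    using "3.prems"(1) by (auto simp: vwalk_def reachable_def
        intro: rtrancl_on_into_rtrancl_on[OF rtrancl_on_refl])
  have IH: "ancestor T y z" "ancestor T z (last (y # xs))" if "z \<in> set (y # xs)" for z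
    using "3.IH"[OF w that] by simp_all
  have tr: "ancestor T x z" if "ancestor T y z" for z
    using xy that unfolding reachable_def by (rule rtrancl_on_trans)
  show ?case
  proof (cases "q = x")
    case True
    have "ancestor T x (last (y # xs))"
      by (rule tr, rule IH(2)) simp
    with True xx show ?thesis by simp
  next
    case False
    with "3.prems"(2) have "q \<in> set (y # xs)" by simp
    from tr[OF IH(1)[OF this]] IH(2)[OF this] show ?thesis by simp
  qed
qed (auto simp: vwalk_def reachable_def)

lemma
  assumes "tree_model G T r P" "v \<in> pverts G" "q \<in> set (P v)"
  shows high_ancestor: "ancestor T (high P v) q" and ancestor_low: "ancestor T q (low P v)"
proof -
  have "vwalk (P v) (with_proj T)"
    using assms(1,2) by (simp add: tree_model_def vpath_def)
  from vwalk_ancestor[OF this assms(3)]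
  show "ancestor T (high P v) q" "ancestor T q (low P v)"
    by (simp_all add: high_def low_def)
qed


section \<open>The vertex order\<close>

definition precedes_in :: "'a list \<Rightarrow> 'a \<Rightarrow> 'a \<Rightarrow> bool" where
  "precedes_in xs x y \<longleftrightarrow> (\<exists>i j. i < j \<and> j < length xs \<and> xs ! i = x \<and> xs ! j = y)"

text \<open>
  \<open>dfs_postorder ch p xs\<close>: the depth-first search from \<open>p\<close> that explores the children of each
  node \<open>q\<close> in the order of the list \<open>ch q\<close> processes the nodes in the order \<open>xs\<close>.
\<close>

inductive dfs_postorder :: "('n \<Rightarrow> 'n list) \<Rightarrow> 'n \<Rightarrow> 'n list \<Rightarrow> bool" for ch where
  "list_all2 (dfs_postorder ch) (ch p) xss \<Longrightarrow> dfs_postorder ch p (concat xss @ [p])"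

definition highs_below ::
    "'v pair_pre_digraph \<Rightarrow> 'n pair_pre_digraph \<Rightarrow> ('v \<Rightarrow> 'n list) \<Rightarrow> 'n \<Rightarrow> 'n set" where
  "highs_below G T P x = {high P v | v. v \<in> pverts G \<and> low P v \<in> subtree T x}"

definition explored_before ::
    "'v pair_pre_digraph \<Rightarrow> 'n pair_pre_digraph \<Rightarrow> ('v \<Rightarrow> 'n list) \<Rightarrow> 'n \<Rightarrow> 'n \<Rightarrow> bool" where
  "explored_before G T P x y \<longleftrightarrow>
     (let D = (highs_below G T P x - highs_below G T P y) \<union> (highs_below G T P y - highs_below G T P x)
      in \<exists>v\<in>pverts G. low P v \<in> subtree T x \<and> high P v \<in> D \<and> (\<forall>q\<in>D. ancestor T (high P v) q))"

text \<open>\<open>ns\<close> lists the nodes of the tree in an order \<open>\<prec>\<^sub>D\<^sub>F\<^sub>S\<close>, smallest first.\<close>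

definition dfs_order ::
    "'v pair_pre_digraph \<Rightarrow> 'n pair_pre_digraph \<Rightarrow> 'n \<Rightarrow> ('v \<Rightarrow> 'n list) \<Rightarrow> 'n list \<Rightarrow> bool" where
  "dfs_order G T r P ns \<longleftrightarrow> (\<exists>ch.
     (\<forall>p\<in>pverts T. distinct (ch p) \<and> set (ch p) = {q. (p, q) \<in> parcs T} \<and>
        (\<forall>x\<in>set (ch p). \<forall>y\<in>set (ch p). explored_before G T P x y \<longrightarrow> precedes_in (ch p) x y)) \<and>
     dfs_postorder ch r ns)"

text \<open>
  \<open>vs\<close> lists the vertices of the graph in an order \<open>\<prec>\<close> arising from \<open>ns\<close>, smallest first;
  any choice of such a list is a way of breaking the remaining ties.
\<close>

definition vertex_order ::
    "'v pair_pre_digraph \<Rightarrow> 'n pair_pre_digraph \<Rightarrow> ('v \<Rightarrow> 'n list) \<Rightarrow> 'n list \<Rightarrow> 'v list \<Rightarrow> bool" where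
  "vertex_order G T P ns vs \<longleftrightarrow> distinct vs \<and> set vs = pverts G \<and>
     (\<forall>u\<in>pverts G. \<forall>v\<in>pverts G.
        precedes_in ns (low P u) (low P v) \<or>
        low P u = low P v \<and> ancestor T (high P u) (high P v) \<and> high P u \<noteq> high P v
        \<longrightarrow> precedes_in vs u v)"


section \<open>Grid rank\<close>

definition adjacency_mat :: "'v pair_pre_digraph \<Rightarrow> 'v list \<Rightarrow> nat mat" where
  "adjacency_mat G vs =
     mat (length vs) (length vs) (\<lambda>(i, j). if (vs ! i, vs ! j) \<in> parcs G then 1 else 0)"

definition interval_partition :: "nat \<Rightarrow> nat \<Rightarrow> nat set set \<Rightarrow> bool" where
  "interval_partition k n \<P> \<longleftrightarrow>
     partition_on {..<n} \<P> \<and> card \<P> = k \<and> (\<forall>I\<in>\<P>. \<exists>a b. I = {a..<b})"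

definition k_division :: "nat \<Rightarrow> 'a mat \<Rightarrow> nat set set \<Rightarrow> nat set set \<Rightarrow> bool" where
  "k_division k M \<R> \<C> \<longleftrightarrow>
     interval_partition k (dim_row M) \<R> \<and> interval_partition k (dim_col M) \<C>"

definition rank_division :: "nat \<Rightarrow> 'a mat \<Rightarrow> nat set set \<Rightarrow> nat set set \<Rightarrow> bool" where
  "rank_division k M \<R> \<C> \<longleftrightarrow> k_division k M \<R> \<C> \<and>
     (\<forall>I\<in>\<R>. \<forall>J\<in>\<C>. k \<le> card (set (rows (submatrix M I J))) \<or>
                   k \<le> card (set (cols (submatrix M I J))))"

definition grid_rank :: "'a mat \<Rightarrow> nat" where
  "grid_rank M = Max {k. \<exists>\<R> \<C>. rank_division k M \<R> \<C>}"


section \<open>Transversal pairs of half-graphs\<close>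

text \<open>\<open>VA i j\<close>, \<open>VB k i j\<close> and \<open>VC i j\<close> are the vertices written $a_{i,j}$, $b^k_{i,j}$ and $c_{i,j}$.\<close>

datatype tp_vertex = VA nat nat | VB nat nat nat | VC nat nat

definition lex_le :: "nat \<times> nat \<Rightarrow> nat \<times> nat \<Rightarrow> bool" where
  "lex_le p q \<longleftrightarrow> fst p < fst q \<or> fst p = fst q \<and> snd p \<le> snd q"

inductive tp_edge :: "nat \<Rightarrow> tp_vertex \<Rightarrow> tp_vertex \<Rightarrow> bool" for l where
  "lex_le (i, j) (i', j') \<Longrightarrow> tp_edge l (VA i j) (VB 0 i' j')"
| "k \<in> {1..l} \<Longrightarrow> (i, j) = (i', j') \<Longrightarrow> tp_edge l (VB (k - 1) i j) (VB k i' j')"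
| "lex_le (j, i) (j', i') \<Longrightarrow> tp_edge l (VB l i j) (VC i' j')"

definition tp_verts :: "nat \<Rightarrow> nat \<Rightarrow> tp_vertex set" where
  "tp_verts t l = {VA i j | i j. i \<in> {1..t} \<and> j \<in> {1..t}} \<union>
     {VB k i j | k i j. k \<le> l \<and> i \<in> {1..t} \<and> j \<in> {1..t}} \<union>
     {VC i j | i j. i \<in> {1..t} \<and> j \<in> {1..t}}"

definition transversal_pair :: "nat \<Rightarrow> nat \<Rightarrow> tp_vertex pair_pre_digraph" where
  "transversal_pair t l = \<lparr> pverts = tp_verts t l,
     parcs = {(x, y). x \<in> tp_verts t l \<and> y \<in> tp_verts t l \<and> (tp_edge l x y \<or> tp_edge l y x)} \<rparr>"

text \<open>Position of the set containing a vertex in the sequence \<open>A, B\<^sub>0, \<dots>, B\<^sub>l, C\<close>.\<close>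

fun tp_layer :: "nat \<Rightarrow> tp_vertex \<Rightarrow> nat" where
  "tp_layer l (VA i j) = 0"
| "tp_layer l (VB k i j) = k + 1"
| "tp_layer l (VC i j) = l + 2"

text \<open>
  Only pairs of consecutive sets are constrained: edges inside a set and between
  non-consecutive sets are arbitrary.
\<close>

definition semi_induced_transversal_pair :: "nat \<Rightarrow> nat \<Rightarrow> 'v pair_pre_digraph \<Rightarrow> bool" where
  "semi_induced_transversal_pair t l G \<longleftrightarrow> (\<exists>f.
     inj_on f (pverts (transversal_pair t l)) \<and>
     f ` pverts (transversal_pair t l) \<subseteq> pverts G \<and>
     (\<forall>x\<in>pverts (transversal_pair t l). \<forall>y\<in>pverts (transversal_pair t l).
        tp_layer l y = tp_layer l x + 1 \<longrightarrow>
        ((f x, f y) \<in> parcs G \<longleftrightarrow> (x, y) \<in> parcs (transversal_pair t l))))"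


section \<open>The bound\<close>

definition g1 :: "nat \<Rightarrow> nat" where "g1 t = (2 * t\<^sup>2) ^ (2 * t\<^sup>2) + 2"

definition g2 :: "nat \<Rightarrow> nat" where "g2 t = (2 * t\<^sup>2)\<^sup>2 + 1"

definition g :: "nat \<Rightarrow> nat" where "g t = 4 * g1 t ^ g2 t"

end

theory Submission
  imports Defs
begin

text \<open>
  Split the rows and columns so that the row blocks precede the column blocks, and let \<open>\<pi>\<close> be a lowest
  node at the border. Adjacency between the two sides then only depends on the segments in which the
  vertex paths meet the path from the root to \<open>\<pi>\<close>; the lower ends of these segments are monotone along
  \<open>\<prec>\<close>. After halving the blocks, the segments of one side (\<open>U\<close>) all end above those of the other side
  (\<open>Z\<close>), and a cell with three distinct rows or columns yields, for every block of \<open>U\<close> and every block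
  of \<open>Z\<close>, a vertex in the \<open>Z\<close>-block whose highest node falls between the ends of two segments of the
  \<open>U\<close>-block. Thus every \<open>Z\<close>-block (a group) has highest nodes in many prescribed ranges above a node \<open>D\<close>
  and all its lowest nodes below \<open>D\<close>.

  If the groups branch off at many different nodes of a path below \<open>D\<close>, then minimality of the model
  provides a vertex starting at each branching node and a vertex leaving the path to \<open>D\<close> at each highest
  node, and these give \<open>T\<^sub>t\<close>. Otherwise some node has many children whose subtrees contain different groups.
  The children are sorted lexicographically by the sets of highest nodes, which makes it possible to choose
  groups and representatives with increasing highest nodes, whichever child of a chosen group is used.
  A second vertex in the same child, with highest node in a range of our choice, and a vertex starting at
  the child give the two matchings of \<open>T\<^sub>t\<^sub>,\<^sub>2\<close>.
\<close>

section \<open>Rooted trees\<close>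

text \<open>A transversal pair carries two lexicographic orders, one by (i, j) and one by (j, i), on
  the same t^2 pairs. One order is read off from the highest nodes above \<open>D\<close>; the other
  needs a source that can be prescribed independently. When the groups branch off along one path,
  the position of the group is such a source, because every group has a vertex in every segment.
  Below a single branching node this fails: siblings are incomparable, and no vertex starting at one
  of them sees their order. The second order then has to come from highest nodes too, which costs a
  second vertex per child and hence the two matchings. The obstacle is that a vertex chosen for its
  segment dictates the child, and with it the highest nodes still available to its partner. This is
  why the selection lemma fixes the groups first and then allows every choice function \<sigma>.
  Each group needs 2 t^2 + 1 segments: t^2 to guarantee enough candidates for the first order, one
  as a barrier, and t^2 for the second order.\<close>

locale forest =
  fixes E :: "'n rel"
  assumes finite_E: "finite E"
    and acyclic_E: "acyclic E"
    and parent_unique: "(a, c) \<in> E \<Longrightarrow> (b, c) \<in> E \<Longrightarrow> a = b"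
begin

abbreviation anc :: "'n \<Rightarrow> 'n \<Rightarrow> bool" (infix "\<preceq>" 50) where
  "x \<preceq> y \<equiv> (x, y) \<in> E\<^sup>*"

text \<open>Among the ancestors of one node \<preceq> is the order of these numbers, which lets
  highest nodes enter the selection argument as natural numbers.\<close>

definition depth :: "'n \<Rightarrow> nat" where
  "depth x = card {q. (q, x) \<in> E\<^sup>+}"

lemma anc_antisym: "x \<preceq> y \<Longrightarrow> y \<preceq> x \<Longrightarrow> x = y"
  using acyclic_E by (metis acyclic_impl_antisym_rtrancl antisymD)

lemma anc_parent: "x \<preceq> y \<Longrightarrow> (p, y) \<in> E \<Longrightarrow> x \<noteq> y \<Longrightarrow> x \<preceq> p"
  by (metis parent_unique rtranclE)

lemma anc_linear: "p \<preceq> x \<Longrightarrow> q \<preceq> x \<Longrightarrow> p \<preceq> q \<or> q \<preceq> p"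
proof (induction rule: rtrancl_induct)
  case (step y z)
  then show ?case
    by (metis anc_parent rtrancl.rtrancl_into_rtrancl)
qed auto

lemma child_towards: "x \<preceq> y \<Longrightarrow> x \<noteq> y \<Longrightarrow> \<exists>c. (x, c) \<in> E \<and> c \<preceq> y"
  by (meson converse_rtranclE)

lemma finite_strict_anc: "finite {q. (q, x) \<in> E\<^sup>+}"
proof (rule finite_subset)
  show "{q. (q, x) \<in> E\<^sup>+} \<subseteq> Field E"
    by (auto simp: Field_def dest: tranclD)
qed (simp add: finite_E finite_Field)

lemma depth_less:
  assumes "x \<preceq> y" "x \<noteq> y"
  shows "depth x < depth y"
proof -
  have xy: "(x, y) \<in> E\<^sup>+" using assms by (meson rtranclD)
  have "{q. (q, x) \<in> E\<^sup>+} \<subseteq> {q. (q, y) \<in> E\<^sup>+}"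
    using trancl_trans[OF _ xy] by blast
  moreover have "x \<in> {q. (q, y) \<in> E\<^sup>+}" "x \<notin> {q. (q, x) \<in> E\<^sup>+}"
    using xy acyclic_E by (simp_all add: acyclic_def)
  ultimately have "{q. (q, x) \<in> E\<^sup>+} \<subset> {q. (q, y) \<in> E\<^sup>+}" by blast
  then show ?thesis
    unfolding depth_def using finite_strict_anc by (simp add: psubset_card_mono)
qed

lemma depth_le: "x \<preceq> y \<Longrightarrow> depth x \<le> depth y"
  using depth_less by (cases "x = y") (auto intro: less_imp_le)

lemma anc_iff_depth:
  assumes "x \<preceq> z" "y \<preceq> z"
  shows "x \<preceq> y \<longleftrightarrow> depth x \<le> depth y"
proof
  assume "depth x \<le> depth y"
  then have "\<not> (y \<preceq> x \<and> y \<noteq> x)" using depth_less leD by blast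
  then show "x \<preceq> y" using anc_linear[OF assms] by auto
qed (rule depth_le)

lemma depth_inj: "x \<preceq> z \<Longrightarrow> y \<preceq> z \<Longrightarrow> depth x = depth y \<Longrightarrow> x = y"
  using anc_iff_depth anc_antisym by (metis order_refl)

end

section \<open>Tree models\<close>

text \<open>A path enters only through its two ends: in a forest it consists of exactly the nodes
  between them. The last two assumptions are the two non-inclusions of bags across an arc, spelled
  out in these terms.\<close>

locale path_model = forest E
  for E :: "'n rel" +
  fixes G :: "'v pair_pre_digraph" and hi lo :: "'v \<Rightarrow> 'n"
  assumes hi_lo: "v \<in> pverts G \<Longrightarrow> (hi v, lo v) \<in> E\<^sup>*"
    and arcs_iff: "u \<in> pverts G \<Longrightarrow> w \<in> pverts G \<Longrightarrow> u \<noteq> w \<Longrightarrow> (u, w) \<in> parcs G \<longleftrightarrow>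
      (\<exists>q. (hi u, q) \<in> E\<^sup>* \<and> (q, lo u) \<in> E\<^sup>* \<and> (hi w, q) \<in> E\<^sup>* \<and> (q, lo w) \<in> E\<^sup>*)"
    and min_upper: "(p, q) \<in> E \<Longrightarrow>
      \<exists>v\<in>pverts G. (hi v, p) \<in> E\<^sup>* \<and> (p, lo v) \<in> E\<^sup>* \<and> \<not> ((hi v, q) \<in> E\<^sup>* \<and> (q, lo v) \<in> E\<^sup>*)"
    and min_lower: "(p, q) \<in> E \<Longrightarrow>
      \<exists>v\<in>pverts G. (hi v, q) \<in> E\<^sup>* \<and> (q, lo v) \<in> E\<^sup>* \<and> \<not> ((hi v, p) \<in> E\<^sup>* \<and> (p, lo v) \<in> E\<^sup>*)"
begin

definition on_path :: "'v \<Rightarrow> 'n \<Rightarrow> bool" where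
  "on_path v q \<longleftrightarrow> hi v \<preceq> q \<and> q \<preceq> lo v"

lemma arcs_on_path: "u \<in> pverts G \<Longrightarrow> w \<in> pverts G \<Longrightarrow> u \<noteq> w \<Longrightarrow>
    (u, w) \<in> parcs G \<longleftrightarrow> (\<exists>q. on_path u q \<and> on_path w q)"
  using arcs_iff unfolding on_path_def by blast

lemma arcs_sym: "u \<in> pverts G \<Longrightarrow> w \<in> pverts G \<Longrightarrow> u \<noteq> w \<Longrightarrow>
    (u, w) \<in> parcs G \<longleftrightarrow> (w, u) \<in> parcs G"
  using arcs_on_path by (metis)

text \<open>Against paths running down through \<open>D\<close> such a vertex acts as a threshold
  placed at \<open>s\<close>; it supplies the outer side of a half-graph.\<close>

definition exits_at :: "'n \<Rightarrow> 'n \<Rightarrow> 'v \<Rightarrow> bool" where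
  "exits_at D s u \<longleftrightarrow> u \<in> pverts G \<and> on_path u s \<and> (\<forall>q. on_path u q \<longrightarrow> q \<preceq> D \<longrightarrow> q \<preceq> s)"

text \<open>Let \<open>s'\<close> be the next node from \<open>s\<close> towards \<open>D\<close>.
  Minimality gives a path through \<open>s\<close> that misses \<open>s'\<close>; a node of it
  further down towards \<open>D\<close> would force \<open>s'\<close> onto the path.\<close>

lemma exits_at_exists:
  assumes "s \<preceq> D" "s \<noteq> D"
  shows "\<exists>u. exits_at D s u"
proof -
  obtain s' where s': "(s, s') \<in> E" "s' \<preceq> D" using child_towards[OF assms] by blast
  obtain u where u: "u \<in> pverts G" "hi u \<preceq> s" "s \<preceq> lo u" "\<not> (hi u \<preceq> s' \<and> s' \<preceq> lo u)"
    using min_upper[OF s'(1)] by blast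
  have "q \<preceq> s" if "on_path u q" "q \<preceq> D" for q
  proof -
    have "\<not> s' \<preceq> q"
    proof
      assume "s' \<preceq> q"
      then have "s' \<preceq> lo u" using that(1) unfolding on_path_def by (meson rtrancl_trans)
      moreover have "hi u \<preceq> s'" using u(2) s'(1) by (meson rtrancl.rtrancl_into_rtrancl)
      ultimately show False using u(4) by blast
    qed
    then have "q \<preceq> s'" "q \<noteq> s'" using anc_linear[OF that(2) s'(2)] by auto
    then show ?thesis using s'(1) anc_parent by blast
  qed
  then show ?thesis using u unfolding exits_at_def on_path_def by blast
qed

definition exit_vertex :: "'n \<Rightarrow> 'n \<Rightarrow> 'v" where
  "exit_vertex D s = (SOME u. exits_at D s u)"

lemma exits_at_exit_vertex: "s \<preceq> D \<Longrightarrow> s \<noteq> D \<Longrightarrow> exits_at D s (exit_vertex D s)"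
  unfolding exit_vertex_def using exits_at_exists by (metis someI_ex)

lemma exits_at_not_below:
  assumes "exits_at D s u" "s \<preceq> D" "s \<noteq> D"
  shows "\<not> D \<preceq> lo u"
proof
  assume *: "D \<preceq> lo u"
  have "hi u \<preceq> s" using assms(1) unfolding exits_at_def on_path_def by blast
  then have "on_path u D" using * assms(2) unfolding on_path_def by (meson rtrancl_trans)
  then show False using assms anc_antisym unfolding exits_at_def by blast
qed

lemma exits_at_unique:
  assumes "exits_at D s u" "exits_at D s' u" "s \<preceq> D" "s' \<preceq> D"
  shows "s = s'"
  using assms anc_antisym unfolding exits_at_def by blast

text \<open>\<open>u\<close> never reaches \<open>D\<close>, so the two paths can only meet above
  it. There \<open>z\<close> occupies everything from \<open>hi z\<close> down to \<open>D\<close>,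
  and \<open>u\<close> nothing below \<open>s\<close>.\<close>

lemma exits_at_adjacent:
  assumes u: "exits_at D s u" "s \<preceq> D" "s \<noteq> D"
    and z: "z \<in> pverts G" "hi z \<preceq> D" "D \<preceq> lo z"
  shows "(u, z) \<in> parcs G \<longleftrightarrow> hi z \<preceq> s"
proof -
  have uV: "u \<in> pverts G" using u(1) unfolding exits_at_def by blast
  have ne: "u \<noteq> z" using exits_at_not_below[OF u] z by blast
  show ?thesis
  proof
    assume "(u, z) \<in> parcs G"
    then obtain q where q: "on_path u q" "on_path z q" using arcs_on_path[OF uV z(1) ne] by blast
    have "q \<preceq> D"
    proof (rule ccontr)
      assume "\<not> q \<preceq> D"
      then have "D \<preceq> q" using anc_linear[of q "lo z" D] q(2) z(3) unfolding on_path_def by blast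
      then show False using exits_at_not_below[OF u] q(1) unfolding on_path_def
        by (meson rtrancl_trans)
    qed
    then have "q \<preceq> s" using u(1) q(1) unfolding exits_at_def by blast
    then show "hi z \<preceq> s" using q(2) unfolding on_path_def by (meson rtrancl_trans)
  next
    assume "hi z \<preceq> s"
    moreover have "s \<preceq> lo z" using u(2) z(3) by (meson rtrancl_trans)
    ultimately have "on_path z s" unfolding on_path_def by blast
    then show "(u, z) \<in> parcs G"
      using arcs_on_path[OF uV z(1) ne] u(1) unfolding exits_at_def by blast
  qed
qed

text \<open>A path through \<open>y\<close> that misses the parent \<open>p\<close> cannot have
  begun higher: every strict ancestor of \<open>y\<close> is an ancestor of \<open>p\<close>, so
  \<open>p\<close> would lie on it.\<close>

lemma starting_vertex_exists:
  assumes "(p, y) \<in> E"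
  shows "\<exists>v\<in>pverts G. hi v = y"
proof -
  obtain v where v: "v \<in> pverts G" "hi v \<preceq> y" "y \<preceq> lo v" "\<not> (hi v \<preceq> p \<and> p \<preceq> lo v)"
    using min_lower[OF assms] by blast
  have "p \<preceq> lo v" using assms v(3) by (meson converse_rtrancl_into_rtrancl)
  then have "hi v = y" using v anc_parent[OF v(2) assms] by blast
  then show ?thesis using v by blast
qed

definition start_vertex :: "'n \<Rightarrow> 'v" where
  "start_vertex y = (SOME v. v \<in> pverts G \<and> hi v = y)"

lemma start_vertex:
  assumes "(p, y) \<in> E"
  shows "start_vertex y \<in> pverts G" "hi (start_vertex y) = y"
proof -
  have "\<exists>v. v \<in> pverts G \<and> hi v = y" using starting_vertex_exists[OF assms] by blast
  then have "start_vertex y \<in> pverts G \<and> hi (start_vertex y) = y"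
    unfolding start_vertex_def by (rule someI_ex)
  then show "start_vertex y \<in> pverts G" "hi (start_vertex y) = y" by auto
qed

text \<open>\<open>z\<close> starts strictly higher than \<open>v\<close>, and a shared node lies
  below \<open>hi v\<close>, so only the lower end of \<open>z\<close> decides.\<close>

lemma starts_at_adjacent:
  assumes v: "v \<in> pverts G" and z: "z \<in> pverts G" and "hi z \<preceq> hi v" "hi z \<noteq> hi v"
  shows "(v, z) \<in> parcs G \<longleftrightarrow> hi v \<preceq> lo z"
proof -
  have ne: "v \<noteq> z" using assms by blast
  show ?thesis
  proof
    assume "(v, z) \<in> parcs G"
    then show "hi v \<preceq> lo z"
      unfolding arcs_on_path[OF v z ne] on_path_def by (meson rtrancl_trans)
  next
    assume "hi v \<preceq> lo z"
    then have "on_path v (hi v)" "on_path z (hi v)"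
      using hi_lo[OF v] assms(3) unfolding on_path_def by auto
    then show "(v, z) \<in> parcs G" unfolding arcs_on_path[OF v z ne] by blast
  qed
qed

end

section \<open>Lexicographically ordered sets\<close>

text \<open>The first differing element, read from below, belongs to \<open>A\<close>.\<close>

definition lex_ge :: "nat set \<Rightarrow> nat set \<Rightarrow> bool" where
  "lex_ge A B \<longleftrightarrow> (\<forall>s\<in>B - A. \<exists>s'<s. s' \<in> A - B)"

text \<open>
  \<open>\<kappa> i a\<close> is the sibling containing the \<open>i\<close>-th vertex of group \<open>a\<close>, and
  \<open>H A n\<close> consists of the siblings between those used by the groups \<open>A, \<dots>, A + n - 1\<close>.
  A common initial segment \<open>F\<close> of their sets is extended by one element as long as the next
  elements agree on some of the \<open>2 * \<tau>\<close> subintervals; otherwise the next elements increase.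
\<close>

lemma lex_increasing_representatives:
  fixes S :: "nat \<Rightarrow> nat set" and \<kappa> h :: "nat \<Rightarrow> nat \<Rightarrow> nat" and \<tau> m :: nat
  defines "H \<equiv> \<lambda>A n. {c. \<exists>i<m. \<exists>i'<m. \<kappa> i A \<le> c \<and> c \<le> \<kappa> i' (A + n - 1)}"
  assumes tau: "0 < \<tau>" "\<tau> \<le> m"
    and bounded: "\<And>c. S c \<subseteq> {..<B}"
    and lex: "\<And>a b i i' c c'. i < m \<Longrightarrow> i' < m \<Longrightarrow> b < N \<Longrightarrow> \<kappa> i a \<le> c \<Longrightarrow> c < c' \<Longrightarrow> c' \<le> \<kappa> i' b \<Longrightarrow>
      lex_ge (S c) (S c')"
    and \<kappa>: "\<And>a b i i'. i < m \<Longrightarrow> i' < m \<Longrightarrow> a < b \<Longrightarrow> b < N \<Longrightarrow> \<kappa> i a < \<kappa> i' b"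
    and h: "\<And>i a. i < \<tau> \<Longrightarrow> a < N \<Longrightarrow> h i a \<in> S (\<kappa> i a)"
    and h_mono: "\<And>i i' a. i < i' \<Longrightarrow> i' < \<tau> \<Longrightarrow> a < N \<Longrightarrow> h i a < h i' a"
    and start: "A\<^sub>0 + (2 * \<tau>) ^ Suc k\<^sub>0 \<le> N" "finite F\<^sub>0" "\<tau> \<le> card F\<^sub>0 + k\<^sub>0"
      "\<And>c. c \<in> H A\<^sub>0 ((2 * \<tau>) ^ Suc k\<^sub>0) \<Longrightarrow> F\<^sub>0 \<subseteq> S c \<and> (\<forall>s\<in>S c - F\<^sub>0. \<forall>f\<in>F\<^sub>0. f < s)"
  shows "\<exists>\<alpha>. (\<forall>b<\<tau>. \<alpha> b < N) \<and> (\<forall>b b'. b < b' \<longrightarrow> b' < \<tau> \<longrightarrow> \<alpha> b < \<alpha> b') \<and>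
      (\<forall>\<sigma>. (\<forall>b<\<tau>. \<sigma> b < m) \<longrightarrow> (\<exists>s. (\<forall>b<\<tau>. s b \<in> S (\<kappa> (\<sigma> b) (\<alpha> b))) \<and>
         (\<forall>b b'. b < b' \<longrightarrow> b' < \<tau> \<longrightarrow> s b < (s b' :: nat))))" (is ?R)
proof -
  have m0: "0 < m" using tau by linarith
  have memH: "\<kappa> i b \<in> H A n" if "i < m" "A \<le> b" "b < A + n" "A + n \<le> N" for i b A n
  proof -
    have "\<kappa> i A \<le> \<kappa> i b" using \<kappa>[of i i A b] that by (cases "A = b") auto
    moreover have "\<kappa> i b \<le> \<kappa> i (A + n - 1)"
    proof (cases "b = A + n - 1")
      case False
      then have "b < A + n - 1" "A + n - 1 < N" using that by linarith+
      then show ?thesis using \<kappa>[of i i b "A + n - 1"] that by simp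
    qed auto
    ultimately show ?thesis unfolding H_def using that by blast
  qed
  \<comment> \<open>One common set with \<tau> elements serves every \<sigma>: the representatives
    are its elements in increasing order, whichever siblings are chosen.\<close>
  have full: ?R
    if n: "A + n \<le> N" "2 * \<tau> \<le> n" and F: "finite F" "\<tau> \<le> card F"
      and sub: "\<And>c. c \<in> H A n \<Longrightarrow> F \<subseteq> S c" for A n and F :: "nat set"
  proof -
    define s where "s b = sorted_list_of_set F ! b" for b
    have s: "s b \<in> F" if "b < \<tau>" for b
      using that F nth_mem[of b "sorted_list_of_set F"] unfolding s_def by simp
    have s_mono: "s b < s b'" if "b < b'" "b' < \<tau>" for b b'
      using that F strict_sorted_list_of_set[of F] unfolding s_def
      by (intro sorted_wrt_nth_less[of "(<)"]) auto
    have "A + b < N \<and> (\<forall>i<m. F \<subseteq> S (\<kappa> i (A + b)))" if b: "b < \<tau>" for b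
    proof (intro conjI allI impI)
      show bN: "A + b < N" using n b tau by linarith
      fix i assume "i < m"
      then have "\<kappa> i (A + b) \<in> H A n" using n b tau by (intro memH) auto
      then show "F \<subseteq> S (\<kappa> i (A + b))" by (rule sub)
    qed
    note in_S = this
    have "\<exists>s. (\<forall>b<\<tau>. s b \<in> S (\<kappa> (\<sigma> b) (A + b))) \<and> (\<forall>b b'. b < b' \<longrightarrow> b' < \<tau> \<longrightarrow> s b < s b')"
      if "\<forall>b<\<tau>. \<sigma> b < m" for \<sigma>
      using in_S s s_mono that by (intro exI[of _ s]) blast
    then show ?thesis using in_S by (intro exI[of _ "\<lambda>b. A + b"]) auto
  qed
  \<comment> \<open>\<open>k\<close> bounds how many elements \<open>F\<close> still lacks. Each
    extension of \<open>F\<close> shrinks the window of groups by a factor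
    \<open>2 * \<tau>\<close>, which is where the power comes from.\<close>
  have ?R if "A + (2 * \<tau>) ^ Suc k \<le> N" "finite F" "\<tau> \<le> card F + k"
      "\<And>c. c \<in> H A ((2 * \<tau>) ^ Suc k) \<Longrightarrow> F \<subseteq> S c \<and> (\<forall>s\<in>S c - F. \<forall>f\<in>F. f < s)" for A k F
    using that
  proof (induction k arbitrary: A F)
    case 0
    show ?case by (rule full[of A "(2 * \<tau>) ^ Suc 0" F]) (use 0 in auto)
  next
    case (Suc k)
    define n where "n = (2 * \<tau>) ^ Suc k"
    have n2: "2 * \<tau> \<le> n" "0 < n" using tau unfolding n_def by (auto simp: Suc_le_eq)
    have nS: "(2 * \<tau>) ^ Suc (Suc k) = 2 * \<tau> * n" unfolding n_def by simp
    have nN: "A + 2 * \<tau> * n \<le> N" using Suc.prems(1) unfolding nS .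
    have n4: "2 * \<tau> \<le> 2 * \<tau> * n" "0 < 2 * \<tau> * n" using n2 tau by auto
    have inH: "F \<subseteq> S c" "s \<in> S c \<Longrightarrow> s \<notin> F \<Longrightarrow> f \<in> F \<Longrightarrow> f < s"
      if "c \<in> H A (2 * \<tau> * n)" for c s f
      using Suc.prems(4) that unfolding nS by blast+
    show ?case
    proof (cases "\<tau> \<le> card F")
      case True
      show ?thesis
        by (rule full[OF nN n4(1) Suc.prems(2) True inH(1)])
    next
      case False
      \<comment> \<open>A sibling without further elements receives \<open>B\<close>, which exceeds
        every element, so that exhausted siblings sort last and monotonicity has no
        exception.\<close>
      define nx where "nx c = (if S c - F = {} then B else Min (S c - F))" for c
      have finS: "finite (S c)" for c using bounded[of c] finite_subset by blast
      have nx_in: "nx c \<in> S c - F" if "nx c < B" for c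
        using that finS Min_in[of "S c - F"] unfolding nx_def by (auto split: if_splits)
      have nx_le: "nx c \<le> s" if "s \<in> S c" "s \<notin> F" for c s
        using that finS Min_le[of "S c - F" s] unfolding nx_def by auto
      have nx_B: "nx c \<le> B" for c
      proof (cases "S c - F = {}")
        case False
        then have "Min (S c - F) \<in> S c" using finS Min_in[of "S c - F"] by blast
        then have "Min (S c - F) < B" using bounded[of c] by blast
        then show ?thesis using False by (simp add: nx_def)
      qed (auto simp: nx_def)
      \<comment> \<open>A smaller next element at the later sibling would be missing from
        \<open>S c\<close>. The lexicographic order then gives a still smaller element of
        \<open>S c\<close> outside \<open>S c'\<close>, hence outside \<open>F\<close>, against the
        choice of \<open>nx c\<close>.\<close>
      have nx_mono: "nx c \<le> nx c'" if c: "c \<in> H A (2 * \<tau> * n)" "c' \<in> H A (2 * \<tau> * n)" "c \<le> c'" for c c'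
      proof (rule ccontr)
        assume "\<not> nx c \<le> nx c'"
        then have lt: "nx c' < nx c" by simp
        then have ne: "c < c'" using c(3) by (cases "c = c'") auto
        have "nx c' \<in> S c' - F" using lt nx_B[of c] by (intro nx_in) simp
        moreover have "nx c' \<notin> S c" using nx_le[of "nx c'" c] lt calculation by auto
        moreover have "lex_ge (S c) (S c')"
        proof -
          obtain i j where "i < m" "j < m" "\<kappa> i A \<le> c" "c' \<le> \<kappa> j (A + 2 * \<tau> * n - 1)"
            using c unfolding H_def by blast
          moreover have "A + 2 * \<tau> * n - 1 < N" using nN n4 by linarith
          ultimately show ?thesis using ne by (intro lex[of i j "A + 2 * \<tau> * n - 1" A])
        qed
        ultimately obtain s' where s': "s' < nx c'" "s' \<in> S c" "s' \<notin> S c'"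
          unfolding lex_ge_def by blast
        have "s' \<notin> F" using s'(3) inH(1)[OF c(2)] by blast
        then have "nx c \<le> s'" using nx_le s'(2) by blast
        then show False using lt s'(1) by linarith
      qed
      define st where "st b = A + b * n" for b
      have st: "st b + n \<le> A + 2 * \<tau> * n" if "b < 2 * \<tau>" for b
        using mult_le_mono1[of "Suc b" "2 * \<tau>" n] that unfolding st_def by simp
      have stN: "st b + n \<le> N" if "b < 2 * \<tau>" for b
        using st[OF that] nN by linarith
      have st_less: "st b + n \<le> st b'" if "b < b'" for b b'
        using mult_le_mono1[of "Suc b" b' n] that unfolding st_def by simp
      have sub: "c \<in> H A (2 * \<tau> * n)" if b: "b < 2 * \<tau>" and c: "c \<in> H (st b) n" for b c
      proof -
        obtain i i' where i: "i < m" "i' < m" "\<kappa> i (st b) \<le> c" "c \<le> \<kappa> i' (st b + n - 1)"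
          using c unfolding H_def by blast
        have "\<exists>j<m. \<kappa> j A \<le> c"
        proof (cases "A < st b")
          case True
          then have "\<kappa> 0 A < \<kappa> i (st b)" using stN[OF b] n2 i m0 by (intro \<kappa>) auto
          then show ?thesis using i m0 by (meson le_trans less_imp_le)
        next
          case False
          then show ?thesis using i unfolding st_def by auto
        qed
        moreover have "\<exists>j<m. c \<le> \<kappa> j (A + 2 * \<tau> * n - 1)"
        proof (cases "st b + n - 1 < A + 2 * \<tau> * n - 1")
          case True
          then have "\<kappa> i' (st b + n - 1) < \<kappa> 0 (A + 2 * \<tau> * n - 1)"
            using nN n4(2) i m0 by (intro \<kappa>) linarith+
          then show ?thesis using i m0 by (meson le_trans less_imp_le)
        next
          case False
          then have "st b + n - 1 = A + 2 * \<tau> * n - 1" using st[OF b] by linarith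
          then show ?thesis using i by auto
        qed
        ultimately show ?thesis unfolding H_def by blast
      qed
      show ?thesis
      proof (cases "\<exists>b<2 * \<tau>. \<exists>v. \<forall>c\<in>H (st b) n. nx c = v")
        case True
        then obtain b v where b: "b < 2 * \<tau>" and v: "\<And>c. c \<in> H (st b) n \<Longrightarrow> nx c = v" by blast
        have stb: "st b < N" using stN[OF b] n2 by linarith
        \<comment> \<open>The \<tau> values \<open>h i (st b)\<close> are distinct and
          \<open>F\<close> has fewer elements, so some sibling of the block has an element outside
          \<open>F\<close>; hence the constant value is not the default \<open>B\<close>.\<close>
        have "\<exists>i<\<tau>. h i (st b) \<notin> F"
        proof (rule ccontr)
          assume "\<not> ?thesis"
          then have "(\<lambda>i. h i (st b)) ` {..<\<tau>} \<subseteq> F" by auto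
          moreover have "inj_on (\<lambda>i. h i (st b)) {..<\<tau>}"
            using h_mono[OF _ _ stb] by (intro linorder_inj_onI) (auto, fastforce)
          ultimately have "\<tau> \<le> card F"
            using card_inj_on_le[of _ "{..<\<tau>}" F] Suc.prems(2) by fastforce
          then show False using \<open>\<not> \<tau> \<le> card F\<close> by simp
        qed
        then obtain i where i: "i < \<tau>" "h i (st b) \<notin> F" by blast
        have memb: "\<kappa> i (st b) \<in> H (st b) n"
          using i tau n2 stN[OF b] by (intro memH) auto
        then have vh: "v \<le> h i (st b)" using v nx_le[OF h[OF i(1) stb] i(2)] by fastforce
        have vB: "v < B" using vh h[OF i(1) stb] bounded by (meson lessThan_iff order_le_less_trans subsetD)
        have vF: "v \<in> S c - F" if "c \<in> H (st b) n" for c using nx_in[of c] v[OF that] vB by simp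
        have "v \<notin> F" using vF[OF memb] by blast
        show ?thesis
        proof (rule Suc.IH[of "st b" "insert v F"])
          show "st b + (2 * \<tau>) ^ Suc k \<le> N" using stN[OF b] unfolding n_def .
          show "finite (insert v F)" using Suc.prems by simp
          show "\<tau> \<le> card (insert v F) + k" using \<open>v \<notin> F\<close> Suc.prems by simp
          fix c assume c: "c \<in> H (st b) ((2 * \<tau>) ^ Suc k)"
          then have c': "c \<in> H (st b) n" unfolding n_def .
          have cc: "c \<in> H A (2 * \<tau> * n)" by (rule sub[OF b c'])
          have "f < s" if "s \<in> S c - insert v F" "f \<in> insert v F" for f s
          proof (cases "f = v")
            case True
            then show ?thesis using nx_le[of s c] v[OF c'] that by auto
          next
            case False
            then show ?thesis using inH(2)[OF cc, of s f] that by auto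
          qed
          then show "insert v F \<subseteq> S c \<and> (\<forall>s\<in>S c - insert v F. \<forall>f\<in>insert v F. f < s)"
            using inH(1)[OF cc] vF[OF c'] by blast
        qed
      next
        case False
        have nonconst: "\<exists>x x'. x \<in> H (st b) n \<and> x' \<in> H (st b) n \<and> nx x < nx x'" if "b < 2 * \<tau>" for b
          using False that by (metis linorder_neqE_nat)
        \<comment> \<open>Representatives come from the first group of each even block. On the odd
          block that follows, \<open>nx\<close> is not constant; this forces a strict increase and
          keeps the chosen values below \<open>B\<close>, whichever siblings are used.\<close>
        define \<alpha> where "\<alpha> b = st (2 * b)" for b
        have \<alpha>N: "\<alpha> b < N" if "b < \<tau>" for b
          using stN[of "2 * b"] that n2 unfolding \<alpha>_def by simp
        have \<alpha>_mono: "\<alpha> b < \<alpha> b'" if "b < b'" for b b'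
          using st_less[of "2 * b" "2 * b'"] that n2 unfolding \<alpha>_def by simp
        have Hl: "c < x" if ax: "x \<in> H (st b) n" "c = \<kappa> i a" "i < m" "a < st b" "b < 2 * \<tau>" for c x b i a
        proof -
          obtain j where j: "j < m" "\<kappa> j (st b) \<le> x" using ax(1) unfolding H_def by auto
          have "\<kappa> i a < \<kappa> j (st b)" using ax stN[OF ax(5)] n2 j by (intro \<kappa>) auto
          then show ?thesis using j ax by simp
        qed
        have Hr: "x < c" if ax: "x \<in> H (st b) n" "c = \<kappa> i a" "i < m" "st b + n \<le> a" "a < N" for c x b i a
        proof -
          obtain j where j: "j < m" "x \<le> \<kappa> j (st b + n - 1)" using ax(1) unfolding H_def by auto
          have "\<kappa> j (st b + n - 1) < \<kappa> i a" using ax n2 j by (intro \<kappa>) auto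
          then show ?thesis using j ax by simp
        qed
        have sel: "\<forall>\<sigma>. (\<forall>b<\<tau>. \<sigma> b < m) \<longrightarrow> (\<exists>s. (\<forall>b<\<tau>. s b \<in> S (\<kappa> (\<sigma> b) (\<alpha> b))) \<and>
            (\<forall>b b'. b < b' \<longrightarrow> b' < \<tau> \<longrightarrow> s b < s b'))"
        proof (rule allI, rule impI)
          fix \<sigma> assume \<sigma>: "\<forall>b<\<tau>. \<sigma> b < m"
          have cH: "\<kappa> (\<sigma> b) (\<alpha> b) \<in> H A (2 * \<tau> * n)" if b: "b < \<tau>" for b
          proof (rule sub)
            show "2 * b < 2 * \<tau>" using b by simp
            show "\<kappa> (\<sigma> b) (\<alpha> b) \<in> H (st (2 * b)) n"
              using \<sigma> b n2 stN[of "2 * b"] unfolding \<alpha>_def by (intro memH) auto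
          qed
          have step: "\<exists>x x'. \<kappa> (\<sigma> b) (\<alpha> b) < x \<and> x \<in> H (st (2 * b + 1)) n \<and> x' \<in> H (st (2 * b + 1)) n \<and>
              nx (\<kappa> (\<sigma> b) (\<alpha> b)) \<le> nx x \<and> nx x < nx x'" if b: "b < \<tau>" for b
          proof -
            have b2: "2 * b + 1 < 2 * \<tau>" using b by simp
            obtain x x' where x: "x \<in> H (st (2 * b + 1)) n" "x' \<in> H (st (2 * b + 1)) n" "nx x < nx x'"
              using nonconst[OF b2] by blast
            have "\<alpha> b < st (2 * b + 1)" using st_less[of "2 * b" "2 * b + 1"] n2 unfolding \<alpha>_def by simp
            then have l: "\<kappa> (\<sigma> b) (\<alpha> b) < x" using Hl[OF x(1) refl _ _ b2] \<sigma> b by blast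
            then have "nx (\<kappa> (\<sigma> b) (\<alpha> b)) \<le> nx x"
              using cH[OF b] sub[OF b2 x(1)] by (intro nx_mono) auto
            then show ?thesis using l x by blast
          qed
          have in_S: "nx (\<kappa> (\<sigma> b) (\<alpha> b)) \<in> S (\<kappa> (\<sigma> b) (\<alpha> b))" if bt: "b < \<tau>" for b
          proof -
            obtain x x' where "nx (\<kappa> (\<sigma> b) (\<alpha> b)) \<le> nx x" "nx x < nx x'"
              using step[OF bt] by auto
            then have "nx (\<kappa> (\<sigma> b) (\<alpha> b)) < B" using nx_B[of x'] by linarith
            then show ?thesis using nx_in by blast
          qed
          have less: "nx (\<kappa> (\<sigma> b) (\<alpha> b)) < nx (\<kappa> (\<sigma> b') (\<alpha> b'))" if b: "b < b'" "b' < \<tau>" for b b'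
          proof -
            have bt: "b < \<tau>" and b2: "2 * b + 1 < 2 * \<tau>" using b by auto
            obtain x x' where x: "x' \<in> H (st (2 * b + 1)) n" "nx (\<kappa> (\<sigma> b) (\<alpha> b)) \<le> nx x" "nx x < nx x'"
              using step[OF bt] by blast
            have "st (2 * b + 1) + n \<le> \<alpha> b'" using st_less[of "2 * b + 1" "2 * b'"] b unfolding \<alpha>_def by simp
            then have "x' < \<kappa> (\<sigma> b') (\<alpha> b')" using Hr[OF x(1) refl] \<sigma> b \<alpha>N by blast
            then have "nx x' \<le> nx (\<kappa> (\<sigma> b') (\<alpha> b'))"
              using cH[OF b(2)] sub[OF b2 x(1)] by (intro nx_mono) auto
            then show ?thesis using x by linarith
          qed
          show "\<exists>s. (\<forall>b<\<tau>. s b \<in> S (\<kappa> (\<sigma> b) (\<alpha> b))) \<and> (\<forall>b b'. b < b' \<longrightarrow> b' < \<tau> \<longrightarrow> s b < s b')"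
            using in_S less by (intro exI[of _ "\<lambda>b. nx (\<kappa> (\<sigma> b) (\<alpha> b))"]) simp
        qed
        have "\<forall>b<\<tau>. \<alpha> b < N" "\<forall>b b'. b < b' \<longrightarrow> b' < \<tau> \<longrightarrow> \<alpha> b < \<alpha> b'"
          using \<alpha>N \<alpha>_mono by simp_all
        then show ?thesis using sel by (intro exI[of _ \<alpha>] conjI)
      qed
    qed
  qed
  from this[OF start] show ?R .
qed

section \<open>Recognizing transversal pairs\<close>

definition lex_rank :: "nat \<Rightarrow> nat \<Rightarrow> nat \<Rightarrow> nat" where
  "lex_rank t i j = (i - 1) * t + (j - 1)"

lemma lex_rank_less: "i \<in> {1..t} \<Longrightarrow> j \<in> {1..t} \<Longrightarrow> lex_rank t i j < t\<^sup>2"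
proof -
  assume ij: "i \<in> {1..t}" "j \<in> {1..t}"
  then have "(i - 1) * t + (j - 1) < (i - 1) * t + t" by auto
  also have "\<dots> = i * t" using ij by (cases i) auto
  also have "\<dots> \<le> t\<^sup>2" using ij by (simp add: power2_eq_square)
  finally show ?thesis unfolding lex_rank_def .
qed

lemma lex_rank_less_if:
  assumes "i < i'" "i \<in> {1..t}" "j \<in> {1..t}"
  shows "lex_rank t i j < lex_rank t i' j'"
proof -
  have "(i - 1) * t + (j - 1) < (i - 1) * t + t" using assms by auto
  also have "\<dots> = i * t" using assms by (cases i) auto
  also have "\<dots> \<le> (i' - 1) * t" using assms by (intro mult_le_mono1) auto
  finally show ?thesis unfolding lex_rank_def by linarith
qed

lemma lex_rank_le_iff:
  assumes "i \<in> {1..t}" "j \<in> {1..t}" "i' \<in> {1..t}" "j' \<in> {1..t}"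
  shows "lex_rank t i j \<le> lex_rank t i' j' \<longleftrightarrow> lex_le (i, j) (i', j')"
proof -
  consider "i < i'" | "i' < i" | "i = i'" by linarith
  then show ?thesis
  proof cases
    case 1
    then show ?thesis using lex_rank_less_if[OF 1 assms(1,2)] by (auto simp: lex_le_def less_imp_le)
  next
    case 2
    then show ?thesis using lex_rank_less_if[OF 2 assms(3,4), of j] by (auto simp: lex_le_def)
  next
    case 3
    then show ?thesis using assms by (auto simp: lex_le_def lex_rank_def)
  qed
qed

lemma lex_le_antisym: "lex_le p q \<Longrightarrow> lex_le q p \<Longrightarrow> p = q"
  by (auto simp: lex_le_def prod_eq_iff)

lemma lex_le_refl: "lex_le p p"
  by (simp add: lex_le_def)

inductive_simps tp_edge_AB: "tp_edge l (VA i j) (VB k i' j')"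
inductive_simps tp_edge_BA: "tp_edge l (VB k i' j') (VA i j)"
inductive_simps tp_edge_BB: "tp_edge l (VB k i j) (VB k' i' j')"
inductive_simps tp_edge_BC: "tp_edge l (VB k i j) (VC i' j')"
inductive_simps tp_edge_CB: "tp_edge l (VC i' j') (VB k i j)"

lemmas tp_edge_simps = tp_edge_AB tp_edge_BA tp_edge_BB tp_edge_BC tp_edge_CB

text \<open>The embedding must be injective even across sets whose mutual edges are unconstrained,
  so every pair of families comes with its own distinctness condition.\<close>

lemma semi_induced_transversal_pairI:
  fixes a c :: "nat \<Rightarrow> nat \<Rightarrow> 'v" and b :: "nat \<Rightarrow> nat \<Rightarrow> nat \<Rightarrow> 'v"
  assumes V: "\<And>i j. i \<in> {1..t} \<Longrightarrow> j \<in> {1..t} \<Longrightarrow> a i j \<in> pverts G"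
      "\<And>k i j. k \<le> l \<Longrightarrow> i \<in> {1..t} \<Longrightarrow> j \<in> {1..t} \<Longrightarrow> b k i j \<in> pverts G"
      "\<And>i j. i \<in> {1..t} \<Longrightarrow> j \<in> {1..t} \<Longrightarrow> c i j \<in> pverts G"
    and a_inj: "\<And>i j i' j'. i \<in> {1..t} \<Longrightarrow> j \<in> {1..t} \<Longrightarrow> i' \<in> {1..t} \<Longrightarrow> j' \<in> {1..t} \<Longrightarrow>
      a i j = a i' j' \<Longrightarrow> i = i' \<and> j = j'"
    and b_inj: "\<And>k k' i j i' j'. k \<le> l \<Longrightarrow> k' \<le> l \<Longrightarrow> i \<in> {1..t} \<Longrightarrow> j \<in> {1..t} \<Longrightarrow> i' \<in> {1..t} \<Longrightarrow> j' \<in> {1..t} \<Longrightarrow>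
      b k i j = b k' i' j' \<Longrightarrow> k = k' \<and> i = i' \<and> j = j'"
    and c_inj: "\<And>i j i' j'. i \<in> {1..t} \<Longrightarrow> j \<in> {1..t} \<Longrightarrow> i' \<in> {1..t} \<Longrightarrow> j' \<in> {1..t} \<Longrightarrow>
      c i j = c i' j' \<Longrightarrow> i = i' \<and> j = j'"
    and ne: "\<And>k i j i' j'. k \<le> l \<Longrightarrow> i \<in> {1..t} \<Longrightarrow> j \<in> {1..t} \<Longrightarrow> i' \<in> {1..t} \<Longrightarrow> j' \<in> {1..t} \<Longrightarrow> a i j \<noteq> b k i' j'"
      "\<And>k i j i' j'. k \<le> l \<Longrightarrow> i \<in> {1..t} \<Longrightarrow> j \<in> {1..t} \<Longrightarrow> i' \<in> {1..t} \<Longrightarrow> j' \<in> {1..t} \<Longrightarrow> c i j \<noteq> b k i' j'"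
      "\<And>i j i' j'. i \<in> {1..t} \<Longrightarrow> j \<in> {1..t} \<Longrightarrow> i' \<in> {1..t} \<Longrightarrow> j' \<in> {1..t} \<Longrightarrow> a i j \<noteq> c i' j'"
    and ab: "\<And>i j i' j'. i \<in> {1..t} \<Longrightarrow> j \<in> {1..t} \<Longrightarrow> i' \<in> {1..t} \<Longrightarrow> j' \<in> {1..t} \<Longrightarrow>
      (a i j, b 0 i' j') \<in> parcs G \<longleftrightarrow> lex_le (i, j) (i', j')"
    and bb: "\<And>k i j i' j'. k < l \<Longrightarrow> i \<in> {1..t} \<Longrightarrow> j \<in> {1..t} \<Longrightarrow> i' \<in> {1..t} \<Longrightarrow> j' \<in> {1..t} \<Longrightarrow>
      (b k i j, b (Suc k) i' j') \<in> parcs G \<longleftrightarrow> i = i' \<and> j = j'"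
    and bc: "\<And>i j i' j'. i \<in> {1..t} \<Longrightarrow> j \<in> {1..t} \<Longrightarrow> i' \<in> {1..t} \<Longrightarrow> j' \<in> {1..t} \<Longrightarrow>
      (b l i j, c i' j') \<in> parcs G \<longleftrightarrow> lex_le (j, i) (j', i')"
  shows "semi_induced_transversal_pair t l G"
proof -
  define f where "f x = (case x of VA i j \<Rightarrow> a i j | VB k i j \<Rightarrow> b k i j | VC i j \<Rightarrow> c i j)" for x
  have f: "f (VA i j) = a i j" "f (VB k i j) = b k i j" "f (VC i j) = c i j" for i j k
    by (simp_all add: f_def)
  have mem: "VA i j \<in> tp_verts t l \<longleftrightarrow> i \<in> {1..t} \<and> j \<in> {1..t}"
    "VB k i j \<in> tp_verts t l \<longleftrightarrow> k \<le> l \<and> i \<in> {1..t} \<and> j \<in> {1..t}"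
    "VC i j \<in> tp_verts t l \<longleftrightarrow> i \<in> {1..t} \<and> j \<in> {1..t}" for i j k
    by (auto simp: tp_verts_def)
  have pv: "pverts (transversal_pair t l) = tp_verts t l" by (simp add: transversal_pair_def)
  have inj: "x = y" if "x \<in> tp_verts t l" "y \<in> tp_verts t l" "f x = f y" for x y
  proof (cases x)
    case VA: (VA i j)
    show ?thesis
    proof (cases y)
      case (VA i' j')
      then show ?thesis using that \<open>x = VA i j\<close> a_inj[of i j i' j'] by (simp add: f mem)
    next
      case (VB k' i' j')
      then show ?thesis using that ne(1)[of k' i j i' j'] unfolding VA by (simp add: f mem)
    next
      case (VC i' j')
      then show ?thesis using that ne(3)[of i j i' j'] unfolding VA by (simp add: f mem)
    qed
  next
    case VB: (VB k i j)
    show ?thesis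
    proof (cases y)
      case (VA i' j')
      then show ?thesis using that ne(1)[of k i' j' i j] unfolding VB by (simp add: f mem)
    next
      case (VB k' i' j')
      then show ?thesis using that b_inj[of k k' i j i' j'] unfolding \<open>x = VB k i j\<close> by (simp add: f mem)
    next
      case (VC i' j')
      then show ?thesis using that ne(2)[of k i' j' i j] unfolding VB by (simp add: f mem)
    qed
  next
    case VC: (VC i j)
    show ?thesis
    proof (cases y)
      case (VA i' j')
      then show ?thesis using that ne(3)[of i' j' i j] unfolding VC by (simp add: f mem)
    next
      case (VB k' i' j')
      then show ?thesis using that ne(2)[of k' i j i' j'] unfolding VC by (simp add: f mem)
    next
      case (VC i' j')
      then show ?thesis using that \<open>x = VC i j\<close> c_inj[of i j i' j'] by (simp add: f mem)
    qed
  qed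
  have V': "f x \<in> pverts G" if "x \<in> tp_verts t l" for x
    using that V by (cases x) (simp_all add: f mem)
  have arcs: "(f x, f y) \<in> parcs G \<longleftrightarrow> (x, y) \<in> parcs (transversal_pair t l)"
    if x: "x \<in> tp_verts t l" and y: "y \<in> tp_verts t l" and lay: "tp_layer l y = tp_layer l x + 1" for x y
  proof -
    have *: "(x, y) \<in> parcs (transversal_pair t l) \<longleftrightarrow> tp_edge l x y \<or> tp_edge l y x"
      using x y by (simp add: transversal_pair_def)
    show ?thesis
    proof (cases x)
      case (VA i j)
      then obtain i' j' where "y = VB 0 i' j'" using y lay by (cases y) (auto simp: mem)
      then show ?thesis using x y ab VA unfolding * by (simp add: f mem tp_edge_simps)
    next
      case (VB k i j)
      show ?thesis
      proof (cases y)
        case (VB k' i' j')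
        then have "k' = Suc k" "k < l" using lay y \<open>x = VB k i j\<close> by (auto simp: mem)
        then show ?thesis using x y bb VB \<open>x = VB k i j\<close> unfolding * by (auto simp: f mem tp_edge_simps)
      next
        case (VC i' j')
        then have "k = l" using lay \<open>x = VB k i j\<close> by auto
        then show ?thesis using x y bc VC \<open>x = VB k i j\<close> unfolding * by (simp add: f mem tp_edge_simps)
      qed (use lay VB in auto)
    next
      case (VC i j)
      then show ?thesis using lay y by (cases y) (auto simp: mem)
    qed
  qed
  show ?thesis
    unfolding semi_induced_transversal_pair_def pv
    using inj V' arcs by (intro exI[of _ f] conjI inj_onI) auto
qed

section \<open>Transversal pairs from chains and from stars\<close>

context path_model
begin

text \<open>One family \<open>X\<close> serves both half-graphs: vertices leaving the path to
  \<open>D\<close> at the highest nodes test where a path begins, and vertices starting at the nodes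
  \<open>Y\<close> test how far it runs below \<open>D\<close>.\<close>

lemma transversal_pair_of_chain:
  assumes X: "\<And>i j. i \<in> {1..t} \<Longrightarrow> j \<in> {1..t} \<Longrightarrow>
      X i j \<in> pverts G \<and> hi (X i j) \<preceq> D \<and> hi (X i j) \<noteq> D \<and> D \<preceq> lo (X i j)"
    and X_order: "\<And>i j i' j'. i \<in> {1..t} \<Longrightarrow> j \<in> {1..t} \<Longrightarrow> i' \<in> {1..t} \<Longrightarrow> j' \<in> {1..t} \<Longrightarrow>
      depth (hi (X i' j')) \<le> depth (hi (X i j)) \<longleftrightarrow> lex_le (i, j) (i', j')"
    and Y: "\<And>i j. i \<in> {1..t} \<Longrightarrow> j \<in> {1..t} \<Longrightarrow> D \<preceq> Y i j"
    and XY: "\<And>i j i' j'. i \<in> {1..t} \<Longrightarrow> j \<in> {1..t} \<Longrightarrow> i' \<in> {1..t} \<Longrightarrow> j' \<in> {1..t} \<Longrightarrow>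
      Y i' j' \<preceq> lo (X i j) \<longleftrightarrow> lex_le (j, i) (j', i')"
  shows "semi_induced_transversal_pair t 0 G"
proof (rule semi_induced_transversal_pairI[where a = "\<lambda>i j. exit_vertex D (hi (X i j))"
      and b = "\<lambda>k. X" and c = "\<lambda>i j. start_vertex (Y i j)"])
  have ex: "exits_at D (hi (X i j)) (exit_vertex D (hi (X i j)))"
    if "i \<in> {1..t}" "j \<in> {1..t}" for i j
    using exits_at_exit_vertex X[OF that] by blast
  have st: "start_vertex (Y i j) \<in> pverts G \<and> hi (start_vertex (Y i j)) = Y i j"
    if "i \<in> {1..t}" "j \<in> {1..t}" for i j
  proof -
    have "hi (X i j) \<preceq> Y i j" using X[OF that] Y[OF that] by (meson rtrancl_trans)
    moreover have "hi (X i j) \<noteq> Y i j" using X[OF that] Y[OF that] anc_antisym by metis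
    ultimately obtain p where "(p, Y i j) \<in> E" by (meson rtranclE)
    then show ?thesis using start_vertex by blast
  qed
  have hiX: "hi (X i j) \<preceq> Y i' j' \<and> hi (X i j) \<noteq> Y i' j'"
    if "i \<in> {1..t}" "j \<in> {1..t}" "i' \<in> {1..t}" "j' \<in> {1..t}" for i j i' j'
    using X[OF that(1,2)] Y[OF that(3,4)] anc_antisym by (metis rtrancl_trans)
  have X_inj: "i = i' \<and> j = j'"
    if ij: "i \<in> {1..t}" "j \<in> {1..t}" "i' \<in> {1..t}" "j' \<in> {1..t}" and "hi (X i j) = hi (X i' j')" for i j i' j'
    using X_order[OF ij] X_order[OF ij(3,4,1,2)] lex_le_antisym that(5) by fastforce
  fix i j assume ij: "i \<in> {1..t}" "j \<in> {1..t}"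
  show "exit_vertex D (hi (X i j)) \<in> pverts G" using ex[OF ij] unfolding exits_at_def by blast
  show "X i j \<in> pverts G" using X[OF ij] by blast
  show "start_vertex (Y i j) \<in> pverts G" using st[OF ij] by blast
  fix i' j' assume ij': "i' \<in> {1..t}" "j' \<in> {1..t}"
  show "i = i' \<and> j = j'" if "exit_vertex D (hi (X i j)) = exit_vertex D (hi (X i' j'))"
    using exits_at_unique[of D "hi (X i j)" _ "hi (X i' j')"] ex[OF ij] ex[OF ij'] that X[OF ij] X[OF ij'] X_inj[OF ij ij']
    by metis
  show "k = k' \<and> i = i' \<and> j = j'" if "k \<le> 0" "k' \<le> 0" "X i j = X i' j'" for k k' :: nat
    using that X_inj[OF ij ij'] by simp
  show "i = i' \<and> j = j'" if eq: "start_vertex (Y i j) = start_vertex (Y i' j')"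
  proof -
    have "Y i j = Y i' j'" using st[OF ij] st[OF ij'] eq by metis
    then have "lex_le (j, i) (j', i')" "lex_le (j', i') (j, i)"
      using XY[OF ij ij] XY[OF ij ij'] XY[OF ij' ij] XY[OF ij' ij'] lex_le_refl by auto
    then show ?thesis using lex_le_antisym by blast
  qed
  show "exit_vertex D (hi (X i j)) \<noteq> X i' j'"
    using exits_at_not_below[OF ex[OF ij]] X[OF ij] X[OF ij'] by metis
  show "start_vertex (Y i j) \<noteq> X i' j'" using st[OF ij] hiX[OF ij' ij] by metis
  show "exit_vertex D (hi (X i j)) \<noteq> start_vertex (Y i' j')"
  proof
    assume eq: "exit_vertex D (hi (X i j)) = start_vertex (Y i' j')"
    have "D \<preceq> lo (start_vertex (Y i' j'))"
      using st[OF ij'] Y[OF ij'] hi_lo by (metis rtrancl_trans)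
    then show False using exits_at_not_below[OF ex[OF ij]] X[OF ij] eq by metis
  qed
  show "(exit_vertex D (hi (X i j)), X i' j') \<in> parcs G \<longleftrightarrow> lex_le (i, j) (i', j')"
    using exits_at_adjacent[OF ex[OF ij], of "X i' j'"] X[OF ij] X[OF ij'] X_order[OF ij ij']
      anc_iff_depth[of "hi (X i' j')" D "hi (X i j)"] by blast
  have "(start_vertex (Y i' j'), X i j) \<in> parcs G \<longleftrightarrow> lex_le (j, i) (j', i')"
    using starts_at_adjacent[of "start_vertex (Y i' j')" "X i j"] st[OF ij'] X[OF ij]
      XY[OF ij ij'] hiX[OF ij ij'] by metis
  then show "(X i j, start_vertex (Y i' j')) \<in> parcs G \<longleftrightarrow> lex_le (j, i) (j', i')"
    using arcs_sym[of "start_vertex (Y i' j')" "X i j"] st[OF ij'] X[OF ij] hiX[OF ij ij'] by metis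
qed simp_all

text \<open>Children of \<open>y\<close> are incomparable, so a vertex starting at
  \<open>K i j\<close> recognizes only its own child and yields a matching instead of a half-graph.
  The second order is again tested by exit vertices, now at the highest nodes of the partners
  \<open>W\<close>. These differ from the highest nodes of \<open>X\<close>, which keeps the two
  families of exit vertices disjoint.\<close>

lemma transversal_pair_of_star:
  assumes X: "\<And>i j. i \<in> {1..t} \<Longrightarrow> j \<in> {1..t} \<Longrightarrow>
      X i j \<in> pverts G \<and> hi (X i j) \<preceq> D \<and> hi (X i j) \<noteq> D \<and> K i j \<preceq> lo (X i j)"
    and X_order: "\<And>i j i' j'. i \<in> {1..t} \<Longrightarrow> j \<in> {1..t} \<Longrightarrow> i' \<in> {1..t} \<Longrightarrow> j' \<in> {1..t} \<Longrightarrow>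
      depth (hi (X i' j')) \<le> depth (hi (X i j)) \<longleftrightarrow> lex_le (i, j) (i', j')"
    and W: "\<And>i j. i \<in> {1..t} \<Longrightarrow> j \<in> {1..t} \<Longrightarrow>
      W i j \<in> pverts G \<and> hi (W i j) \<preceq> D \<and> hi (W i j) \<noteq> D \<and> K i j \<preceq> lo (W i j)"
    and W_order: "\<And>i j i' j'. i \<in> {1..t} \<Longrightarrow> j \<in> {1..t} \<Longrightarrow> i' \<in> {1..t} \<Longrightarrow> j' \<in> {1..t} \<Longrightarrow>
      depth (hi (W i j)) \<le> depth (hi (W i' j')) \<longleftrightarrow> lex_le (j, i) (j', i')"
    and XW: "\<And>i j i' j'. i \<in> {1..t} \<Longrightarrow> j \<in> {1..t} \<Longrightarrow> i' \<in> {1..t} \<Longrightarrow> j' \<in> {1..t} \<Longrightarrow>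
      hi (X i j) \<noteq> hi (W i' j')"
    and K: "\<And>i j. i \<in> {1..t} \<Longrightarrow> j \<in> {1..t} \<Longrightarrow> (y, K i j) \<in> E"
    and K_inj: "\<And>i j i' j'. i \<in> {1..t} \<Longrightarrow> j \<in> {1..t} \<Longrightarrow> i' \<in> {1..t} \<Longrightarrow> j' \<in> {1..t} \<Longrightarrow>
      K i j = K i' j' \<Longrightarrow> i = i' \<and> j = j'"
    and y: "D \<preceq> y"
  shows "semi_induced_transversal_pair t 2 G"
proof -
  define b where "b k = (if k = 0 then X else if k = 1 then (\<lambda>i j. start_vertex (K i j)) else W)" for k :: nat
  have DK: "D \<preceq> K i j" if "i \<in> {1..t}" "j \<in> {1..t}" for i j
    using y K[OF that] by (meson rtrancl.rtrancl_into_rtrancl)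
  have K_anc: "i = i' \<and> j = j'"
    if ij: "i \<in> {1..t}" "j \<in> {1..t}" "i' \<in> {1..t}" "j' \<in> {1..t}" and "K i j \<preceq> q" "K i' j' \<preceq> q" for i j i' j' q
  proof -
    have no: False if "(y, k) \<in> E" "(y, k') \<in> E" "k \<preceq> k'" "k \<noteq> k'" for k k'
    proof -
      have "k \<preceq> y" using anc_parent that by blast
      then have "(y, y) \<in> E\<^sup>+" using that(1) by (meson rtrancl_into_trancl2)
      then show False using acyclic_E unfolding acyclic_def by blast
    qed
    have "K i j = K i' j'" using anc_linear[OF that(5,6)] no K[OF ij(1,2)] K[OF ij(3,4)] by metis
    then show ?thesis using K_inj[OF ij] by blast
  qed
  have exX: "exits_at D (hi (X i j)) (exit_vertex D (hi (X i j)))"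
    if "i \<in> {1..t}" "j \<in> {1..t}" for i j
    using exits_at_exit_vertex X[OF that] by blast
  have exW: "exits_at D (hi (W i j)) (exit_vertex D (hi (W i j)))"
    if "i \<in> {1..t}" "j \<in> {1..t}" for i j
    using exits_at_exit_vertex W[OF that] by blast
  have st: "start_vertex (K i j) \<in> pverts G" "hi (start_vertex (K i j)) = K i j"
    if "i \<in> {1..t}" "j \<in> {1..t}" for i j
    using start_vertex[OF K[OF that]] by auto
  have loX: "D \<preceq> lo (X i j)" and loW: "D \<preceq> lo (W i j)" and loK: "D \<preceq> lo (start_vertex (K i j))"
    if "i \<in> {1..t}" "j \<in> {1..t}" for i j
    using DK[OF that] X[OF that] W[OF that] st[OF that] hi_lo[OF st(1)[OF that]] by (auto intro: rtrancl_trans)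
  have below: "u \<preceq> K i' j' \<and> u \<noteq> K i' j'" if "u \<preceq> D" "u \<noteq> D" "i' \<in> {1..t}" "j' \<in> {1..t}" for u i' j'
    using DK[OF that(3,4)] that anc_antisym by (metis rtrancl_trans)
  have X_inj: "i = i' \<and> j = j'"
    if ij: "i \<in> {1..t}" "j \<in> {1..t}" "i' \<in> {1..t}" "j' \<in> {1..t}" and "hi (X i j) = hi (X i' j')" for i j i' j'
    using X_order[OF ij] X_order[OF ij(3,4,1,2)] lex_le_antisym that(5) by fastforce
  have W_inj: "i = i' \<and> j = j'"
    if ij: "i \<in> {1..t}" "j \<in> {1..t}" "i' \<in> {1..t}" "j' \<in> {1..t}" and "hi (W i j) = hi (W i' j')" for i j i' j'
    using W_order[OF ij] W_order[OF ij(3,4,1,2)] lex_le_antisym that(5) by fastforce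
  have b_lo: "D \<preceq> lo (b k i j)" if "i \<in> {1..t}" "j \<in> {1..t}" for i j k
    using loX loW loK that by (simp add: b_def)
  show ?thesis
  proof (rule semi_induced_transversal_pairI[where a = "\<lambda>i j. exit_vertex D (hi (X i j))"
        and b = b and c = "\<lambda>i j. exit_vertex D (hi (W i j))"])
    fix i j assume ij: "i \<in> {1..t}" "j \<in> {1..t}"
    show "exit_vertex D (hi (X i j)) \<in> pverts G" using exX[OF ij] unfolding exits_at_def by blast
    show "exit_vertex D (hi (W i j)) \<in> pverts G" using exW[OF ij] unfolding exits_at_def by blast
    show "b k i j \<in> pverts G" for k using X[OF ij] W[OF ij] st[OF ij] by (simp add: b_def)
    fix i' j' assume ij': "i' \<in> {1..t}" "j' \<in> {1..t}"
    note ijs = ij ij'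
    show "i = i' \<and> j = j'" if "exit_vertex D (hi (X i j)) = exit_vertex D (hi (X i' j'))"
      using exits_at_unique[of D "hi (X i j)" _ "hi (X i' j')"] exX[OF ij] exX[OF ij'] that X[OF ij] X[OF ij'] X_inj[OF ijs]
      by metis
    show "i = i' \<and> j = j'" if "exit_vertex D (hi (W i j)) = exit_vertex D (hi (W i' j'))"
      using exits_at_unique[of D "hi (W i j)" _ "hi (W i' j')"] exW[OF ij] exW[OF ij'] that W[OF ij] W[OF ij'] W_inj[OF ijs]
      by metis
    show "exit_vertex D (hi (X i j)) \<noteq> exit_vertex D (hi (W i' j'))"
      using exits_at_unique[of D "hi (X i j)" _ "hi (W i' j')"] exX[OF ij] exW[OF ij'] X[OF ij] W[OF ij'] XW[OF ijs]
      by metis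
    show "exit_vertex D (hi (X i j)) \<noteq> b k i' j'" for k
      using exits_at_not_below[OF exX[OF ij]] X[OF ij] b_lo[OF ij'] by metis
    show "exit_vertex D (hi (W i j)) \<noteq> b k i' j'" for k
      using exits_at_not_below[OF exW[OF ij]] W[OF ij] b_lo[OF ij'] by metis
    have XK: "X i j \<noteq> start_vertex (K i' j')"
      using below[OF _ _ ij', of "hi (X i j)"] X[OF ij] st[OF ij'] by metis
    have WK: "W i j \<noteq> start_vertex (K i' j')"
      using below[OF _ _ ij', of "hi (W i j)"] W[OF ij] st[OF ij'] by metis
    have KX: "start_vertex (K i j) \<noteq> X i' j'"
      using below[OF _ _ ij, of "hi (X i' j')"] X[OF ij'] st[OF ij] by metis
    have KW: "start_vertex (K i j) \<noteq> W i' j'"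
      using below[OF _ _ ij, of "hi (W i' j')"] W[OF ij'] st[OF ij] by metis
    have XW': "X i j \<noteq> W i' j'" "W i j \<noteq> X i' j'" using XW[OF ijs] XW[OF ij' ij] by auto
    have same: "X i j = X i' j' \<Longrightarrow> i = i' \<and> j = j'" "W i j = W i' j' \<Longrightarrow> i = i' \<and> j = j'"
      "start_vertex (K i j) = start_vertex (K i' j') \<Longrightarrow> i = i' \<and> j = j'"
      using X_inj[OF ijs] W_inj[OF ijs] K_inj[OF ijs] st(2)[OF ij] st(2)[OF ij'] by metis+
    show "k = k' \<and> i = i' \<and> j = j'" if "k \<le> 2" "k' \<le> 2" "b k i j = b k' i' j'" for k k'
    proof -
      have "k = 0 \<or> k = 1 \<or> k = 2" "k' = 0 \<or> k' = 1 \<or> k' = 2"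
        using \<open>k \<le> 2\<close> \<open>k' \<le> 2\<close> by linarith+
      then show ?thesis
        using \<open>b k i j = b k' i' j'\<close> XK WK KX KW XW' same unfolding b_def
        by (elim disjE) simp_all
    qed
    show "(exit_vertex D (hi (X i j)), b 0 i' j') \<in> parcs G \<longleftrightarrow> lex_le (i, j) (i', j')"
    proof -
      have "(exit_vertex D (hi (X i j)), X i' j') \<in> parcs G \<longleftrightarrow> lex_le (i, j) (i', j')"
        using exits_at_adjacent[OF exX[OF ij], of "X i' j'"] X[OF ij] X[OF ij'] loX[OF ij'] X_order[OF ijs]
          anc_iff_depth[of "hi (X i' j')" D "hi (X i j)"] by blast
      then show ?thesis by (simp add: b_def)
    qed
    have "(exit_vertex D (hi (W i' j')), W i j) \<in> parcs G \<longleftrightarrow> lex_le (j, i) (j', i')"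
      using exits_at_adjacent[OF exW[OF ij'], of "W i j"] W[OF ij] W[OF ij'] loW[OF ij] W_order[OF ijs]
        anc_iff_depth[of "hi (W i j)" D "hi (W i' j')"] by blast
    moreover have "exit_vertex D (hi (W i' j')) \<noteq> W i j"
      using exits_at_not_below[OF exW[OF ij']] W[OF ij'] loW[OF ij] by metis
    moreover have "exit_vertex D (hi (W i' j')) \<in> pverts G" using exW[OF ij'] unfolding exits_at_def by blast
    ultimately show "(b 2 i j, exit_vertex D (hi (W i' j'))) \<in> parcs G \<longleftrightarrow> lex_le (j, i) (j', i')"
      using arcs_sym[of "exit_vertex D (hi (W i' j'))" "W i j"] W[OF ij] by (simp add: b_def)
    have "(start_vertex (K i' j'), X i j) \<in> parcs G \<longleftrightarrow> K i' j' \<preceq> lo (X i j)"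
      using starts_at_adjacent[of "start_vertex (K i' j')" "X i j"] st[OF ij'] X[OF ij]
        below[OF _ _ ij', of "hi (X i j)"] by metis
    also have "\<dots> \<longleftrightarrow> i = i' \<and> j = j'" using K_anc[OF ijs] X[OF ij] by blast
    finally have XK': "(X i j, start_vertex (K i' j')) \<in> parcs G \<longleftrightarrow> i = i' \<and> j = j'"
      using arcs_sym[of "start_vertex (K i' j')" "X i j"] st[OF ij'] X[OF ij] XK by metis
    have "(start_vertex (K i j), W i' j') \<in> parcs G \<longleftrightarrow> K i j \<preceq> lo (W i' j')"
      using starts_at_adjacent[of "start_vertex (K i j)" "W i' j'"] st[OF ij] W[OF ij']
        below[OF _ _ ij, of "hi (W i' j')"] by metis
    also have "\<dots> \<longleftrightarrow> i = i' \<and> j = j'" using K_anc[OF ijs] W[OF ij'] by blast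
    finally show "(b k i j, b (Suc k) i' j') \<in> parcs G \<longleftrightarrow> i = i' \<and> j = j'" if "k < 2" for k
      using that XK' by (cases k) (auto simp: b_def)
  qed
qed

end

section \<open>Vertex orders from depth-first search\<close>

text \<open>\<open>pos\<close> is the position of a node in a depth-first postorder exploring children in the order \<open>ch\<close>.\<close>

locale dfs_path_model = path_model E G hi lo
  for E :: "'n rel" and G :: "'v pair_pre_digraph" and hi lo :: "'v \<Rightarrow> 'n" +
  fixes N :: "'n set" and ch :: "'n \<Rightarrow> 'n list" and pos :: "'n \<Rightarrow> nat"
  assumes finite_N: "finite N"
    and E_N: "(x, y) \<in> E \<Longrightarrow> x \<in> N \<and> y \<in> N"
    and lo_N: "v \<in> pverts G \<Longrightarrow> lo v \<in> N"
    and distinct_ch: "p \<in> N \<Longrightarrow> distinct (ch p)"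
    and set_ch: "p \<in> N \<Longrightarrow> set (ch p) = {q. (p, q) \<in> E}"
    and subtree_interval: "x \<in> N \<Longrightarrow> y \<in> N \<Longrightarrow> z \<in> N \<Longrightarrow> (q, x) \<in> E\<^sup>* \<Longrightarrow> (q, z) \<in> E\<^sup>* \<Longrightarrow>
      pos x \<le> pos y \<Longrightarrow> pos y \<le> pos z \<Longrightarrow> (q, y) \<in> E\<^sup>*"
    and pos_siblings: "p \<in> N \<Longrightarrow> i < j \<Longrightarrow> j < length (ch p) \<Longrightarrow> (ch p ! i, x) \<in> E\<^sup>* \<Longrightarrow>
      (ch p ! j, y) \<in> E\<^sup>* \<Longrightarrow> pos x < pos y"
    and pos_below: "p \<in> N \<Longrightarrow> (p, x) \<in> E\<^sup>* \<Longrightarrow> pos x \<le> pos p"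
    and siblings_lex: "p \<in> N \<Longrightarrow> i < j \<Longrightarrow> j < length (ch p) \<Longrightarrow> v \<in> pverts G \<Longrightarrow>
      (ch p ! j, lo v) \<in> E\<^sup>* \<Longrightarrow> (hi v, p) \<in> E\<^sup>* \<Longrightarrow>
      (\<And>w. w \<in> pverts G \<Longrightarrow> (ch p ! i, lo w) \<in> E\<^sup>* \<Longrightarrow> hi w \<noteq> hi v) \<Longrightarrow>
      \<exists>w\<in>pverts G. (ch p ! i, lo w) \<in> E\<^sup>* \<and> (hi w, hi v) \<in> E\<^sup>* \<and>
        (\<forall>v'\<in>pverts G. (ch p ! j, lo v') \<in> E\<^sup>* \<longrightarrow> hi v' \<noteq> hi w)"
begin

text \<open>With \<tau> = t^2, the segments of index less than \<tau> guarantee candidates for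
  \<open>X\<close>, segment \<tau> is the barrier \<open>B\<close>, and the segments \<tau> + 1 to 2
  \<tau> supply \<open>W\<close>. The segment of \<open>W\<close> determines the child through
  \<kappa>, so \<open>X\<close> has to be found in that child afterwards; the lexicographic
  selection permits exactly this.\<close>

lemma transversal_pair_of_siblings:
  fixes z \<kappa> :: "nat \<Rightarrow> nat \<Rightarrow> _"
  assumes t: "0 < t" and y: "y \<in> N" "D \<preceq> y"
    and z: "\<And>i a. i \<le> 2 * t\<^sup>2 \<Longrightarrow> a < n \<Longrightarrow>
      z i a \<in> pverts G \<and> hi (z i a) \<preceq> D \<and> hi (z i a) \<noteq> D"
    and z_depth: "\<And>i i' a a'. i < i' \<Longrightarrow> i' \<le> 2 * t\<^sup>2 \<Longrightarrow> a < n \<Longrightarrow> a' < n \<Longrightarrow>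
      depth (hi (z i a)) < depth (hi (z i' a'))"
    and z_child: "\<And>i a. i \<le> 2 * t\<^sup>2 \<Longrightarrow> a < n \<Longrightarrow>
      \<kappa> i a < length (ch y) \<and> ch y ! \<kappa> i a \<preceq> lo (z i a)"
    and \<kappa>: "\<And>i i' a a'. i \<le> 2 * t\<^sup>2 \<Longrightarrow> i' \<le> 2 * t\<^sup>2 \<Longrightarrow> a < a' \<Longrightarrow> a' < n \<Longrightarrow> \<kappa> i a < \<kappa> i' a'"
    and n: "(2 * t\<^sup>2) ^ Suc (t\<^sup>2) \<le> n"
  shows "semi_induced_transversal_pair t 2 G"
proof -
  define \<tau> where "\<tau> = t\<^sup>2"
  have tau: "0 < \<tau>" using t by (simp add: \<tau>_def)
  have n0: "0 < n" using n tau unfolding \<tau>_def by (metis gr0I le_zero_eq mult_eq_0_iff power_eq_0_iff zero_neq_numeral)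
  define B where "B = depth (hi (z \<tau> 0))"
  define Q where "Q c v \<longleftrightarrow> v \<in> pverts G \<and> c < length (ch y) \<and> ch y ! c \<preceq> lo v \<and>
    hi v \<preceq> D \<and> hi v \<noteq> D \<and> depth (hi v) < B" for c v
  define S where "S c = (\<lambda>v. depth (hi v)) ` {v. Q c v}" for c
  \<comment> \<open>Cutting the sets of highest nodes off at depth \<open>B\<close> preserves the
    lexicographic order, because the witness lies above the node it has to beat.\<close>
  have S_lex: "lex_ge (S c) (S c')" if c: "c < c'" "c' < length (ch y)" for c c'
    unfolding lex_ge_def
  proof
    fix s assume s: "s \<in> S c' - S c"
    then obtain v where v: "Q c' v" "s = depth (hi v)" unfolding S_def by blast
    have no: "hi w \<noteq> hi v" if "w \<in> pverts G" "ch y ! c \<preceq> lo w" for w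
    proof
      assume eq: "hi w = hi v"
      then have "Q c w" using that v(1) c unfolding Q_def by simp
      then have "depth (hi w) \<in> S c" unfolding S_def by simp
      then show False using s eq v(2) by simp
    qed
    have "hi v \<preceq> y" using v(1) y(2) unfolding Q_def by (meson rtrancl_trans)
    then obtain w where w: "w \<in> pverts G" "ch y ! c \<preceq> lo w" "hi w \<preceq> hi v"
      "\<And>v'. v' \<in> pverts G \<Longrightarrow> ch y ! c' \<preceq> lo v' \<Longrightarrow> hi v' \<noteq> hi w"
      using siblings_lex[OF y(1) c, of v] v(1) no unfolding Q_def by blast
    have lt: "depth (hi w) < s" unfolding v(2) by (rule depth_less[OF w(3) no[OF w(1,2)]])
    have wD: "hi w \<preceq> D" "hi w \<noteq> D"
    proof -
      have hv: "hi v \<preceq> D" "hi v \<noteq> D" using v(1) unfolding Q_def by blast+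
      then show "hi w \<preceq> D" using w(3) by (rule_tac rtrancl_trans)
      show "hi w \<noteq> D" using anc_antisym[of "hi v" D] hv w(3) by blast
    qed
    have "Q c w" using w(1,2) wD lt v c unfolding Q_def by simp
    then have "depth (hi w) \<in> S c" unfolding S_def by simp
    moreover have "depth (hi w) \<notin> S c'"
    proof
      assume "depth (hi w) \<in> S c'"
      then obtain v' where v': "Q c' v'" "depth (hi w) = depth (hi v')" unfolding S_def by blast
      then have "hi w = hi v'" using depth_inj[OF wD(1), of "hi v'"] unfolding Q_def by simp
      then show False using w(4) v'(1) unfolding Q_def by metis
    qed
    ultimately show "\<exists>s'<s. s' \<in> S c - S c'" using lt by blast
  qed
  have rep: "\<exists>\<alpha>. (\<forall>b<\<tau>. \<alpha> b < n) \<and> (\<forall>b b'. b < b' \<longrightarrow> b' < \<tau> \<longrightarrow> \<alpha> b < \<alpha> b') \<and>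
      (\<forall>\<sigma>. (\<forall>b<\<tau>. \<sigma> b < Suc (2 * \<tau>)) \<longrightarrow> (\<exists>s. (\<forall>b<\<tau>. s b \<in> S (\<kappa> (\<sigma> b) (\<alpha> b))) \<and>
         (\<forall>b b'. b < b' \<longrightarrow> b' < \<tau> \<longrightarrow> s b < s b')))"
  \<comment> \<open>Starting from the empty set all \<tau> elements are missing, so
    \<open>k\<^sub>0 = \<tau>\<close>; this gives the exponent t^2 + 1 in the number of
    groups.\<close>
  proof (rule lex_increasing_representatives[where h = "\<lambda>i a. depth (hi (z i a))" and B = B
        and A\<^sub>0 = 0 and F\<^sub>0 = "{}" and k\<^sub>0 = \<tau>])
    show "S c \<subseteq> {..<B}" for c unfolding S_def Q_def by auto
    show "lex_ge (S c) (S c')" if "i' < Suc (2 * \<tau>)" "b < n" "c < c'" "c' \<le> \<kappa> i' b" for i' b c c'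
      using that z_child[of i' b] by (intro S_lex) (auto simp: \<tau>_def)
    show "\<kappa> i a < \<kappa> i' b" if "i < Suc (2 * \<tau>)" "i' < Suc (2 * \<tau>)" "a < b" "b < n" for a b i i'
      using that by (intro \<kappa>) (auto simp: \<tau>_def)
    show "depth (hi (z i a)) \<in> S (\<kappa> i a)" if "i < \<tau>" "a < n" for i a
      using z[of i a] z_child[of i a] z_depth[of i \<tau> a 0] that n0 unfolding S_def Q_def B_def
      by (auto simp: \<tau>_def)
    show "depth (hi (z i a)) < depth (hi (z i' a))" if "i < i'" "i' < \<tau>" "a < n" for i i' a
      using that by (intro z_depth) (auto simp: \<tau>_def)
  qed (use tau n in \<open>auto simp: \<tau>_def\<close>)
  then obtain \<alpha> where \<alpha>: "\<And>b. b < \<tau> \<Longrightarrow> \<alpha> b < n" "\<And>b b'. b < b' \<Longrightarrow> b' < \<tau> \<Longrightarrow> \<alpha> b < \<alpha> b'"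
    and sel: "\<And>\<sigma>. (\<forall>b<\<tau>. \<sigma> b < Suc (2 * \<tau>)) \<Longrightarrow> \<exists>s. (\<forall>b<\<tau>. s b \<in> S (\<kappa> (\<sigma> b) (\<alpha> b))) \<and>
         (\<forall>b b'. b < b' \<longrightarrow> b' < \<tau> \<longrightarrow> s b < s b')"
    by blast
  \<comment> \<open>\<open>e\<close> numbers the pairs backwards, since larger pairs must receive
    higher nodes. \<open>r\<close> decodes such a number and returns the rank of the transposed
    pair, so that \<sigma>, which skips the segments up to \<tau>, orders the vertices
    \<open>W\<close> by (j, i).\<close>
  define e where "e i j = \<tau> - 1 - lex_rank t i j" for i j
  define r where "r b = (let q = \<tau> - 1 - b in lex_rank t (q mod t + 1) (q div t + 1))" for b
  define \<sigma> where "\<sigma> b = Suc \<tau> + r b" for b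
  have rank: "lex_rank t i j < \<tau>" if "i \<in> {1..t}" "j \<in> {1..t}" for i j
    using lex_rank_less[OF that] by (simp add: \<tau>_def)
  have e_less: "e i j < \<tau>" for i j using tau unfolding e_def by simp
  have r_less: "r b < \<tau>" for b
  proof -
    have "\<tau> - 1 - b < t * t" using tau by (simp add: \<tau>_def power2_eq_square)
    then have "(\<tau> - 1 - b) div t < t" using t by (simp add: less_mult_imp_div_less)
    then show ?thesis unfolding r_def Let_def using t by (intro rank) (auto simp: Suc_le_eq)
  qed
  have r_e: "r (e i j) = lex_rank t j i" if "i \<in> {1..t}" "j \<in> {1..t}" for i j
  proof -
    have "\<tau> - 1 - e i j = (i - 1) * t + (j - 1)"
      using rank[OF that] unfolding e_def lex_rank_def by simp
    moreover have "(q * t + p) div t = q \<and> (q * t + p) mod t = p" if "p < t" for p q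
      using that by simp
    moreover have "j - 1 < t" "i - 1 + 1 = i" "j - 1 + 1 = j" using that by auto
    ultimately show ?thesis unfolding r_def Let_def by metis
  qed
  have \<sigma>_le: "\<sigma> b \<le> 2 * t\<^sup>2" for b
    using r_less[of b] unfolding \<sigma>_def \<tau>_def by simp
  obtain s where s: "\<And>b. b < \<tau> \<Longrightarrow> s b \<in> S (\<kappa> (\<sigma> b) (\<alpha> b))"
    and s_mono: "\<And>b b'. b < b' \<Longrightarrow> b' < \<tau> \<Longrightarrow> s b < s b'"
    using sel[of \<sigma>] \<sigma>_le by (auto simp: \<tau>_def less_Suc_eq_le)
  have ex: "\<exists>v. Q (\<kappa> (\<sigma> b) (\<alpha> b)) v \<and> s b = depth (hi v)" if "b < \<tau>" for b
    using s[OF that] unfolding S_def by blast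
  define x where "x b = (SOME v. Q (\<kappa> (\<sigma> b) (\<alpha> b)) v \<and> s b = depth (hi v))" for b
  have x: "Q (\<kappa> (\<sigma> b) (\<alpha> b)) (x b)" and sx: "s b = depth (hi (x b))" if "b < \<tau>" for b
    using someI_ex[OF ex[OF that]] unfolding x_def by blast+
  define w where "w b = z (\<sigma> b) (\<alpha> b)" for b
  define k where "k b = ch y ! \<kappa> (\<sigma> b) (\<alpha> b)" for b
  have w: "w b \<in> pverts G \<and> hi (w b) \<preceq> D \<and> hi (w b) \<noteq> D \<and> k b \<preceq> lo (w b)" if "b < \<tau>" for b
    using z[OF \<sigma>_le \<alpha>(1)[OF that]] z_child[OF \<sigma>_le \<alpha>(1)[OF that]] unfolding w_def k_def by blast
  have k_len: "\<kappa> (\<sigma> b) (\<alpha> b) < length (ch y)" if "b < \<tau>" for b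
    using z_child[OF \<sigma>_le \<alpha>(1)[OF that]] by blast
  have k_inj: "b = b'" if "b < \<tau>" "b' < \<tau>" "k b = k b'" for b b'
  proof -
    have "\<kappa> (\<sigma> b) (\<alpha> b) = \<kappa> (\<sigma> b') (\<alpha> b')"
      using that k_len distinct_ch[OF y(1)] nth_eq_iff_index_eq unfolding k_def by blast
    moreover have "\<kappa> (\<sigma> b) (\<alpha> b) < \<kappa> (\<sigma> b') (\<alpha> b')" if "b < b'" "b' < \<tau>" for b b'
      using that \<alpha> \<sigma>_le by (intro \<kappa>) auto
    ultimately show ?thesis using that(1,2) by (metis less_irrefl linorder_neqE_nat)
  qed
  have w_depth: "depth (hi (w b)) < depth (hi (w b'))" if "b < \<tau>" "b' < \<tau>" "r b < r b'" for b b'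
    using that \<alpha> \<sigma>_le unfolding w_def by (intro z_depth) (auto simp: \<sigma>_def)
  have B_w: "B < depth (hi (w b))" if "b < \<tau>" for b
    using that \<alpha>(1) \<sigma>_le n0 unfolding w_def B_def by (intro z_depth) (auto simp: \<sigma>_def)
  have e_le: "e i' j' \<le> e i j \<longleftrightarrow> lex_rank t i j \<le> lex_rank t i' j'"
    if "i \<in> {1..t}" "j \<in> {1..t}" "i' \<in> {1..t}" "j' \<in> {1..t}" for i j i' j'
    using rank[OF that(1,2)] rank[OF that(3,4)] unfolding e_def by linarith
  show ?thesis
  proof (rule transversal_pair_of_star[where X = "\<lambda>i j. x (e i j)" and W = "\<lambda>i j. w (e i j)"
        and K = "\<lambda>i j. k (e i j)" and D = D and y = y])
    fix i j assume ij: "i \<in> {1..t}" "j \<in> {1..t}"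
    show "x (e i j) \<in> pverts G \<and> hi (x (e i j)) \<preceq> D \<and> hi (x (e i j)) \<noteq> D \<and> k (e i j) \<preceq> lo (x (e i j))"
      using x[OF e_less] unfolding Q_def k_def by blast
    show "w (e i j) \<in> pverts G \<and> hi (w (e i j)) \<preceq> D \<and> hi (w (e i j)) \<noteq> D \<and> k (e i j) \<preceq> lo (w (e i j))"
      by (rule w[OF e_less])
    show "(y, k (e i j)) \<in> E"
      using k_len[OF e_less, of i j] set_ch[OF y(1)] nth_mem unfolding k_def by blast
    fix i' j' assume ij': "i' \<in> {1..t}" "j' \<in> {1..t}"
    note ijs = ij ij'
    have sx_le: "depth (hi (x b)) \<le> depth (hi (x b')) \<longleftrightarrow> b \<le> b'" if "b < \<tau>" "b' < \<tau>" for b b'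
      using s_mono[of b b'] s_mono[of b' b] sx[OF that(1)] sx[OF that(2)] that
      by (cases b b' rule: linorder_cases) auto
    show "depth (hi (x (e i' j'))) \<le> depth (hi (x (e i j))) \<longleftrightarrow> lex_le (i, j) (i', j')"
      using sx_le[OF e_less e_less] e_le[OF ijs] lex_rank_le_iff[OF ijs] by simp
    have w_le: "depth (hi (w b)) \<le> depth (hi (w b')) \<longleftrightarrow> r b \<le> r b'" if "b < \<tau>" "b' < \<tau>" "r b = r b' \<longrightarrow> b = b'" for b b'
      using w_depth[of b b'] w_depth[of b' b] that by (cases "r b" "r b'" rule: linorder_cases) auto
    have "r (e i j) = r (e i' j') \<longrightarrow> e i j = e i' j'"
    proof
      assume "r (e i j) = r (e i' j')"
      then have "lex_rank t j i = lex_rank t j' i'" using r_e ij ij' by simp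
      then have "(j, i) = (j', i')"
        using lex_rank_le_iff[OF ij(2,1) ij'(2,1)] lex_rank_le_iff[OF ij'(2,1) ij(2,1)] lex_le_antisym by fastforce
      then show "e i j = e i' j'" by simp
    qed
    then show "depth (hi (w (e i j))) \<le> depth (hi (w (e i' j'))) \<longleftrightarrow> lex_le (j, i) (j', i')"
      using w_le[OF e_less e_less] r_e[OF ij] r_e[OF ij'] lex_rank_le_iff[OF ij(2,1) ij'(2,1)] by simp
    show "hi (x (e i j)) \<noteq> hi (w (e i' j'))"
      using B_w[OF e_less, of i' j'] x[OF e_less, of i j] unfolding Q_def by force
    show "i = i' \<and> j = j'" if "k (e i j) = k (e i' j')"
    proof -
      have "e i j = e i' j'" using k_inj[OF e_less e_less that] .
      then have "lex_rank t i j = lex_rank t i' j'" using rank[OF ij] rank[OF ij'] unfolding e_def by linarith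
      then show ?thesis
        using lex_rank_le_iff[OF ijs] lex_rank_le_iff[OF ij' ij] lex_le_antisym[of "(i, j)" "(i', j')"] by simp
    qed
  qed (rule y(2))
qed

end

section \<open>Distribution of the groups below a node\<close>

lemma power_gap:
  fixes q :: nat
  assumes "2 \<le> q"
  shows "(q ^ Suc r + 1) * (q - 2) + 4 \<le> q ^ Suc (Suc r)"
proof -
  obtain p where p: "q = p + 2" using assms by (metis le_add_diff_inverse2)
  have "p + 2 \<le> (p + 2) ^ Suc r" using self_le_power[of "p + 2" "Suc r"] by simp
  then have "p + 4 \<le> 2 * (p + 2) ^ Suc r" by linarith
  then show ?thesis unfolding p by (simp add: algebra_simps)
qed

context dfs_path_model
begin

lemma strict_below_child:
  assumes "y \<in> N" "y \<preceq> x" "y \<noteq> x"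
  shows "\<exists>k<length (ch y). ch y ! k \<preceq> x"
proof -
  obtain c where "(y, c) \<in> E" "c \<preceq> x" using child_towards[OF assms(2,3)] by blast
  then show ?thesis using set_ch[OF assms(1)] by (metis in_set_conv_nth mem_Collect_eq)
qed

end

text \<open>
  The groups \<open>{z i a | i. i \<le> 2 * t\<^sup>2}\<close> for \<open>a < n\<close> occupy consecutive intervals of the postorder,
  and for every group and every \<open>i\<close> the \<open>i\<close>-th segment of the path from the root to \<open>D\<close> contains
  a highest node of a vertex in the group.
\<close>

locale path_grid = dfs_path_model E G hi lo N ch pos
  for E :: "'n rel" and G :: "'v pair_pre_digraph" and hi lo N ch pos +
  fixes t n :: nat and D :: 'n and z :: "nat \<Rightarrow> nat \<Rightarrow> 'v"
  assumes t: "0 < t"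
    and D_N: "D \<in> N"
    and z: "i \<le> 2 * t\<^sup>2 \<Longrightarrow> a < n \<Longrightarrow> z i a \<in> pverts G"
    and z_hi: "i \<le> 2 * t\<^sup>2 \<Longrightarrow> a < n \<Longrightarrow> (hi (z i a), D) \<in> E\<^sup>*"
    and z_hi_ne: "i \<le> 2 * t\<^sup>2 \<Longrightarrow> a < n \<Longrightarrow> hi (z i a) \<noteq> D"
    and z_lo: "i \<le> 2 * t\<^sup>2 \<Longrightarrow> a < n \<Longrightarrow> (D, lo (z i a)) \<in> E\<^sup>*"
    and z_depth: "i < i' \<Longrightarrow> i' \<le> 2 * t\<^sup>2 \<Longrightarrow> a < n \<Longrightarrow> a' < n \<Longrightarrow>
      forest.depth E (hi (z i a)) < forest.depth E (hi (z i' a'))"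
    and z_pos: "i \<le> 2 * t\<^sup>2 \<Longrightarrow> i' \<le> 2 * t\<^sup>2 \<Longrightarrow> a < a' \<Longrightarrow> a' < n \<Longrightarrow>
      pos (lo (z i a)) < pos (lo (z i' a'))"
begin

definition groups_below :: "'n \<Rightarrow> nat set" where
  "groups_below y = {a. a < n \<and> (\<forall>i\<le>2 * t\<^sup>2. y \<preceq> lo (z i a))}"

lemma finite_groups_below: "finite (groups_below y)"
  unfolding groups_below_def by (rule finite_subset[of _ "{..<n}"]) auto

lemma z_lo_N: "i \<le> 2 * t\<^sup>2 \<Longrightarrow> a < n \<Longrightarrow> lo (z i a) \<in> N"
  using lo_N z by blast

text \<open>Subtrees are intervals of the postorder and groups occupy consecutive intervals, so only
  the first and the last group meeting a subtree can stick out of it.\<close>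

lemma between_below:
  assumes "c \<preceq> lo (z i a)" "c \<preceq> lo (z i' a')" "a < b" "b < a'" "a' < n"
    "i \<le> 2 * t\<^sup>2" "i' \<le> 2 * t\<^sup>2"
  shows "b \<in> groups_below c"
proof -
  have "c \<preceq> lo (z k b)" if "k \<le> 2 * t\<^sup>2" for k
  proof (rule subtree_interval[OF _ _ _ assms(1,2)])
    show "pos (lo (z i a)) \<le> pos (lo (z k b))" "pos (lo (z k b)) \<le> pos (lo (z i' a'))"
      using assms that by (auto intro!: less_imp_le z_pos)
  qed (use assms that in \<open>auto intro!: z_lo_N\<close>)
  then show ?thesis using assms unfolding groups_below_def by simp
qed

text \<open>Every (q + 1)-st group below \<open>y\<close> is selected. If two selected groups had
  vertices below the same child, the \<open>q\<close> groups between them would lie below it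
  entirely. Hence different selected groups use different children, in increasing order.\<close>

lemma many_children:
  assumes y: "y \<in> N" "D \<preceq> y"
    and few: "\<And>c. c \<in> set (ch y) \<Longrightarrow> card (groups_below c) < q"
    and card: "(q + 1) * (2 * t\<^sup>2) ^ Suc (t\<^sup>2) < card (groups_below y)"
  shows "semi_induced_transversal_pair t 2 G"
proof -
  define m where "m = (2 * t\<^sup>2) ^ Suc (t\<^sup>2)"
  define L where "L = sorted_list_of_set (groups_below y)"
  have len: "length L = card (groups_below y)" unfolding L_def by simp
  have L_in: "L ! k \<in> groups_below y" if "k < length L" for k
    using that nth_mem[of k L] finite_groups_below unfolding L_def by simp
  have L_n: "L ! k < n" if "k < length L" for k
    using L_in[OF that] unfolding groups_below_def by simp
  have L_mono: "L ! k < L ! k'" if "k < k'" "k' < length L" for k k'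
    using that strict_sorted_list_of_set[of "groups_below y"] unfolding L_def
    by (intro sorted_wrt_nth_less[of "(<)"]) auto
  have idx: "(q + 1) * a < length L - 1" if "a < m" for a
  proof -
    have "(q + 1) * a < (q + 1) * m" using that by (intro mult_less_mono2) simp_all
    then show ?thesis using card len unfolding m_def by linarith
  qed
  define g where "g a = L ! ((q + 1) * a)" for a
  have g_idx: "(q + 1) * a < length L" if "a < m" for a using idx[OF that] by simp
  have g_mono: "g a < g a'" if "a < a'" "a' < m" for a a'
    using that g_idx[of a'] unfolding g_def by (intro L_mono mult_less_mono2) simp_all
  have g_n: "g a < n" if "a < m" for a using L_n[OF g_idx[OF that]] unfolding g_def .
  have g_y: "y \<preceq> lo (z i (g a))" if "a < m" "i \<le> 2 * t\<^sup>2" for i a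
    using L_in[OF g_idx[OF that(1)]] that(2) unfolding g_def groups_below_def by blast
  \<comment> \<open>The last group below \<open>y\<close> is never selected. Its vertices come
    strictly later, and \<open>y\<close> comes last in its own subtree, so no selected lowest node
    equals \<open>y\<close>.\<close>
  have ex: "\<exists>k<length (ch y). ch y ! k \<preceq> lo (z i (g a))" if a: "a < m" and i: "i \<le> 2 * t\<^sup>2" for i a
  proof (rule strict_below_child[OF y(1) g_y[OF a i]])
    have last: "length L - 1 < length L" using idx[OF a] by simp
    have "pos (lo (z i (g a))) < pos (lo (z i (L ! (length L - 1))))"
      unfolding g_def using idx[OF a] last i L_n by (intro z_pos L_mono) auto
    also have "\<dots> \<le> pos y"
      using L_in[OF last] i unfolding groups_below_def by (intro pos_below[OF y(1)]) blast
    finally show "y \<noteq> lo (z i (g a))" by auto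
  qed
  define \<kappa> where "\<kappa> i a = (SOME k. k < length (ch y) \<and> ch y ! k \<preceq> lo (z i (g a)))" for i a
  have \<kappa>: "\<kappa> i a < length (ch y) \<and> ch y ! \<kappa> i a \<preceq> lo (z i (g a))" if "a < m" "i \<le> 2 * t\<^sup>2" for i a
    unfolding \<kappa>_def by (rule someI_ex) (use ex[OF that] in blast)
  have \<kappa>_less: "\<kappa> i a < \<kappa> i' a'" if i: "i \<le> 2 * t\<^sup>2" "i' \<le> 2 * t\<^sup>2" and a: "a < a'" "a' < m" for i i' a a'
  proof (rule ccontr)
    assume "\<not> ?thesis"
    then consider "\<kappa> i' a' < \<kappa> i a" | "\<kappa> i' a' = \<kappa> i a" by linarith
    then show False
    proof cases
      case 1
      have "pos (lo (z i' (g a'))) < pos (lo (z i (g a)))"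
        using pos_siblings[OF y(1) 1] \<kappa>[of a i] \<kappa>[of a' i'] i a by simp
      moreover have "pos (lo (z i (g a))) < pos (lo (z i' (g a')))"
        using i a g_mono[OF a] g_n[OF a(2)] by (intro z_pos)
      ultimately show False by simp
    next
      case 2
      define c where "c = ch y ! \<kappa> i a"
      have c: "c \<preceq> lo (z i (g a))" "c \<preceq> lo (z i' (g a'))" "c \<in> set (ch y)"
        using \<kappa>[of a i] \<kappa>[of a' i'] i a 2 unfolding c_def by auto
      have k: "(q + 1) * a + q < (q + 1) * a'"
        using a(1) mult_le_mono2[of "Suc a" a' "q + 1"] by simp
      have sub: "(\<lambda>j. L ! ((q + 1) * a + 1 + j)) ` {..<q} \<subseteq> groups_below c"
      proof
        fix b assume "b \<in> (\<lambda>j. L ! ((q + 1) * a + 1 + j)) ` {..<q}"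
        then obtain j where j: "j < q" "b = L ! ((q + 1) * a + 1 + j)" by auto
        show "b \<in> groups_below c"
        proof (rule between_below[OF c(1,2) _ _ g_n[OF a(2)] i])
          show "g a < b" unfolding g_def j(2) using j(1) k g_idx[OF a(2)] by (intro L_mono) linarith+
          show "b < g a'" unfolding g_def j(2) using j(1) k g_idx[OF a(2)] by (intro L_mono) linarith+
        qed
      qed
      have "inj_on (\<lambda>j. L ! ((q + 1) * a + 1 + j)) {..<q}"
      proof (rule linorder_inj_onI)
        fix j j' assume "j < j'" "j \<in> {..<q}" "j' \<in> {..<q}"
        then have "L ! ((q + 1) * a + 1 + j) < L ! ((q + 1) * a + 1 + j')"
          using k g_idx[OF a(2)] by (intro L_mono) auto
        then show "L ! ((q + 1) * a + 1 + j) \<noteq> L ! ((q + 1) * a + 1 + j')" by simp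
      qed auto
      then have "q \<le> card (groups_below c)"
        using card_inj_on_le[OF _ sub finite_groups_below] by simp
      then show False using few[OF c(3)] by simp
    qed
  qed
  show ?thesis
  proof (rule transversal_pair_of_siblings[OF t y, where z = "\<lambda>i a. z i (g a)" and \<kappa> = \<kappa> and n = m])
    show "z i (g a) \<in> pverts G \<and> hi (z i (g a)) \<preceq> D \<and> hi (z i (g a)) \<noteq> D"
      if "i \<le> 2 * t\<^sup>2" "a < m" for i a
      using z[OF that(1) g_n] z_hi[OF that(1) g_n] z_hi_ne[OF that(1) g_n] that(2) by simp
    show "depth (hi (z i (g a))) < depth (hi (z i' (g a')))"
      if "i < i'" "i' \<le> 2 * t\<^sup>2" "a < m" "a' < m" for i i' a a'
      using that g_n by (intro z_depth)
  qed (use \<kappa> \<kappa>_less in \<open>auto simp: m_def\<close>)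
qed

text \<open>Descend to a deepest node \<open>x\<close> that has lost at most three of the required
  groups. If no child of \<open>x\<close> is rich, the groups spread over many children. Otherwise
  pass to a rich child \<open>c\<close>: more than three groups have been left behind, at least one
  of them entirely, and this one is paired with \<open>y\<close> as the next link of the
  chain.\<close>

lemma branching_or_chain:
  assumes q: "(2 * t\<^sup>2) ^ Suc (t\<^sup>2) + 2 \<le> q"
  shows "y \<in> N \<Longrightarrow> D \<preceq> y \<Longrightarrow> q ^ Suc r \<le> card (groups_below y) \<Longrightarrow>
    semi_induced_transversal_pair t 2 G \<or>
    (\<exists>Y e. (\<forall>b<r. y \<preceq> Y b \<and> e b < n \<and> (\<forall>i\<le>2 * t\<^sup>2. Y b \<preceq> lo (z i (e b)))) \<and>
      (\<forall>b b'. b < b' \<longrightarrow> b' < r \<longrightarrow> Y b \<preceq> Y b' \<and> (\<forall>i\<le>2 * t\<^sup>2. \<not> Y b' \<preceq> lo (z i (e b)))))"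
proof (induction r arbitrary: y)
  case 0
  then show ?case by auto
next
  case (Suc r)
  \<comment> \<open>The 4 pays for the three groups that may be lost on the way to \<open>x\<close>
    and for the strict inequality demanded by \<open>many_children\<close>.\<close>
  have gap: "(q ^ Suc r + 1) * (2 * t\<^sup>2) ^ Suc (t\<^sup>2) + 4 \<le> q ^ Suc (Suc r)"
  proof -
    have "(q ^ Suc r + 1) * (2 * t\<^sup>2) ^ Suc (t\<^sup>2) \<le> (q ^ Suc r + 1) * (q - 2)"
      using q by (intro mult_le_mono2) linarith
    then show ?thesis using power_gap[of q r] q by linarith
  qed
  define C where "C = {x \<in> N. y \<preceq> x \<and> q ^ Suc (Suc r) - 3 \<le> card (groups_below x)}"
  have "finite C" "y \<in> C" using finite_N Suc.prems unfolding C_def by auto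
  then obtain x where x: "x \<in> C" "\<And>x'. x' \<in> C \<Longrightarrow> depth x' \<le> depth x"
    using finite_has_maximal[of "depth ` C"] by (metis (no_types, lifting) finite_imageI image_iff empty_iff nle_le)
  have xN: "x \<in> N" "D \<preceq> x" "y \<preceq> x" using x(1) Suc.prems(2) unfolding C_def by (auto intro: rtrancl_trans)
  have child: "c \<in> N" "y \<preceq> c" "card (groups_below c) < q ^ Suc (Suc r) - 3" if c: "c \<in> set (ch x)" for c
  proof -
    have E: "(x, c) \<in> E" using c set_ch[OF xN(1)] by blast
    show cN: "c \<in> N" "y \<preceq> c" using E E_N xN(3) by (auto intro: rtrancl.rtrancl_into_rtrancl)
    have "x \<noteq> c" using E acyclic_E unfolding acyclic_def by blast
    then have "depth x < depth c" using E by (intro depth_less) auto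
    then have "c \<notin> C" using x(2)[of c] by linarith
    then show "card (groups_below c) < q ^ Suc (Suc r) - 3" using cN unfolding C_def by simp
  qed
  show ?case
  proof (cases "\<forall>c\<in>set (ch x). card (groups_below c) < q ^ Suc r")
    case True
    have "q ^ Suc (Suc r) - 3 \<le> card (groups_below x)" using x(1) unfolding C_def by blast
    then have big: "(q ^ Suc r + 1) * (2 * t\<^sup>2) ^ Suc (t\<^sup>2) < card (groups_below x)"
      using gap by linarith
    have "semi_induced_transversal_pair t 2 G"
      by (rule many_children[OF xN(1,2) _ big]) (rule bspec[OF True])
    then show ?thesis ..
  next
    case False
    then obtain c where c: "c \<in> set (ch x)" "q ^ Suc r \<le> card (groups_below c)" by fastforce
    note cN = child[OF c(1)]
    define Z where "Z = groups_below y - groups_below c"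
    have finZ: "finite Z" unfolding Z_def using finite_groups_below by blast
    have "card (groups_below y) - card (groups_below c) \<le> card Z"
      unfolding Z_def by (rule diff_card_le_card_Diff[OF finite_groups_below])
    then have Z3: "3 \<le> card Z" using cN(3) Suc.prems(3) by linarith
    then have "Z \<noteq> {}" by auto
    have "\<not> Z \<subseteq> {Min Z, Max Z}"
    proof
      assume "Z \<subseteq> {Min Z, Max Z}"
      then have "card Z \<le> card {Min Z, Max Z}" by (intro card_mono) auto
      also have "\<dots> \<le> 2" by (simp add: card_insert_if)
      finally show False using Z3 by simp
    qed
    then obtain b where b: "b \<in> Z" "b \<noteq> Min Z" "b \<noteq> Max Z" by blast
    have b_between: "Min Z < b" "b < Max Z"
      using b Min_le[OF finZ b(1)] Max_ge[OF finZ b(1)] by linarith+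
    have MM: "Min Z \<in> Z" "Max Z \<in> Z" using finZ \<open>Z \<noteq> {}\<close> by auto
    have Z_n: "a < n" if "a \<in> Z" for a using that unfolding Z_def groups_below_def by simp
    \<comment> \<open>If all groups left behind met the subtree of \<open>c\<close>, the first and
      the last of them would enclose a third, which would then lie entirely below
      \<open>c\<close>.\<close>
    have "\<exists>e\<in>Z. \<forall>i\<le>2 * t\<^sup>2. \<not> c \<preceq> lo (z i e)"
    proof (rule ccontr)
      assume neg: "\<not> ?thesis"
      obtain i where i: "i \<le> 2 * t\<^sup>2" "c \<preceq> lo (z i (Min Z))" using neg MM(1) by blast
      obtain i' where i': "i' \<le> 2 * t\<^sup>2" "c \<preceq> lo (z i' (Max Z))" using neg MM(2) by blast
      have "b \<in> groups_below c"
        by (rule between_below[OF i(2) i'(2) b_between Z_n[OF MM(2)] i(1) i'(1)])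
      then show False using b(1) unfolding Z_def by blast
    qed
    then obtain e\<^sub>0 where e0: "e\<^sub>0 \<in> Z" "\<And>i. i \<le> 2 * t\<^sup>2 \<Longrightarrow> \<not> c \<preceq> lo (z i e\<^sub>0)" by blast
    have Dc: "D \<preceq> c" using Suc.prems(2) cN(2) by (rule rtrancl_trans)
    show ?thesis
    proof (cases "semi_induced_transversal_pair t 2 G")
      case False
      then obtain Y e where
        Y: "\<And>b. b < r \<Longrightarrow> c \<preceq> Y b \<and> e b < n \<and> (\<forall>i\<le>2 * t\<^sup>2. Y b \<preceq> lo (z i (e b)))"
        and YY: "\<And>b b'. b < b' \<Longrightarrow> b' < r \<Longrightarrow> Y b \<preceq> Y b' \<and> (\<forall>i\<le>2 * t\<^sup>2. \<not> Y b' \<preceq> lo (z i (e b)))"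
        using Suc.IH[OF cN(1) Dc c(2)] by blast
      define Y' where "Y' b = (case b of 0 \<Rightarrow> y | Suc b \<Rightarrow> Y b)" for b
      define e' where "e' b = (case b of 0 \<Rightarrow> e\<^sub>0 | Suc b \<Rightarrow> e b)" for b
      have 1: "y \<preceq> Y' b \<and> e' b < n \<and> (\<forall>i\<le>2 * t\<^sup>2. Y' b \<preceq> lo (z i (e' b)))" if "b < Suc r" for b
      proof (cases b)
        case 0
        then show ?thesis using e0(1) unfolding Y'_def e'_def Z_def groups_below_def by simp
      next
        case (Suc d)
        then show ?thesis using Y[of d] that cN(2) unfolding Y'_def e'_def by (auto intro: rtrancl_trans)
      qed
      have 2: "Y' b \<preceq> Y' b' \<and> (\<forall>i\<le>2 * t\<^sup>2. \<not> Y' b' \<preceq> lo (z i (e' b)))" if bb: "b < b'" "b' < Suc r" for b b'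
      proof -
        obtain d' where d': "b' = Suc d'" "d' < r" using bb by (cases b') auto
        show ?thesis
        proof (cases b)
          case 0
          have "y \<preceq> Y d'" using Y[OF d'(2)] cN(2) by (blast intro: rtrancl_trans)
          moreover have "\<not> Y d' \<preceq> lo (z i e\<^sub>0)" if "i \<le> 2 * t\<^sup>2" for i
            using e0(2)[OF that] Y[OF d'(2)] by (blast intro: rtrancl_trans)
          ultimately show ?thesis using 0 d' unfolding Y'_def e'_def by simp
        next
          case (Suc d)
          then show ?thesis using YY[of d d'] bb d' unfolding Y'_def e'_def by simp
        qed
      qed
      show ?thesis using 1 2 by blast
    qed blast
  qed
qed

lemma transversal_pair_of_grid:
  assumes n: "((2 * t\<^sup>2) ^ Suc (t\<^sup>2) + 2) ^ Suc (t\<^sup>2) \<le> n"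
  shows "semi_induced_transversal_pair t 0 G \<or> semi_induced_transversal_pair t 2 G"
proof -
  define \<tau> where "\<tau> = t\<^sup>2"
  have "groups_below D = {..<n}" using z_lo unfolding groups_below_def by auto
  then have "((2 * t\<^sup>2) ^ Suc (t\<^sup>2) + 2) ^ Suc \<tau> \<le> card (groups_below D)" using n by (simp add: \<tau>_def)
  from branching_or_chain[OF order_refl D_N _ this]
  consider "semi_induced_transversal_pair t 2 G" | Y e where
      "\<And>b. b < \<tau> \<Longrightarrow> D \<preceq> Y b \<and> e b < n \<and> (\<forall>i\<le>2 * t\<^sup>2. Y b \<preceq> lo (z i (e b)))"
      "\<And>b b'. b < b' \<Longrightarrow> b' < \<tau> \<Longrightarrow> Y b \<preceq> Y b' \<and> (\<forall>i\<le>2 * t\<^sup>2. \<not> Y b' \<preceq> lo (z i (e b)))"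
    by blast
  then show ?thesis
  proof cases
    case 2
    define f where "f i j = \<tau> - 1 - lex_rank t i j" for i j
    have rank: "lex_rank t i j < \<tau>" if "i \<in> {1..t}" "j \<in> {1..t}" for i j
      using lex_rank_less[OF that] by (simp add: \<tau>_def)
    have f_less: "f i j < \<tau>" for i j using t unfolding f_def \<tau>_def by simp
    have f_M: "f i j \<le> 2 * t\<^sup>2" for i j using f_less[of i j] unfolding \<tau>_def by simp
    have f_le: "f i' j' \<le> f i j \<longleftrightarrow> lex_le (i, j) (i', j')"
      if "i \<in> {1..t}" "j \<in> {1..t}" "i' \<in> {1..t}" "j' \<in> {1..t}" for i j i' j'
      unfolding lex_rank_le_iff[OF that, symmetric] f_def
      using rank[OF that(1,2)] rank[OF that(3,4)] by linarith
    have f_inj: "(i, j) = (i', j')" if ij: "i \<in> {1..t}" "j \<in> {1..t}" "i' \<in> {1..t}" "j' \<in> {1..t}" and "f i j = f i' j'" for i j i' j'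
      using f_le[OF ij] f_le[OF ij(3,4,1,2)] that(5) lex_le_antisym[of "(i, j)" "(i', j')"] by simp
    have e_n: "e (f i j) < n" for i j using 2(1)[OF f_less] by blast
    have "semi_induced_transversal_pair t 0 G"
    \<comment> \<open>The segment is indexed by (i, j) and the group by (j, i). Both run backwards
      through \<open>f\<close>, because in either half-graph larger pairs must receive higher
      nodes.\<close>
    proof (rule transversal_pair_of_chain[where X = "\<lambda>i j. z (f i j) (e (f j i))" and Y = "\<lambda>i j. Y (f j i)" and D = D])
      fix i j assume ij: "i \<in> {1..t}" "j \<in> {1..t}"
      show "z (f i j) (e (f j i)) \<in> pverts G \<and> hi (z (f i j) (e (f j i))) \<preceq> D \<and>
          hi (z (f i j) (e (f j i))) \<noteq> D \<and> D \<preceq> lo (z (f i j) (e (f j i)))"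
        using z[OF f_M e_n] z_hi[OF f_M e_n] z_hi_ne[OF f_M e_n] z_lo[OF f_M e_n] by blast
      show "D \<preceq> Y (f j i)" using 2(1)[OF f_less] by blast
      fix i' j' assume ij': "i' \<in> {1..t}" "j' \<in> {1..t}"
      note ijs = ij ij'
      have lt: "depth (hi (z (f i j) (e (f j i)))) < depth (hi (z (f i' j') (e (f j' i'))))"
        if "f i j < f i' j'" for i j i' j'
        by (rule z_depth[OF that f_M e_n e_n])
      show "depth (hi (z (f i' j') (e (f j' i')))) \<le> depth (hi (z (f i j) (e (f j i)))) \<longleftrightarrow> lex_le (i, j) (i', j')"
      proof (cases "f i j" "f i' j'" rule: linorder_cases)
        case equal
        then show ?thesis using f_inj[OF ijs] by (auto simp: lex_le_refl)
      qed (use lt[of i j i' j'] lt[of i' j' i j] f_le[OF ijs] in auto)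
      show "Y (f j' i') \<preceq> lo (z (f i j) (e (f j i))) \<longleftrightarrow> lex_le (j, i) (j', i')"
      proof (cases "f j' i' \<le> f j i")
        case True
        have "Y (f j' i') \<preceq> Y (f j i)"
          using 2(2)[of "f j' i'" "f j i"] f_less True by (cases "f j' i' = f j i") auto
        moreover have "Y (f j i) \<preceq> lo (z (f i j) (e (f j i)))" using 2(1)[OF f_less] f_M by blast
        ultimately have "Y (f j' i') \<preceq> lo (z (f i j) (e (f j i)))" by (rule rtrancl_trans)
        then show ?thesis using True f_le[OF ij(2,1) ij'(2,1)] by simp
      next
        case False
        then have "\<not> Y (f j' i') \<preceq> lo (z (f i j) (e (f j i)))"
          using 2(2)[of "f j i" "f j' i'"] f_less f_M by simp
        then show ?thesis using False f_le[OF ij(2,1) ij'(2,1)] by simp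
      qed
    qed
    then show ?thesis ..
  qed blast
qed

end

section \<open>Depth-first postorders\<close>

definition list_index :: "'a list \<Rightarrow> 'a \<Rightarrow> nat" where
  "list_index xs = inv_into {..<length xs} ((!) xs)"

lemma list_index_nth: "distinct xs \<Longrightarrow> i < length xs \<Longrightarrow> list_index xs (xs ! i) = i"
  unfolding list_index_def by (intro inv_into_f_f) (auto simp: inj_on_def nth_eq_iff_index_eq)

lemma nth_list_index:
  assumes "x \<in> set xs"
  shows "xs ! list_index xs x = x" "list_index xs x < length xs"
proof -
  have x: "x \<in> (!) xs ` {..<length xs}" using assms by (auto simp: in_set_conv_nth)
  show "xs ! list_index xs x = x" unfolding list_index_def by (rule f_inv_into_f[OF x])
  show "list_index xs x < length xs" using inv_into_into[OF x] unfolding list_index_def by simp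
qed

lemma precedes_in_iff:
  assumes "distinct xs" "x \<in> set xs" "y \<in> set xs"
  shows "precedes_in xs x y \<longleftrightarrow> list_index xs x < list_index xs y"
  using assms nth_list_index list_index_nth unfolding precedes_in_def
  by (metis order.strict_trans)

lemma list_index_append_less:
  assumes "distinct (as @ bs)" "x \<in> set as" "y \<in> set bs"
  shows "list_index (as @ bs) x < list_index (as @ bs) y"
proof -
  obtain i where i: "i < length as" "as ! i = x" using assms(2) by (auto simp: in_set_conv_nth)
  obtain j where j: "j < length bs" "bs ! j = y" using assms(3) by (auto simp: in_set_conv_nth)
  have "list_index (as @ bs) x = i"
    using list_index_nth[OF assms(1), of i] i by (simp add: nth_append)
  moreover have "list_index (as @ bs) y = length as + j"
    using list_index_nth[OF assms(1), of "length as + j"] j by (simp add: nth_append)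
  ultimately show ?thesis using i by simp
qed

context forest
begin

lemma subtrees_disjoint:
  assumes "(p, c) \<in> E" "(p, c') \<in> E" "c \<preceq> x" "c' \<preceq> x"
  shows "c = c'"
proof -
  have no: False if "(p, k) \<in> E" "(p, k') \<in> E" "k \<preceq> k'" "k \<noteq> k'" for k k'
  proof -
    have "k \<preceq> p" using anc_parent that by blast
    then have "(p, p) \<in> E\<^sup>+" using that(1) by (meson rtrancl_into_trancl2)
    then show False using acyclic_E unfolding acyclic_def by blast
  qed
  show ?thesis using anc_linear[OF assms(3,4)] no assms(1,2) by blast
qed

context
  fixes N :: "'n set" and ch :: "'n \<Rightarrow> 'n list"
  assumes E_N: "\<And>x y. (x, y) \<in> E \<Longrightarrow> x \<in> N \<and> y \<in> N"
    and ch: "\<And>p. p \<in> N \<Longrightarrow> distinct (ch p) \<and> set (ch p) = {q. (p, q) \<in> E}"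
begin

lemma descendants_rec:
  assumes "p \<in> N"
  shows "{x. p \<preceq> x} = insert p (\<Union>c\<in>set (ch p). {x. c \<preceq> x})"
proof -
  have "p \<preceq> x \<longleftrightarrow> x = p \<or> (\<exists>c. (p, c) \<in> E \<and> c \<preceq> x)" for x
    by (metis child_towards converse_rtrancl_into_rtrancl rtrancl.rtrancl_refl)
  then show ?thesis using ch[OF assms] by auto
qed

lemma dfs_postorder_set:
  "dfs_postorder ch p xs \<Longrightarrow> p \<in> N \<Longrightarrow> set xs = {x. p \<preceq> x} \<and> distinct xs"
proof (induction rule: dfs_postorder.induct)
  case (1 p xss)
  define cs where "cs = ch p"
  have all: "list_all2 (\<lambda>c xs. dfs_postorder ch c xs \<and> (c \<in> N \<longrightarrow> set xs = {x. c \<preceq> x} \<and> distinct xs)) cs xss"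
    using 1(1) by (simp add: cs_def)
  have cs: "distinct cs" "\<And>c. c \<in> set cs \<Longrightarrow> (p, c) \<in> E" using ch[OF 1(2)] unfolding cs_def by auto
  have "set (concat xss) = (\<Union>c\<in>set cs. {x. c \<preceq> x}) \<and> distinct (concat xss)"
    using all cs
  proof (induction rule: list_all2_induct)
    case (Cons c cs xs xss)
    have "c \<in> N" using Cons.prems(2)[of c] E_N by simp
    then have xs: "set xs = {x. c \<preceq> x}" "distinct xs" using Cons.hyps(1) by auto
    have IH: "set (concat xss) = (\<Union>c\<in>set cs. {x. c \<preceq> x}) \<and> distinct (concat xss)"
      using Cons by auto
    have "set xs \<inter> set (concat xss) = {}"
    proof (rule ccontr)
      assume "\<not> ?thesis"
      then obtain x c' where "c \<preceq> x" "c' \<in> set cs" "c' \<preceq> x" using IH xs(1) by auto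
      then have "c = c'" using subtrees_disjoint[of p c c' x] Cons.prems(2) by simp
      then show False using Cons.prems(1) \<open>c' \<in> set cs\<close> by simp
    qed
    then show ?case using IH xs by simp
  qed simp
  moreover have "p \<notin> (\<Union>c\<in>set cs. {x. c \<preceq> x})"
  proof
    assume "p \<in> (\<Union>c\<in>set cs. {x. c \<preceq> x})"
    then obtain c where "(p, c) \<in> E" "c \<preceq> p" using cs(2) by blast
    then have "(p, p) \<in> E\<^sup>+" by (rule rtrancl_into_trancl2)
    then show False using acyclic_E unfolding acyclic_def by blast
  qed
  ultimately show ?case using descendants_rec[OF 1(2)] by (simp add: cs_def)
qed

text \<open>The nodes below \<open>q\<close> are processed in one contiguous run, which is itself a
  search from \<open>q\<close>. The interval property and the order of siblings are read off from
  this.\<close>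

lemma dfs_postorder_subtree:
  "dfs_postorder ch p xs \<Longrightarrow> p \<in> N \<Longrightarrow> p \<preceq> q \<Longrightarrow> \<exists>as bs cs. xs = as @ bs @ cs \<and> dfs_postorder ch q bs"
proof (induction rule: dfs_postorder.induct)
  case (1 p xss)
  show ?case
  proof (cases "p = q")
    case True
    have "dfs_postorder ch p (concat xss @ [p])"
      using 1(1) by (intro dfs_postorder.intros) (auto elim: list_all2_mono)
    then show ?thesis using True by (metis append_Nil append_Nil2)
  next
    case False
    then obtain c where c: "(p, c) \<in> E" "c \<preceq> q" using child_towards 1(3) by blast
    then obtain k where k: "k < length (ch p)" "ch p ! k = c"
      using ch[OF 1(2)] by (metis in_set_conv_nth mem_Collect_eq)
    have len: "length xss = length (ch p)" using 1(1) by (simp add: list_all2_lengthD)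
    have "\<exists>as bs cs. xss ! k = as @ bs @ cs \<and> dfs_postorder ch q bs"
      using list_all2_nthD[OF 1(1) k(1)] k(2) c E_N by blast
    then obtain as bs cs where x: "xss ! k = as @ bs @ cs" "dfs_postorder ch q bs" by blast
    have "concat xss = concat (take k xss) @ (xss ! k) @ concat (drop (Suc k) xss)"
      using id_take_nth_drop[of k xss] k(1) len by (metis concat.simps(2) concat_append)
    then have "concat xss @ [p] = (concat (take k xss) @ as) @ bs @ (cs @ concat (drop (Suc k) xss) @ [p])"
      using x(1) by simp
    then show ?thesis using x(2) by blast
  qed
qed

lemma
  assumes ns: "dfs_postorder ch r ns" "r \<in> N" and N: "\<And>x. x \<in> N \<Longrightarrow> r \<preceq> x"
  shows postorder_interval: "x \<in> N \<Longrightarrow> y \<in> N \<Longrightarrow> z \<in> N \<Longrightarrow> q \<preceq> x \<Longrightarrow> q \<preceq> z \<Longrightarrow>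
      list_index ns x \<le> list_index ns y \<Longrightarrow> list_index ns y \<le> list_index ns z \<Longrightarrow> q \<preceq> y"
    and postorder_siblings: "p \<in> N \<Longrightarrow> i < j \<Longrightarrow> j < length (ch p) \<Longrightarrow> ch p ! i \<preceq> x \<Longrightarrow>
      ch p ! j \<preceq> y \<Longrightarrow> list_index ns x < list_index ns y"
    and postorder_below: "p \<in> N \<Longrightarrow> p \<preceq> x \<Longrightarrow> list_index ns x \<le> list_index ns p"
proof -
  have dist: "distinct ns" and set_ns: "set ns = {x. r \<preceq> x}"
    using dfs_postorder_set[OF ns] by auto
  have in_N: "q \<in> N" if "q \<preceq> x" "x \<in> N" for q x
    using that E_N by (metis converse_rtranclE)
  have split: "\<exists>as xss cs. ns = as @ (concat xss @ [p]) @ cs \<and> length xss = length (ch p) \<and>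
      (\<forall>k<length (ch p). set (xss ! k) = {x. ch p ! k \<preceq> x}) \<and> set (concat xss @ [p]) = {x. p \<preceq> x}"
    if p: "p \<in> N" for p
  proof -
    obtain as bs cs where s: "ns = as @ bs @ cs" "dfs_postorder ch p bs"
      using dfs_postorder_subtree[OF ns N[OF p]] by blast
    from s(2) obtain xss where x: "bs = concat xss @ [p]" "list_all2 (dfs_postorder ch) (ch p) xss"
      by (cases rule: dfs_postorder.cases) blast
    have "set (xss ! k) = {x. ch p ! k \<preceq> x}" if k: "k < length (ch p)" for k
    proof -
      have "dfs_postorder ch (ch p ! k) (xss ! k)" using list_all2_nthD[OF x(2) k] .
      moreover have "ch p ! k \<in> N" using k ch[OF p] nth_mem E_N by blast
      ultimately show ?thesis using dfs_postorder_set by blast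
    qed
    moreover have "set bs = {x. p \<preceq> x}" using dfs_postorder_set[OF s(2) p] by blast
    ultimately show ?thesis using s(1) x list_all2_lengthD[OF x(2)] by metis
  qed
  show "q \<preceq> y" if h: "x \<in> N" "y \<in> N" "z \<in> N" "q \<preceq> x" "q \<preceq> z"
    "list_index ns x \<le> list_index ns y" "list_index ns y \<le> list_index ns z"
  proof (rule ccontr)
    assume "\<not> q \<preceq> y"
    obtain as xss cs where s: "ns = as @ (concat xss @ [q]) @ cs" "set (concat xss @ [q]) = {x. q \<preceq> x}"
      using split[OF in_N[OF h(4,1)]] by blast
    have "y \<in> set ns" using N h(2) set_ns by blast
    then consider "y \<in> set as" | "y \<in> set cs" using s \<open>\<not> q \<preceq> y\<close> by (metis Un_iff mem_Collect_eq set_append)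
    then show False
    proof cases
      case 1
      have "list_index ns y < list_index ns x"
        unfolding s(1) by (rule list_index_append_less) (use dist s h 1 in auto)
      then show False using h(6) by simp
    next
      case 2
      have "list_index ((as @ concat xss @ [q]) @ cs) z < list_index ((as @ concat xss @ [q]) @ cs) y"
        by (rule list_index_append_less) (use dist s h 2 in auto)
      then show False using h(7) s(1) by simp
    qed
  qed
  show "list_index ns x < list_index ns y"
    if h: "p \<in> N" "i < j" "j < length (ch p)" "ch p ! i \<preceq> x" "ch p ! j \<preceq> y"
  proof -
    obtain as xss cs where s: "ns = as @ (concat xss @ [p]) @ cs" "length xss = length (ch p)"
      "\<And>k. k < length (ch p) \<Longrightarrow> set (xss ! k) = {x. ch p ! k \<preceq> x}"
      using split[OF h(1)] by blast
    have c: "concat xss = concat (take j xss) @ concat (drop j xss)"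
      by (metis append_take_drop_id concat_append)
    have ns_eq: "ns = (as @ concat (take j xss)) @ (concat (drop j xss) @ [p] @ cs)"
      unfolding s(1) c by simp
    have "take j xss ! i \<in> set (take j xss)" using h s(2) by (intro nth_mem) simp
    then have x: "x \<in> set (concat (take j xss))" using s(3)[of i] h by auto
    have "drop j xss ! 0 \<in> set (drop j xss)" using h s(2) by (intro nth_mem) simp
    then have y: "y \<in> set (concat (drop j xss))" using s(2) s(3)[of j] h by auto
    show ?thesis unfolding ns_eq by (rule list_index_append_less) (use dist ns_eq x y in auto)
  qed
  show "list_index ns x \<le> list_index ns p" if h: "p \<in> N" "p \<preceq> x"
  proof (cases "x = p")
    case False
    obtain as xss cs where s: "ns = as @ (concat xss @ [p]) @ cs" "set (concat xss @ [p]) = {x. p \<preceq> x}"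
      using split[OF h(1)] by blast
    have x: "x \<in> set (concat xss)" using s(2) h(2) False by auto
    have ns_eq: "ns = (as @ concat xss) @ ([p] @ cs)" unfolding s(1) by simp
    have "list_index ns x < list_index ns p"
      unfolding ns_eq by (rule list_index_append_less) (use dist ns_eq x in auto)
    then show ?thesis by simp
  qed simp
qed

end

end

section \<open>From minimal tree models to path models\<close>

lemma rooted_tree_forest:
  assumes "rooted_tree T r"
  shows "forest (parcs T)"
proof -
  interpret T: pair_fin_digraph T using assms unfolding rooted_tree_def by blast
  have uniq: "p = q" if "T.awalk r p x" "T.awalk r q x" for p q x
    using assms that T.awalk_last_in_verts unfolding rooted_tree_def by blast
  have ex: "\<exists>p. T.awalk r p x" if "x \<in> pverts T" for x
    using assms that unfolding rooted_tree_def by blast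
  show ?thesis
  proof
    show "finite (parcs T)" by (rule T.pair_finite_arcs)
    show "a = b" if ac: "(a, c) \<in> parcs T" "(b, c) \<in> parcs T" for a b c
    proof -
      obtain p q where p: "T.awalk r p a" "T.awalk r q b"
        using ex[OF T.in_arcsD1[OF ac(1)]] ex[OF T.in_arcsD1[OF ac(2)]] by blast
      have "T.awalk r (p @ [(a, c)]) c" "T.awalk r (q @ [(b, c)]) c"
        using T.awalk_appendI[OF p(1) T.arc_implies_awalk[OF ac(1), simplified]]
          T.awalk_appendI[OF p(2) T.arc_implies_awalk[OF ac(2), simplified]] by blast+
      then have "p @ [(a, c)] = q @ [(b, c)]" by (rule uniq)
      then show ?thesis by simp
    qed
    \<comment> \<open>A cycle through \<open>x\<close> could be appended to the walk from the root
      to \<open>x\<close>, giving a second such walk.\<close>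
    show "acyclic (parcs T)"
      unfolding acyclic_def
    proof (intro allI notI)
      fix x assume "(x, x) \<in> (parcs T)\<^sup>+"
      then obtain y where y: "(x, y) \<in> parcs T" "(y, x) \<in> (parcs T)\<^sup>*" by (meson tranclD)
      have "y \<in> pverts T" "x \<in> pverts T" using y T.in_arcsD1 T.in_arcsD2 by blast+
      then have "(y, x) \<in> rtrancl_on (pverts T) (parcs T)"
        using y(2) T.in_arcsD2 by (intro rtrancl_consistent_rtrancl_on)
      then have "y \<rightarrow>\<^sup>*\<^bsub>T\<^esub> x" unfolding reachable_def by simp
      then have "\<exists>q. T.awalk y q x" by (simp only: T.reachable_awalk)
      then obtain q where q: "T.awalk y q x" ..
      from ex[OF \<open>x \<in> pverts T\<close>] obtain p where p: "T.awalk r p x" ..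
      have "T.awalk r (p @ [(x, y)] @ q) x"
        using T.awalk_appendI[OF p T.awalk_appendI[OF T.arc_implies_awalk[OF y(1), simplified] q]] by simp
      then have "p = p @ [(x, y)] @ q" by (rule uniq[OF p])
      then show False by simp
    qed
  qed
qed

text \<open>The membership condition is there because the reflexive transitive closure relates every
  element of the type to itself, whereas reachability is reflexive on nodes only.\<close>

lemma ancestor_iff:
  assumes "pair_fin_digraph T"
  shows "ancestor T p q \<longleftrightarrow> p \<in> pverts T \<and> (p, q) \<in> (parcs T)\<^sup>*"
proof
  interpret T: pair_fin_digraph T by fact
  assume a: "p \<in> pverts T \<and> (p, q) \<in> (parcs T)\<^sup>*"
  then have "q \<in> pverts T" by (metis T.in_arcsD2 rtranclE)
  then have "(p, q) \<in> rtrancl_on (pverts T) (parcs T)"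
    using a T.in_arcsD2 by (intro rtrancl_consistent_rtrancl_on) auto
  then show "ancestor T p q" unfolding reachable_def by simp
next
  assume "ancestor T p q"
  then show "p \<in> pverts T \<and> (p, q) \<in> (parcs T)\<^sup>*"
    by (auto simp: reachable_def dest: rtrancl_on_rtranclI in_rtrancl_on_in_F)
qed

text \<open>Parents are unique, so climbing from the last node retraces the walk up to its head and
  bypasses nothing between the ends.\<close>

lemma vwalk_between:
  assumes "forest (parcs T)" and "vwalk xs (with_proj T)"
  shows "q \<in> set xs \<longleftrightarrow> (hd xs, q) \<in> (parcs T)\<^sup>* \<and> (q, last xs) \<in> (parcs T)\<^sup>*"
proof
  interpret forest "parcs T" by fact
  have fwd: "(hd xs, q) \<in> (parcs T)\<^sup>* \<and> (q, last xs) \<in> (parcs T)\<^sup>*"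
    if "vwalk xs (with_proj T)" "q \<in> set xs" for xs q
    using vwalk_ancestor[OF that] by (auto simp: reachable_def dest!: rtrancl_on_rtranclI)
  show "q \<in> set xs \<Longrightarrow> (hd xs, q) \<in> (parcs T)\<^sup>* \<and> (q, last xs) \<in> (parcs T)\<^sup>*"
    by (rule fwd[OF assms(2)])
  show "(hd xs, q) \<in> (parcs T)\<^sup>* \<and> (q, last xs) \<in> (parcs T)\<^sup>* \<Longrightarrow> q \<in> set xs"
    using assms(2)
  proof (induction xs rule: vwalk_arcs.induct)
    case (2 x)
    then show ?case using anc_antisym by auto
  next
    case (3 x y xs)
    have w: "vwalk (y # xs) (with_proj T)" and xy: "(x, y) \<in> parcs T"
      using 3(3) by (auto simp: vwalk_def)
    have last: "(q, last (y # xs)) \<in> (parcs T)\<^sup>*" "(x, q) \<in> (parcs T)\<^sup>*" using 3(2) by simp_all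
    have "(y, last (y # xs)) \<in> (parcs T)\<^sup>*" using fwd[OF w, of y] by simp
    then consider "(y, q) \<in> (parcs T)\<^sup>*" | "(q, y) \<in> (parcs T)\<^sup>*" "q \<noteq> y" using anc_linear[OF last(1)] by blast
    then show ?case
    proof cases
      case 1
      then have "q \<in> set (y # xs)" using 3(1)[OF _ w] last(1) by simp
      then show ?thesis by simp
    next
      case 2
      then have "(q, x) \<in> (parcs T)\<^sup>*" using anc_parent xy by blast
      then have "q = x" using last(2) anc_antisym by blast
      then show ?thesis by simp
    qed
  qed (simp add: vwalk_def)
qed

lemma dfs_path_model_of_minimal_tree_model:
  assumes mtm: "minimal_tree_model G T r P"
    and ch: "\<forall>p\<in>pverts T. distinct (ch p) \<and> set (ch p) = {q. (p, q) \<in> parcs T} \<and>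
        (\<forall>x\<in>set (ch p). \<forall>y\<in>set (ch p). explored_before G T P x y \<longrightarrow> precedes_in (ch p) x y)"
    and ns: "dfs_postorder ch r ns"
  shows "dfs_path_model (parcs T) G (high P) (low P) (pverts T) ch (list_index ns)"
    and "set ns = pverts T" and "distinct ns"
proof -
  have tm: "tree_model G T r P" and
    minimal: "\<And>p q. (p, q) \<in> parcs T \<Longrightarrow> \<not> bag G P p \<subseteq> bag G P q \<and> \<not> bag G P q \<subseteq> bag G P p"
    using mtm unfolding minimal_tree_model_def by blast+
  have rt: "rooted_tree T r" using tm unfolding tree_model_def by blast
  have path: "vpath (P v) T" if "v \<in> pverts G" for v using tm that unfolding tree_model_def by blast
  have fin: "pair_fin_digraph T" and r: "r \<in> pverts T" using rt unfolding rooted_tree_def by blast+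
  interpret T: pair_fin_digraph T by (rule fin)
  interpret forest "parcs T" by (rule rooted_tree_forest[OF rt])
  have E_N: "x \<in> pverts T \<and> y \<in> pverts T" if "(x, y) \<in> parcs T" for x y
    using that T.in_arcsD1 T.in_arcsD2 by blast
  have ch': "distinct (ch p) \<and> set (ch p) = {q. (p, q) \<in> parcs T}" if "p \<in> pverts T" for p
    using ch that by blast
  have anc: "ancestor T p q \<longleftrightarrow> p \<in> pverts T \<and> (p, q) \<in> (parcs T)\<^sup>*" for p q by (rule ancestor_iff[OF fin])
  have root: "(r, x) \<in> (parcs T)\<^sup>*" if x: "x \<in> pverts T" for x
  proof -
    obtain p where "T.awalk r p x" using rt x unfolding rooted_tree_def by blast
    then have "ancestor T r x" unfolding T.reachable_awalk ..
    then show ?thesis using anc by blast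
  qed
  have between: "q \<in> set (P v) \<longleftrightarrow> (high P v, q) \<in> (parcs T)\<^sup>* \<and> (q, low P v) \<in> (parcs T)\<^sup>*" if "v \<in> pverts G" for v q
    unfolding high_def low_def using path[OF that] unfolding vpath_def
    by (intro vwalk_between[OF forest_axioms]) blast
  have low_N: "low P v \<in> pverts T" and high_N: "high P v \<in> pverts T" and high_low: "(high P v, low P v) \<in> (parcs T)\<^sup>*"
    if v: "v \<in> pverts G" for v
  proof -
    have w: "P v \<noteq> []" "set (P v) \<subseteq> pverts T" using path[OF v] unfolding vpath_def vwalk_def by auto
    then have "hd (P v) \<in> set (P v)" "last (P v) \<in> set (P v)" by auto
    then show "low P v \<in> pverts T" "high P v \<in> pverts T" using w unfolding low_def high_def by auto
    show "(high P v, low P v) \<in> (parcs T)\<^sup>*"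
      using between[OF v, of "high P v"] \<open>hd (P v) \<in> set (P v)\<close> unfolding high_def by simp
  qed
  show set_ns: "set ns = pverts T"
  proof -
    have "y \<in> pverts T" if "(r, y) \<in> (parcs T)\<^sup>*" for y using that r E_N by (metis rtranclE)
    then show ?thesis using dfs_postorder_set[of "pverts T" ch, OF E_N ch' ns r] root by auto
  qed
  show "distinct ns" using dfs_postorder_set[of "pverts T" ch, OF E_N ch' ns r] by blast
  show "dfs_path_model (parcs T) G (high P) (low P) (pverts T) ch (list_index ns)"
  proof
    show "finite (pverts T)" by (rule T.pair_finite_verts)
    show "(high P v, low P v) \<in> (parcs T)\<^sup>*" "low P v \<in> pverts T" if "v \<in> pverts G" for v
      using high_low low_N that by blast+
    show "(u, w) \<in> parcs G \<longleftrightarrow> (\<exists>q. (high P u, q) \<in> (parcs T)\<^sup>* \<and> (q, low P u) \<in> (parcs T)\<^sup>* \<and> (high P w, q) \<in> (parcs T)\<^sup>* \<and> (q, low P w) \<in> (parcs T)\<^sup>*)"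
      if "u \<in> pverts G" "w \<in> pverts G" "u \<noteq> w" for u w
    proof -
      have "(u, w) \<in> parcs G \<longleftrightarrow> set (P u) \<inter> set (P w) \<noteq> {}"
        using tm that unfolding tree_model_def by blast
      also have "\<dots> \<longleftrightarrow> (\<exists>q. q \<in> set (P u) \<and> q \<in> set (P w))" by blast
      finally show ?thesis unfolding between[OF that(1)] between[OF that(2)] by simp
    qed
    show "\<exists>v\<in>pverts G. (high P v, p) \<in> (parcs T)\<^sup>* \<and> (p, low P v) \<in> (parcs T)\<^sup>* \<and> \<not> ((high P v, q) \<in> (parcs T)\<^sup>* \<and> (q, low P v) \<in> (parcs T)\<^sup>*)"
      if e: "(p, q) \<in> parcs T" for p q
    proof -
      obtain v where "v \<in> bag G P p" "v \<notin> bag G P q" using minimal[OF e] by blast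
      then have "v \<in> pverts G" "p \<in> set (P v)" "q \<notin> set (P v)" unfolding bag_def by auto
      then show ?thesis using between[of v p] between[of v q] by blast
    qed
    show "\<exists>v\<in>pverts G. (high P v, q) \<in> (parcs T)\<^sup>* \<and> (q, low P v) \<in> (parcs T)\<^sup>* \<and> \<not> ((high P v, p) \<in> (parcs T)\<^sup>* \<and> (p, low P v) \<in> (parcs T)\<^sup>*)"
      if e: "(p, q) \<in> parcs T" for p q
    proof -
      obtain v where "v \<in> bag G P q" "v \<notin> bag G P p" using minimal[OF e] by blast
      then have "v \<in> pverts G" "q \<in> set (P v)" "p \<notin> set (P v)" unfolding bag_def by auto
      then show ?thesis using between[of v p] between[of v q] by blast
    qed
    show "distinct (ch p)" "set (ch p) = {q. (p, q) \<in> parcs T}" if "p \<in> pverts T" for p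
      using ch' that by blast+
    show "x \<in> pverts T \<and> y \<in> pverts T" if "(x, y) \<in> parcs T" for x y
      using E_N that by blast
    show "(q, y) \<in> (parcs T)\<^sup>*" if "x \<in> pverts T" "y \<in> pverts T" "z \<in> pverts T" "(q, x) \<in> (parcs T)\<^sup>*" "(q, z) \<in> (parcs T)\<^sup>*"
      "list_index ns x \<le> list_index ns y" "list_index ns y \<le> list_index ns z" for x y z q
      by (rule postorder_interval[of "pverts T" ch, OF E_N ch' ns r root that])
    show "list_index ns x < list_index ns y" if "p \<in> pverts T" "i < j" "j < length (ch p)"
      "(ch p ! i, x) \<in> (parcs T)\<^sup>*" "(ch p ! j, y) \<in> (parcs T)\<^sup>*" for p i j x y
      by (rule postorder_siblings[of "pverts T" ch, OF E_N ch' ns r root that])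
    show "list_index ns x \<le> list_index ns p" if "p \<in> pverts T" "(p, x) \<in> (parcs T)\<^sup>*" for p x
      by (rule postorder_below[of "pverts T" ch, OF E_N ch' ns r root that])
    show "\<exists>w\<in>pverts G. (ch p ! i, low P w) \<in> (parcs T)\<^sup>* \<and> (high P w, high P v) \<in> (parcs T)\<^sup>* \<and>
        (\<forall>v'\<in>pverts G. (ch p ! j, low P v') \<in> (parcs T)\<^sup>* \<longrightarrow> high P v' \<noteq> high P w)"
      if p: "p \<in> pverts T" and ij: "i < j" "j < length (ch p)" and v: "v \<in> pverts G" "(ch p ! j, low P v) \<in> (parcs T)\<^sup>*"
        "(high P v, p) \<in> (parcs T)\<^sup>*" and new: "\<And>w. w \<in> pverts G \<Longrightarrow> (ch p ! i, low P w) \<in> (parcs T)\<^sup>* \<Longrightarrow> high P w \<noteq> high P v"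
      for p i j v
    proof (rule ccontr)
      assume neg: "\<not> ?thesis"
      define x where "x = ch p ! i"
      define y where "y = ch p ! j"
      have xy: "x \<in> set (ch p)" "y \<in> set (ch p)" using ij unfolding x_def y_def by auto
      then have E: "(p, x) \<in> parcs T" "(p, y) \<in> parcs T" using ch'[OF p] by auto
      then have xyN: "x \<in> pverts T" "y \<in> pverts T" using E_N by blast+
      have hb: "h \<in> highs_below G T P c \<longleftrightarrow> (\<exists>w\<in>pverts G. h = high P w \<and> (c, low P w) \<in> (parcs T)\<^sup>*)"
        if "c \<in> pverts T" for c h
        using that unfolding highs_below_def subtree_def anc by auto
      \<comment> \<open>The exploration rule speaks only when the symmetric difference has a
        minimum. Here it does: all its members begin paths that reach below \<open>p\<close>, so
        they are comparable with \<open>p\<close>; one of them, \<open>high P v\<close>, lies above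
        \<open>p\<close>, and the shallowest such member lies above all others. If it belonged to
        the later child \<open>y\<close>, then \<open>y\<close> would have to be explored before
        \<open>x\<close>.\<close>
      define D where "D = (highs_below G T P y - highs_below G T P x) \<union> (highs_below G T P x - highs_below G T P y)"
      define A where "A = {q \<in> D. (q, p) \<in> (parcs T)\<^sup>*}"
      have vA: "high P v \<in> A"
      proof -
        have "high P v \<in> highs_below G T P y"
          unfolding hb[OF xyN(2)] using v(1,2) by (auto simp: y_def)
        moreover have "high P v \<notin> highs_below G T P x"
          unfolding hb[OF xyN(1)] using new by (metis x_def)
        ultimately show ?thesis using v(3) unfolding A_def D_def by simp
      qed
      obtain s where s: "s \<in> A" "\<And>q. q \<in> A \<Longrightarrow> depth s \<le> depth q"
        using ex_has_least_nat[of "\<lambda>q. q \<in> A" "high P v" depth] vA by blast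
      have s_le: "(s, q) \<in> (parcs T)\<^sup>*" if q: "q \<in> D" for q
      proof -
        obtain w c where w: "w \<in> pverts G" "q = high P w" "c = x \<or> c = y" "(c, low P w) \<in> (parcs T)\<^sup>*"
          using q unfolding D_def Un_iff Diff_iff hb[OF xyN(1)] hb[OF xyN(2)] by blast
        have "(p, low P w) \<in> (parcs T)\<^sup>*" using w(3,4) E by (auto intro: converse_rtrancl_into_rtrancl)
        then consider "(q, p) \<in> (parcs T)\<^sup>*" | "(p, q) \<in> (parcs T)\<^sup>*" using anc_linear high_low[OF w(1)] w(2) by blast
        then show ?thesis
        proof cases
          case 1
          then have "q \<in> A" using q unfolding A_def by blast
          then show ?thesis using s anc_iff_depth[of s p q] unfolding A_def by blast
        next
          case 2
          then show ?thesis using s(1) unfolding A_def by (blast intro: rtrancl_trans)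
        qed
      qed
      have "s \<notin> highs_below G T P x - highs_below G T P y"
      proof
        assume sx: "s \<in> highs_below G T P x - highs_below G T P y"
        then obtain w where w: "w \<in> pverts G" "s = high P w" "(x, low P w) \<in> (parcs T)\<^sup>*" using hb[OF xyN(1)] by blast
        have "(high P w, high P v) \<in> (parcs T)\<^sup>*" using s_le vA w(2) unfolding A_def by blast
        moreover have "\<forall>v'\<in>pverts G. (y, low P v') \<in> (parcs T)\<^sup>* \<longrightarrow> high P v' \<noteq> high P w"
          using sx unfolding Diff_iff hb[OF xyN(2)] w(2) by metis
        ultimately show False using neg w unfolding x_def y_def by blast
      qed
      then have "s \<in> highs_below G T P y" using s(1) unfolding A_def D_def by blast
      then obtain u where u: "u \<in> pverts G" "s = high P u" "(y, low P u) \<in> (parcs T)\<^sup>*" using hb[OF xyN(2)] by blast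
      have "explored_before G T P y x"
        unfolding explored_before_def D_def[symmetric] Let_def
      proof (intro bexI[OF _ u(1)] conjI ballI)
        show "low P u \<in> subtree T y" using u(3) xyN unfolding subtree_def anc by simp
        show "high P u \<in> D" using s(1) u(2) unfolding A_def by simp
        show "ancestor T (high P u) q" if "q \<in> D" for q
          using s_le[OF that] u(2) high_N[OF u(1)] anc by simp
      qed
      then have "precedes_in (ch p) y x" using ch p xy by blast
      then have "list_index (ch p) y < list_index (ch p) x"
        using precedes_in_iff[OF _ xy(2,1)] ch'[OF p] by blast
      then show False
        using list_index_nth[of "ch p"] ch'[OF p] ij unfolding x_def y_def by simp
    qed
  qed
qed

text \<open>Three distinct rows or columns are asked of a cell because one of them may be empty: an
  empty row can be due to a highest node off the path to \<pi>, an empty column to a highest node in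
  no segment.\<close>

lemma two_distinct_nonempty:
  assumes "3 \<le> card \<A>"
  shows "\<exists>A\<in>\<A>. \<exists>B\<in>\<A>. A \<noteq> {} \<and> B \<noteq> {} \<and> A \<noteq> B"
proof (rule ccontr)
  assume neg: "\<not> ?thesis"
  have "\<exists>C. \<A> \<subseteq> {{}, C}"
  proof (cases "\<A> \<subseteq> {{}}")
    case False
    then obtain C where "C \<in> \<A>" "C \<noteq> {}" by blast
    then show ?thesis using neg by blast
  qed blast
  then obtain C where "\<A> \<subseteq> {{}, C}" by blast
  then have "card \<A> \<le> card {{}, C}" by (intro card_mono) auto
  also have "\<dots> \<le> 2" by (simp add: card_insert_if)
  finally show False using assms by simp
qed

context dfs_path_model
begin

text \<open>
  The first segment and every second group are dropped: vertices with the same lowest node are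
  ordered by their highest nodes, so this makes the groups disjoint in the postorder.
\<close>

lemma transversal_pair_of_weak_grid:
  assumes t: "0 < t" and D: "D \<in> N"
    and z: "\<And>i j. i \<le> 2 * t\<^sup>2 + 2 \<Longrightarrow> j < 2 * n \<Longrightarrow>
      z i j \<in> pverts G \<and> hi (z i j) \<preceq> D \<and> D \<preceq> lo (z i j)"
    and z_depth: "\<And>i i' j j'. i < i' \<Longrightarrow> i' \<le> 2 * t\<^sup>2 + 2 \<Longrightarrow> j < 2 * n \<Longrightarrow> j' < 2 * n \<Longrightarrow>
      depth (hi (z i j)) < depth (hi (z i' j'))"
    and z_pos: "\<And>i i' j j'. i \<le> 2 * t\<^sup>2 + 2 \<Longrightarrow> i' \<le> 2 * t\<^sup>2 + 2 \<Longrightarrow> j < j' \<Longrightarrow> j' < 2 * n \<Longrightarrow>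
      pos (lo (z i j)) \<le> pos (lo (z i' j')) \<and> (pos (lo (z i j)) = pos (lo (z i' j')) \<longrightarrow> i \<le> i')"
    and n: "((2 * t\<^sup>2) ^ Suc (t\<^sup>2) + 2) ^ Suc (t\<^sup>2) \<le> n"
  shows "semi_induced_transversal_pair t 0 G \<or> semi_induced_transversal_pair t 2 G"
proof -
  interpret path_grid E G hi lo N ch pos t n D "\<lambda>i a. z (Suc i) (2 * a)"
  proof
    fix i a assume ia: "i \<le> 2 * t\<^sup>2" "a < n"
    have b: "Suc i \<le> 2 * t\<^sup>2 + 2" "2 * a < 2 * n" using ia by auto
    show "z (Suc i) (2 * a) \<in> pverts G" "hi (z (Suc i) (2 * a)) \<preceq> D" "D \<preceq> lo (z (Suc i) (2 * a))"
      using z[OF b] by auto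
    \<comment> \<open>The segment of index 2 t^2 + 2 is given up as well: it separates the retained
      segments from \<open>D\<close> and so keeps their highest nodes away from
      \<open>D\<close>.\<close>
    have "depth (hi (z (Suc i) (2 * a))) < depth (hi (z (2 * t\<^sup>2 + 2) (2 * a)))"
      using ia by (intro z_depth) auto
    also have "\<dots> \<le> depth D" using z[OF _ b(2)] by (intro depth_le) simp
    finally show "hi (z (Suc i) (2 * a)) \<noteq> D" by blast
  next
    fix i i' a a' assume "i < i'" "i' \<le> 2 * t\<^sup>2" "a < n" "a' < n"
    then show "depth (hi (z (Suc i) (2 * a))) < depth (hi (z (Suc i') (2 * a')))"
      by (intro z_depth) auto
  next
    fix i i' a a' assume h: "i \<le> 2 * t\<^sup>2" "i' \<le> 2 * t\<^sup>2" "a < a'" "a' < n"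
    \<comment> \<open>A vertex of the dropped group and the dropped segment is placed in between;
      equal positions would force \<open>Suc i \<le> 0\<close>, so the first comparison is
      strict.\<close>
    have 1: "pos (lo (z (Suc i) (2 * a))) \<le> pos (lo (z 0 (2 * a + 1))) \<and>
        (pos (lo (z (Suc i) (2 * a))) = pos (lo (z 0 (2 * a + 1))) \<longrightarrow> Suc i \<le> 0)"
      using h by (intro z_pos) auto
    have 2: "pos (lo (z 0 (2 * a + 1))) \<le> pos (lo (z (Suc i') (2 * a')))"
      using z_pos[of 0 "Suc i'" "2 * a + 1" "2 * a'"] h by simp
    show "pos (lo (z (Suc i) (2 * a))) < pos (lo (z (Suc i') (2 * a')))" using 1 2 by linarith
  qed (use t D in auto)
  show ?thesis by (rule transversal_pair_of_grid[OF n])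
qed

end

section \<open>Divisions of the adjacency matrix\<close>

locale ordered_dfs_path_model = dfs_path_model E G hi lo N ch pos
  for E :: "'n rel" and G :: "'v pair_pre_digraph" and hi lo N ch pos +
  fixes vs :: "'v list"
  assumes distinct_vs: "distinct vs"
    and set_vs: "set vs = pverts G"
    and vs_pos: "a < b \<Longrightarrow> b < length vs \<Longrightarrow> pos (lo (vs ! a)) \<le> pos (lo (vs ! b))"
    and vs_tie: "a < b \<Longrightarrow> b < length vs \<Longrightarrow> pos (lo (vs ! a)) = pos (lo (vs ! b)) \<Longrightarrow>
      (hi (vs ! b), hi (vs ! a)) \<in> E\<^sup>* \<Longrightarrow> hi (vs ! b) = hi (vs ! a)"
begin

definition adj :: "nat \<Rightarrow> nat \<Rightarrow> bool" where
  "adj a b \<longleftrightarrow> (vs ! a, vs ! b) \<in> parcs G"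

definition mixed_cell :: "nat set \<Rightarrow> nat set \<Rightarrow> bool" where
  "mixed_cell A B \<longleftrightarrow> 3 \<le> card ((\<lambda>a. {b \<in> B. adj a b}) ` A) \<or> 3 \<le> card ((\<lambda>b. {a \<in> A. adj a b}) ` B)"

lemma vs_V: "a < length vs \<Longrightarrow> vs ! a \<in> pverts G"
  using set_vs nth_mem by blast

lemma adj_sym: "a < length vs \<Longrightarrow> b < length vs \<Longrightarrow> a \<noteq> b \<Longrightarrow> adj a b \<longleftrightarrow> adj b a"
  unfolding adj_def using arcs_sym vs_V distinct_vs nth_eq_iff_index_eq by metis

text \<open>The lowest element is the end of the segment, that is, the lowest common ancestor of the
  two nodes. As sets these ends are compared by inclusion, and the definition also makes sense if
  there is no common ancestor.\<close>

definition common :: "'n \<Rightarrow> nat \<Rightarrow> 'n set" where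
  "common \<pi> a = {q. q \<preceq> lo (vs ! a) \<and> q \<preceq> \<pi>}"

lemma common_linear: "common \<pi> a \<subseteq> common \<pi> b \<or> common \<pi> b \<subseteq> common \<pi> a"
proof (rule ccontr)
  assume "\<not> ?thesis"
  then obtain p q where pq: "p \<in> common \<pi> a" "p \<notin> common \<pi> b" "q \<in> common \<pi> b" "q \<notin> common \<pi> a" by blast
  then have "p \<preceq> q \<or> q \<preceq> p" using anc_linear unfolding common_def by blast
  then show False using pq unfolding common_def by (auto intro: rtrancl_trans)
qed

lemma vs_between:
  assumes "a \<le> b" "b \<le> c" "c < length vs" "q \<preceq> lo (vs ! a)" "q \<preceq> lo (vs ! c)"
  shows "q \<preceq> lo (vs ! b)"
proof (rule subtree_interval[OF _ _ _ assms(4,5)])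
  show "lo (vs ! a) \<in> N" "lo (vs ! b) \<in> N" "lo (vs ! c) \<in> N" using assms lo_N vs_V by auto
  show "pos (lo (vs ! a)) \<le> pos (lo (vs ! b))" using vs_pos[of a b] assms by (cases "a = b") auto
  show "pos (lo (vs ! b)) \<le> pos (lo (vs ! c))" using vs_pos[of b c] assms by (cases "b = c") auto
qed

text \<open>The subtree of an ancestor shared by positions \<open>a\<close> and \<beta> is an
  interval of the order, so all positions in between share it too. Thus segments lengthen up to
  \<beta> and, by the next lemma, shorten after it.\<close>

lemma common_mono: "a \<le> b \<Longrightarrow> b \<le> \<beta> \<Longrightarrow> \<beta> < length vs \<Longrightarrow> common (lo (vs ! \<beta>)) a \<subseteq> common (lo (vs ! \<beta>)) b"
  unfolding common_def using vs_between by blast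

lemma common_antimono: "\<beta> \<le> a \<Longrightarrow> a \<le> b \<Longrightarrow> b < length vs \<Longrightarrow> common (lo (vs ! \<beta>)) b \<subseteq> common (lo (vs ! \<beta>)) a"
  unfolding common_def using vs_between by blast

text \<open>A node on both paths is an ancestor of lowest nodes on either side of \<beta>, hence of
  the one at \<beta>. So the paths can only meet above that node, where they are segments of one
  root path and intersect once each starts no lower than the other ends.\<close>

lemma adj_iff_common:
  assumes "a \<le> \<beta>" "\<beta> \<le> b" "a \<noteq> b" "b < length vs"
  shows "adj a b \<longleftrightarrow> hi (vs ! a) \<in> common (lo (vs ! \<beta>)) b \<and> hi (vs ! b) \<in> common (lo (vs ! \<beta>)) a"
proof -
  have V: "vs ! a \<in> pverts G" "vs ! b \<in> pverts G" "vs ! a \<noteq> vs ! b"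
    using assms vs_V distinct_vs by (auto simp: nth_eq_iff_index_eq)
  show ?thesis
  proof
    assume "adj a b"
    then obtain q where q: "on_path (vs ! a) q" "on_path (vs ! b) q"
      using arcs_on_path[OF V] unfolding adj_def by blast
    have "q \<preceq> lo (vs ! \<beta>)" using vs_between[OF assms(1,2,4)] q unfolding on_path_def by blast
    then show "hi (vs ! a) \<in> common (lo (vs ! \<beta>)) b \<and> hi (vs ! b) \<in> common (lo (vs ! \<beta>)) a"
      using q unfolding on_path_def common_def by (auto intro: rtrancl_trans)
  next
    assume h: "hi (vs ! a) \<in> common (lo (vs ! \<beta>)) b \<and> hi (vs ! b) \<in> common (lo (vs ! \<beta>)) a"
    then consider "hi (vs ! a) \<preceq> hi (vs ! b)" | "hi (vs ! b) \<preceq> hi (vs ! a)"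
      using anc_linear unfolding common_def by blast
    then show "adj a b"
    proof cases
      case 1
      then have "on_path (vs ! a) (hi (vs ! b))" "on_path (vs ! b) (hi (vs ! b))"
        using h hi_lo[OF V(2)] unfolding on_path_def common_def by auto
      then show ?thesis using arcs_on_path[OF V] unfolding adj_def by blast
    next
      case 2
      then have "on_path (vs ! a) (hi (vs ! a))" "on_path (vs ! b) (hi (vs ! a))"
        using h hi_lo[OF V(1)] unfolding on_path_def common_def by auto
      then show ?thesis using arcs_on_path[OF V] unfolding adj_def by blast
    qed
  qed
qed

text \<open>The paths of the vertices in the blocks \<open>Z j\<close> leave the path to \<open>\<pi>\<close> below those in the blocks \<open>U i\<close>.\<close>

lemma transversal_pair_of_separated_blocks:
  fixes U Z :: "nat \<Rightarrow> nat set"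
  assumes t: "0 < t"
    and Z: "\<And>j. j < h \<Longrightarrow> Z j \<subseteq> {..<length vs}"
    and Z_less: "\<And>j j' a b. j < j' \<Longrightarrow> j' < h \<Longrightarrow> a \<in> Z j \<Longrightarrow> b \<in> Z j' \<Longrightarrow> a < b"
    and U_mono: "\<And>i i' a b. i < i' \<Longrightarrow> i' < h \<Longrightarrow> a \<in> U i \<Longrightarrow> b \<in> U i' \<Longrightarrow> common \<pi> a \<subseteq> common \<pi> b"
    and UZ: "\<And>i j a b. i < h \<Longrightarrow> j < h \<Longrightarrow> a \<in> U i \<Longrightarrow> b \<in> Z j \<Longrightarrow> common \<pi> a \<subseteq> common \<pi> b"
    and adj: "\<And>i j a b. i < h \<Longrightarrow> j < h \<Longrightarrow> a \<in> U i \<Longrightarrow> b \<in> Z j \<Longrightarrow>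
      adj a b \<longleftrightarrow> hi (vs ! a) \<in> common \<pi> b \<and> hi (vs ! b) \<in> common \<pi> a"
    and U_low: "\<And>i a. i < h \<Longrightarrow> a \<in> U i \<Longrightarrow> hi (vs ! a) \<preceq> lo (vs ! a)"
    and mixed: "\<And>i j. i < h \<Longrightarrow> j < h \<Longrightarrow> mixed_cell (U i) (Z j)"
    and h: "2 * ((2 * t\<^sup>2) ^ Suc (t\<^sup>2) + 2) ^ Suc (t\<^sup>2) \<le> h" "2 * t\<^sup>2 + 3 < h"
  shows "semi_induced_transversal_pair t 0 G \<or> semi_induced_transversal_pair t 2 G"
proof -
  \<comment> \<open>Once \<open>hi (vs ! a)\<close> lies above \<pi> it belongs to the segment of
    \<open>a\<close>, hence to the longer one of \<open>b\<close>; what remains is a threshold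
    condition on \<open>hi (vs ! b)\<close>.\<close>
  have adj': "adj a b \<longleftrightarrow> hi (vs ! a) \<preceq> \<pi> \<and> hi (vs ! b) \<in> common \<pi> a"
    if "i < h" "j < h" "a \<in> U i" "b \<in> Z j" for i j a b
    using adj[OF that] UZ[OF that] U_low[OF that(1,3)] unfolding common_def by blast
  have ex: "\<exists>b\<in>Z j. (\<exists>a\<in>U i. hi (vs ! b) \<notin> common \<pi> a) \<and> (\<exists>a\<in>U i. hi (vs ! b) \<in> common \<pi> a)"
    if ij: "i < h" "j < h" for i j
    using mixed[OF ij] unfolding mixed_cell_def
  proof
    assume "3 \<le> card ((\<lambda>a. {b \<in> Z j. adj a b}) ` U i)"
    from two_distinct_nonempty[OF this] obtain a a' where a: "a \<in> U i" "a' \<in> U i"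
      "{b \<in> Z j. adj a b} \<noteq> {}" "{b \<in> Z j. adj a' b} \<noteq> {}" "{b \<in> Z j. adj a b} \<noteq> {b \<in> Z j. adj a' b}" by blast
    then have ok: "hi (vs ! a) \<preceq> \<pi>" "hi (vs ! a') \<preceq> \<pi>" using adj'[OF ij] by blast+
    obtain b where "b \<in> Z j" "adj a b \<noteq> adj a' b" using a(5) by blast
    then have "b \<in> Z j" "(hi (vs ! b) \<in> common \<pi> a) \<noteq> (hi (vs ! b) \<in> common \<pi> a')"
      using adj'[OF ij a(1)] adj'[OF ij a(2)] ok by blast+
    then show ?thesis using a(1,2) by blast
  next
    assume "3 \<le> card ((\<lambda>b. {a \<in> U i. adj a b}) ` Z j)"
    from two_distinct_nonempty[OF this] obtain b b' where b: "b \<in> Z j" "b' \<in> Z j"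
      "{a \<in> U i. adj a b} \<noteq> {}" "{a \<in> U i. adj a b'} \<noteq> {}" "{a \<in> U i. adj a b} \<noteq> {a \<in> U i. adj a b'}" by blast
    then obtain a where a: "a \<in> U i" "adj a b \<noteq> adj a b'" by blast
    \<comment> \<open>Two different columns disagree at some \<open>a\<close>. One of them is
      adjacent to \<open>a\<close>, which puts \<open>hi (vs ! a)\<close> above \<pi>; the other is
      the required \<open>c\<close>, its column being nonempty.\<close>
    have "\<exists>c\<in>Z j. \<exists>a\<in>U i. hi (vs ! a) \<preceq> \<pi> \<and> \<not> adj a c \<and> {a \<in> U i. adj a c} \<noteq> {}"
      using a b adj'[OF ij] by blast
    then obtain c a a' where "c \<in> Z j" "a \<in> U i" "hi (vs ! a) \<preceq> \<pi>" "\<not> adj a c" "a' \<in> U i" "adj a' c" by blast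
    then show ?thesis using adj'[OF ij] by blast
  qed
  define w where "w i j = (SOME b. b \<in> Z j \<and> (\<exists>a\<in>U i. hi (vs ! b) \<notin> common \<pi> a) \<and> (\<exists>a\<in>U i. hi (vs ! b) \<in> common \<pi> a))" for i j
  have w: "w i j \<in> Z j \<and> (\<exists>a\<in>U i. hi (vs ! w i j) \<notin> common \<pi> a) \<and> (\<exists>a\<in>U i. hi (vs ! w i j) \<in> common \<pi> a)"
    if "i < h" "j < h" for i j
    unfolding w_def by (rule someI_ex) (use ex[OF that] in blast)
  define z where "z i j = vs ! w i j" for i j
  have w_len: "w i j < length vs" if "i < h" "j < h" for i j
    using w[OF that] Z[OF that(2)] by blast
  \<comment> \<open>The highest node for block \<open>i\<close> lies above the end of one segment of
    \<open>U i\<close>, hence above all ends in \<open>U i'\<close>, while the one for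
    \<open>i'\<close> fails to lie above some end in \<open>U i'\<close>.\<close>
  have step: "hi (z i j) \<preceq> hi (z i' j') \<and> hi (z i j) \<noteq> hi (z i' j')"
    if lt: "i < i'" "i' < h" "j < h" "j' < h" for i i' j j'
  proof -
    have "i < h" using lt by simp
    then obtain a where a: "a \<in> U i" "hi (z i j) \<in> common \<pi> a" using w[of i j] lt unfolding z_def by blast
    obtain b where b: "b \<in> U i'" "hi (z i' j') \<notin> common \<pi> b" using w[of i' j'] lt unfolding z_def by blast
    obtain c where c: "hi (z i' j') \<in> common \<pi> c" using w[of i' j'] lt unfolding z_def by blast
    have 1: "hi (z i j) \<in> common \<pi> b" using a(2) U_mono[OF lt(1,2) a(1) b(1)] by blast
    have "\<not> hi (z i' j') \<preceq> hi (z i j)"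
      using 1 b(2) unfolding common_def by (auto intro: rtrancl_trans)
    moreover have "hi (z i j) \<preceq> hi (z i' j') \<or> hi (z i' j') \<preceq> hi (z i j)"
      using anc_linear 1 c unfolding common_def by blast
    ultimately show ?thesis by auto
  qed
  \<comment> \<open>The last block of \<open>U\<close> is spent on \<open>D\<close>: the blocks
    before it give highest nodes strictly above \<open>D\<close>, and since \<open>D\<close> lies in
    a segment of \<open>U\<close>, it is an ancestor of all lowest nodes in the
    \<open>Z\<close>-blocks.\<close>
  define D where "D = hi (z (h - 1) 0)"
  have h1: "h - 1 < h" "0 < h" using h by auto
  obtain a where a: "a \<in> U (h - 1)" "D \<in> common \<pi> a" using w[OF h1] unfolding D_def z_def by blast
  have D_lo: "D \<preceq> lo (z i j)" if "i < h" "j < h" for i j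
    using UZ[OF h1(1) that(2) a(1)] w[OF that] a(2) unfolding z_def common_def by blast
  have z_V: "z i j \<in> pverts G" if "i < h" "j < h" for i j
    unfolding z_def by (rule vs_V[OF w_len[OF that]])
  show ?thesis
  proof (rule transversal_pair_of_weak_grid[OF t, where D = D and z = z and n = "h div 2"])
    have "hi (z 0 0) \<preceq> D" "hi (z 0 0) \<noteq> D" using step[of 0 "h - 1" 0 0] h unfolding D_def by auto
    then obtain p where "(p, D) \<in> E" by (metis rtranclE)
    then show "D \<in> N" using E_N by blast
    have two: "j < h" if "j < 2 * (h div 2)" for j using that by linarith
    show "z i j \<in> pverts G \<and> hi (z i j) \<preceq> D \<and> D \<preceq> lo (z i j)"
      if "i \<le> 2 * t\<^sup>2 + 2" "j < 2 * (h div 2)" for i j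
    proof -
      have b: "i < h - 1" "i < h" "j < h" using that h two by auto
      show ?thesis using z_V[OF b(2,3)] D_lo[OF b(2,3)] step[OF b(1) h1(1) b(3) h1(2)] unfolding D_def by blast
    qed
    show "depth (hi (z i j)) < depth (hi (z i' j'))"
      if "i < i'" "i' \<le> 2 * t\<^sup>2 + 2" "j < 2 * (h div 2)" "j' < 2 * (h div 2)" for i i' j j'
      using step[of i i' j j'] that h two by (intro depth_less) auto
    show "pos (lo (z i j)) \<le> pos (lo (z i' j')) \<and> (pos (lo (z i j)) = pos (lo (z i' j')) \<longrightarrow> i \<le> i')"
      if ij: "i \<le> 2 * t\<^sup>2 + 2" "i' \<le> 2 * t\<^sup>2 + 2" "j < j'" "j' < 2 * (h div 2)" for i i' j j'
    proof -
      have b: "i < h" "i' < h" "j < h" "j' < h" using ij h two by auto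
      have ww: "w i j < w i' j'" using Z_less[OF ij(3) b(4)] w[OF b(1,3)] w[OF b(2,4)] by blast
      have "i \<le> i'" if eq: "pos (lo (z i j)) = pos (lo (z i' j'))"
      proof (rule ccontr)
        assume "\<not> i \<le> i'"
        then have "hi (z i' j') \<preceq> hi (z i j) \<and> hi (z i' j') \<noteq> hi (z i j)"
          using b by (intro step) auto
        then show False using vs_tie[OF ww w_len[OF b(2,4)]] eq unfolding z_def by blast
      qed
      then show ?thesis using vs_pos[OF ww w_len[OF b(2,4)]] unfolding z_def by blast
    qed
    show "((2 * t\<^sup>2) ^ Suc (t\<^sup>2) + 2) ^ Suc (t\<^sup>2) \<le> h div 2" using h(1) by linarith
  qed
qed

lemma mixed_cell_sym:
  assumes "A \<subseteq> {..<length vs}" "B \<subseteq> {..<length vs}" "A \<inter> B = {}" "mixed_cell A B"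
  shows "mixed_cell B A"
proof -
  have sym: "adj a b \<longleftrightarrow> adj b a" if "a \<in> A" "b \<in> B" for a b
    using that assms by (intro adj_sym) auto
  have "(\<lambda>a. {b \<in> B. adj a b}) ` A = (\<lambda>a. {b \<in> B. adj b a}) ` A"
    "(\<lambda>b. {a \<in> A. adj a b}) ` B = (\<lambda>b. {a \<in> A. adj b a}) ` B"
    using sym by (auto intro!: image_cong)
  then show ?thesis using assms(4) unfolding mixed_cell_def by auto
qed

text \<open>Along the order, the ends of the segments move down towards \<pi> within the
  \<open>X\<close>-blocks and up again within the \<open>Y\<close>-blocks. Comparing the ends at the
  medians \<xi> and \<eta> therefore settles a pair of halves completely: either the first halves
  have \<open>X\<close> above \<open>Y\<close>, or the second halves have \<open>Y\<close> above
  \<open>X\<close>. In the latter case the \<open>Y\<close>-blocks are read backwards, so that their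
  ends descend with the index.\<close>

lemma transversal_pair_of_blocks:
  fixes X Y :: "nat \<Rightarrow> nat set"
  assumes t: "0 < t"
    and len: "\<And>i. i < 2 * h \<Longrightarrow> X i \<subseteq> {..<length vs}" "\<And>j. j < 2 * h \<Longrightarrow> Y j \<subseteq> {..<length vs}"
    and X_less: "\<And>i i' a b. i < i' \<Longrightarrow> i' < 2 * h \<Longrightarrow> a \<in> X i \<Longrightarrow> b \<in> X i' \<Longrightarrow> a < b"
    and Y_less: "\<And>i i' a b. i < i' \<Longrightarrow> i' < 2 * h \<Longrightarrow> a \<in> Y i \<Longrightarrow> b \<in> Y i' \<Longrightarrow> a < b"
    and XY: "\<And>i j a b. i < 2 * h \<Longrightarrow> j < 2 * h \<Longrightarrow> a \<in> X i \<Longrightarrow> b \<in> Y j \<Longrightarrow> a < b"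
    and ne: "\<And>i. i < 2 * h \<Longrightarrow> X i \<noteq> {}" "\<And>i. i < 2 * h \<Longrightarrow> Y i \<noteq> {}"
    and mixed: "\<And>i j. i < 2 * h \<Longrightarrow> j < 2 * h \<Longrightarrow> mixed_cell (X i) (Y j)"
    and h: "2 * ((2 * t\<^sup>2) ^ Suc (t\<^sup>2) + 2) ^ Suc (t\<^sup>2) \<le> h" "2 * t\<^sup>2 + 3 < h"
  shows "semi_induced_transversal_pair t 0 G \<or> semi_induced_transversal_pair t 2 G"
proof -
  have fin: "finite (X i)" "finite (Y i)" if "i < 2 * h" for i
    using len[OF that] finite_subset by blast+
  have h0: "0 < h" using h by simp
  define \<beta> where "\<beta> = Max (X (2 * h - 1))"
  have \<beta>: "\<beta> \<in> X (2 * h - 1)" using fin ne h0 unfolding \<beta>_def by (intro Max_in) auto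
  have X_\<beta>: "a \<le> \<beta>" if "a \<in> X i" "i < 2 * h" for a i
  proof (cases "i = 2 * h - 1")
    case True
    then show ?thesis using that fin unfolding \<beta>_def by auto
  next
    case False
    then have "i < 2 * h - 1" "2 * h - 1 < 2 * h" using that by linarith+
    then show ?thesis using X_less[of i "2 * h - 1" a \<beta>] that \<beta> by simp
  qed
  have Y_\<beta>: "\<beta> \<le> b" if "b \<in> Y j" "j < 2 * h" for b j
    using XY[of "2 * h - 1" j \<beta> b] \<beta> that by simp
  define \<pi> where "\<pi> = lo (vs ! \<beta>)"
  have \<beta>_len: "\<beta> < length vs" using \<beta> len(1)[of "2 * h - 1"] h0 by auto
  have X_mono: "common \<pi> a \<subseteq> common \<pi> b" if "a \<le> b" "b \<in> X i" "i < 2 * h" for a b i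
    unfolding \<pi>_def using common_mono that X_\<beta> \<beta>_len by blast
  have Y_mono: "common \<pi> b \<subseteq> common \<pi> a" if "a \<le> b" "a \<in> Y i" "i < 2 * h" "b \<in> Y j" "j < 2 * h" for a b i j
    unfolding \<pi>_def using common_antimono[of \<beta> a b] that Y_\<beta>[OF that(2,3)] len(2)[OF that(5)] by blast
  have adj: "adj a b \<longleftrightarrow> hi (vs ! a) \<in> common \<pi> b \<and> hi (vs ! b) \<in> common \<pi> a"
    if "a \<in> X i" "i < 2 * h" "b \<in> Y j" "j < 2 * h" for a b i j
    unfolding \<pi>_def using adj_iff_common[of a \<beta> b] X_\<beta>[OF that(1,2)] Y_\<beta>[OF that(3,4)] XY[OF that(2,4,1,3)]
      len(2)[OF that(4)] that(3) by auto
  have hl: "hi (vs ! a) \<preceq> lo (vs ! a)" if "a < length vs" for a using hi_lo vs_V[OF that] by blast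
  define \<xi> where "\<xi> = Max (X (h - 1))"
  define \<eta> where "\<eta> = Max (Y (h - 1))"
  have \<xi>: "\<xi> \<in> X (h - 1)" and \<eta>: "\<eta> \<in> Y (h - 1)"
    using fin ne h0 unfolding \<xi>_def \<eta>_def by (auto intro!: Max_in)
  have X_\<xi>: "a \<le> \<xi>" if "a \<in> X i" "i < h" for a i
  proof (cases "i = h - 1")
    case True
    then show ?thesis using that fin unfolding \<xi>_def by auto
  next
    case False
    then have "i < h - 1" "h - 1 < 2 * h" using that by linarith+
    then show ?thesis using X_less[of i "h - 1" a \<xi>] that \<xi> by simp
  qed
  have Y_\<eta>: "b \<le> \<eta>" if "b \<in> Y i" "i < h" for b i
  proof (cases "i = h - 1")
    case True
    then show ?thesis using that fin unfolding \<eta>_def by auto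
  next
    case False
    then have "i < h - 1" "h - 1 < 2 * h" using that by linarith+
    then show ?thesis using Y_less[of i "h - 1" b \<eta>] that \<eta> by simp
  qed
  have \<xi>_X: "\<xi> \<le> a" if "a \<in> X i" "h \<le> i" "i < 2 * h" for a i
  proof -
    have "h - 1 < i" using that h0 by linarith
    then show ?thesis using X_less[of "h - 1" i \<xi> a] \<xi> that by simp
  qed
  have \<eta>_Y: "\<eta> \<le> b" if "b \<in> Y i" "h \<le> i" "i < 2 * h" for b i
  proof -
    have "h - 1 < i" using that h0 by linarith
    then show ?thesis using Y_less[of "h - 1" i \<eta> b] \<eta> that by simp
  qed
  consider "common \<pi> \<xi> \<subseteq> common \<pi> \<eta>" | "common \<pi> \<eta> \<subseteq> common \<pi> \<xi>" using common_linear by blast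
  then show ?thesis
  proof cases
    case 1
    show ?thesis
    proof (rule transversal_pair_of_separated_blocks[OF t, where U = X and Z = Y and h = h and \<pi> = \<pi>])
      show "Y j \<subseteq> {..<length vs}" if "j < h" for j using len that by simp
      show "a < b" if "j < j'" "j' < h" "a \<in> Y j" "b \<in> Y j'" for j j' a b
        using Y_less[of j j'] that by simp
      show "common \<pi> a \<subseteq> common \<pi> b" if "i < i'" "i' < h" "a \<in> X i" "b \<in> X i'" for i i' a b
        using X_mono[of a b i'] X_less[of i i' a b] that by simp
      show "common \<pi> a \<subseteq> common \<pi> b" if "i < h" "j < h" "a \<in> X i" "b \<in> Y j" for i j a b
      proof -
        have "common \<pi> a \<subseteq> common \<pi> \<xi>" using X_mono[OF X_\<xi>[OF that(3,1)] \<xi>] h0 by simp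
        moreover have "common \<pi> \<eta> \<subseteq> common \<pi> b" using Y_mono[OF Y_\<eta>[OF that(4,2)] that(4) _ \<eta>] that by simp
        ultimately show ?thesis using 1 by blast
      qed
      show "adj a b \<longleftrightarrow> hi (vs ! a) \<in> common \<pi> b \<and> hi (vs ! b) \<in> common \<pi> a"
        if "i < h" "j < h" "a \<in> X i" "b \<in> Y j" for i j a b
        using that by (intro adj) auto
      show "hi (vs ! a) \<preceq> lo (vs ! a)" if "i < h" "a \<in> X i" for i a
        using that len(1)[of i] by (intro hl) auto
      show "mixed_cell (X i) (Y j)" if "i < h" "j < h" for i j using mixed that by simp
    qed (rule h)+
  next
    case 2
    show ?thesis
    proof (rule transversal_pair_of_separated_blocks[OF t, where U = "\<lambda>i. Y (2 * h - 1 - i)" and Z = "\<lambda>j. X (h + j)" and h = h and \<pi> = \<pi>])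
      show "X (h + j) \<subseteq> {..<length vs}" if "j < h" for j using len that by simp
      show "a < b" if "j < j'" "j' < h" "a \<in> X (h + j)" "b \<in> X (h + j')" for j j' a b
        using X_less[of "h + j" "h + j'"] that by simp
      show "common \<pi> a \<subseteq> common \<pi> b" if "i < i'" "i' < h" "a \<in> Y (2 * h - 1 - i)" "b \<in> Y (2 * h - 1 - i')" for i i' a b
      proof -
        have "2 * h - 1 - i' < 2 * h - 1 - i" "2 * h - 1 - i < 2 * h" "2 * h - 1 - i' < 2 * h" using that by linarith+
        then show ?thesis
          using Y_mono[of b a "2 * h - 1 - i'" "2 * h - 1 - i"] Y_less[of "2 * h - 1 - i'" "2 * h - 1 - i" b a] that by simp
      qed
      show "common \<pi> a \<subseteq> common \<pi> b" if "i < h" "j < h" "a \<in> Y (2 * h - 1 - i)" "b \<in> X (h + j)" for i j a b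
      proof -
        have "h \<le> 2 * h - 1 - i" "2 * h - 1 - i < 2 * h" using that(1) by linarith+
        then have "\<eta> \<le> a" using \<eta>_Y[OF that(3)] by simp
        then have "common \<pi> a \<subseteq> common \<pi> \<eta>" using Y_mono[OF _ \<eta> _ that(3)] that(1) h0 by simp
        moreover have "common \<pi> \<xi> \<subseteq> common \<pi> b" using X_mono[OF \<xi>_X[OF that(4)] that(4)] that(2) by simp
        ultimately show ?thesis using 2 by blast
      qed
      show "adj a b \<longleftrightarrow> hi (vs ! a) \<in> common \<pi> b \<and> hi (vs ! b) \<in> common \<pi> a"
        if "i < h" "j < h" "a \<in> Y (2 * h - 1 - i)" "b \<in> X (h + j)" for i j a b
      proof -
        have ij: "2 * h - 1 - i < 2 * h" "h + j < 2 * h" using that by auto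
        have "b < a" using XY[OF ij(2,1) that(4,3)] .
        then have "adj a b \<longleftrightarrow> adj b a"
          using len(1)[OF ij(2)] len(2)[OF ij(1)] that by (intro adj_sym) auto
        then show ?thesis using adj[OF that(4) ij(2) that(3) ij(1)] by blast
      qed
      show "hi (vs ! a) \<preceq> lo (vs ! a)" if "i < h" "a \<in> Y (2 * h - 1 - i)" for i a
        using that len(2)[of "2 * h - 1 - i"] by (intro hl) auto
      show "mixed_cell (Y (2 * h - 1 - i)) (X (h + j))" if "i < h" "j < h" for i j
      proof (rule mixed_cell_sym)
        have ij: "2 * h - 1 - i < 2 * h" "h + j < 2 * h" using that by auto
        show "X (h + j) \<inter> Y (2 * h - 1 - i) = {}" using XY[OF ij(2,1)] by blast
        show "X (h + j) \<subseteq> {..<length vs}" "Y (2 * h - 1 - i) \<subseteq> {..<length vs}"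
          "mixed_cell (X (h + j)) (Y (2 * h - 1 - i))" using len mixed ij by auto
      qed
    qed (rule h)+
  qed
qed

end

section \<open>Interval partitions, distinct rows and grid rank\<close>

lemma interval_partition_enumeration:
  assumes "interval_partition k n \<P>"
  shows "\<exists>B. (\<forall>i<k. B i \<in> \<P> \<and> B i \<noteq> {} \<and> B i \<subseteq> {..<n}) \<and>
    (\<forall>i j a b. i < j \<longrightarrow> j < k \<longrightarrow> a \<in> B i \<longrightarrow> b \<in> B j \<longrightarrow> a < b)"
proof -
  have part: "partition_on {..<n} \<P>" and card: "card \<P> = k" and int: "\<And>I. I \<in> \<P> \<Longrightarrow> \<exists>a b. I = {a..<b}"
    using assms unfolding interval_partition_def by auto
  have fin\<P>: "finite \<P>" using part by (rule finite_elements[rotated]) simp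
  have sub: "I \<noteq> {} \<and> I \<subseteq> {..<n} \<and> finite I" if "I \<in> \<P>" for I
    using that part finite_subset[of I "{..<n}"] unfolding partition_on_def by auto
  have disj: "I = J" if "I \<in> \<P>" "J \<in> \<P>" "x \<in> I" "x \<in> J" for I J x
    using part that unfolding partition_on_def disjoint_def by blast
  have Min: "Min I \<in> I" if "I \<in> \<P>" for I using sub[OF that] by (intro Min_in) auto
  have inj: "inj_on Min \<P>" using Min disj by (metis inj_onI)
  \<comment> \<open>The parts are sorted by their minima: if an element of an earlier part were not
    below one of a later part, the later minimum would fall inside the earlier interval.\<close>
  define L where "L = sorted_list_of_set (Min ` \<P>)"
  have len: "length L = k" unfolding L_def using card card_image[OF inj] by simp
  have "\<exists>I\<in>\<P>. Min I = L ! i" if "i < k" for i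
    using that len nth_mem[of i L] fin\<P> unfolding L_def by auto
  then obtain B where B: "\<And>i. i < k \<Longrightarrow> B i \<in> \<P> \<and> Min (B i) = L ! i" by metis
  have less: "a < b" if ij: "i < j" "j < k" "a \<in> B i" "b \<in> B j" for i j a b
  proof (rule ccontr)
    assume "\<not> a < b"
    have Bi: "B i \<in> \<P>" "Min (B i) = L ! i" and Bj: "B j \<in> \<P>" "Min (B j) = L ! j" using B ij by auto
    have "L ! i < L ! j"
      using ij len strict_sorted_list_of_set[of "Min ` \<P>"] unfolding L_def
      by (intro sorted_wrt_nth_less[of "(<)"]) auto
    moreover have "Min (B j) \<le> b" using sub[OF Bj(1)] ij by simp
    ultimately have lt: "Min (B i) < Min (B j)" "Min (B j) \<le> a"
      using Bi Bj \<open>\<not> a < b\<close> by auto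
    obtain p q where pq: "B i = {p..<q}" using int[OF Bi(1)] by blast
    have "p \<le> Min (B i)" "a < q" using Min[OF Bi(1)] ij(3) pq by (metis atLeastLessThan_iff)+
    then have "p \<le> Min (B j)" "Min (B j) < q" using lt by linarith+
    then have "Min (B j) \<in> B i" unfolding pq by simp
    then have "B i = B j" by (rule disj[OF Bi(1) Bj(1) _ Min[OF Bj(1)]])
    then show False using lt(1) by simp
  qed
  show ?thesis
  proof (intro exI conjI allI impI)
    show "B i \<in> \<P>" "B i \<noteq> {}" "B i \<subseteq> {..<n}" if "i < k" for i
      using B[OF that] sub by blast+
    show "a < b" if "i < j" "j < k" "a \<in> B i" "b \<in> B j" for i j a b
      using that by (rule less)
  qed
qed

text \<open>Every row of the submatrix is the indicator vector of the trace of some \<open>i\<close>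
  on \<open>J\<close>, so distinct rows need distinct traces.\<close>

lemma card_rows_submatrix_le:
  fixes Q :: "nat \<Rightarrow> nat \<Rightarrow> bool"
  assumes "I \<subseteq> {..<m}" "J \<subseteq> {..<n}"
  shows "card (set (rows (submatrix (mat m n (\<lambda>(i, j). if Q i j then 1 else 0 :: nat)) I J)))
      \<le> card ((\<lambda>i. {j \<in> J. Q i j}) ` I)"
proof -
  define M where "M = mat m n (\<lambda>(i, j). if Q i j then 1 else 0 :: nat)"
  define \<phi> :: "nat set \<Rightarrow> nat vec" where "\<phi> S = vec (card J) (\<lambda>j. if pick J j \<in> S then 1 else 0)" for S
  have fin: "finite I" "finite J" using assms finite_subset by blast+
  have eqs: "{i. i < m \<and> i \<in> I} = I" "{j. j < n \<and> j \<in> J} = J" using assms by auto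
  have dims: "dim_row (submatrix M I J) = card I" "dim_col (submatrix M I J) = card J"
    by (simp_all add: dim_submatrix M_def eqs)
  have "row (submatrix M I J) i = \<phi> {j \<in> J. Q (pick I i) j} \<and> pick I i \<in> I" if i: "i < card I" for i
  proof
    show pI: "pick I i \<in> I" using i by (intro pick_in_set_le)
    show "row (submatrix M I J) i = \<phi> {j \<in> J. Q (pick I i) j}"
    proof (rule eq_vecI)
      fix j assume "j < dim_vec (\<phi> {j \<in> J. Q (pick I i) j})"
      then have j: "j < card J" by (simp add: \<phi>_def)
      then have pJ: "pick J j \<in> J" by (intro pick_in_set_le)
      have "submatrix M I J $$ (i, j) = M $$ (pick I i, pick J j)"
        using i j by (intro submatrix_index) (simp_all add: M_def eqs)
      also have "\<dots> = (if Q (pick I i) (pick J j) then 1 else 0)"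
        using pI pJ assms unfolding M_def by (subst index_mat) auto
      finally show "row (submatrix M I J) i $ j = \<phi> {j \<in> J. Q (pick I i) j} $ j"
        using i j pJ dims by (simp add: row_def \<phi>_def)
    qed (simp add: dims \<phi>_def)
  qed
  then have "set (rows (submatrix M I J)) \<subseteq> \<phi> ` ((\<lambda>i. {j \<in> J. Q i j}) ` I)"
    unfolding rows_def dims by auto
  then have "card (set (rows (submatrix M I J))) \<le> card (\<phi> ` ((\<lambda>i. {j \<in> J. Q i j}) ` I))"
    using fin by (intro card_mono) auto
  also have "\<dots> \<le> card ((\<lambda>i. {j \<in> J. Q i j}) ` I)" using fin by (intro card_image_le) auto
  finally show ?thesis unfolding M_def .
qed

lemma card_cols_submatrix_le:
  fixes Q :: "nat \<Rightarrow> nat \<Rightarrow> bool"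
  assumes "I \<subseteq> {..<m}" "J \<subseteq> {..<n}"
  shows "card (set (cols (submatrix (mat m n (\<lambda>(i, j). if Q i j then 1 else 0 :: nat)) I J)))
      \<le> card ((\<lambda>j. {i \<in> I. Q i j}) ` J)"
proof -
  have eqs: "{i. i < m \<and> i \<in> I} = I" "{j. j < n \<and> j \<in> J} = J" using assms by auto
  have "cols (submatrix (mat m n (\<lambda>(i, j). if Q i j then 1 else 0 :: nat)) I J)
      = rows (submatrix (mat n m (\<lambda>(i, j). if Q j i then 1 else 0)) J I)"
  proof -
    have "pick I i < m" if "i < card I" for i using pick_in_set_le[of i I] that assms by auto
    moreover have "pick J j < n" if "j < card J" for j using pick_in_set_le[of j J] that assms by auto
    ultimately have "transpose_mat (submatrix (mat m n (\<lambda>(i, j). if Q i j then 1 else 0 :: nat)) I J)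
        = submatrix (mat n m (\<lambda>(i, j). if Q j i then 1 else 0)) J I"
      by (intro eq_matI) (simp_all add: submatrix_def eqs)
    then show ?thesis by (metis rows_transpose)
  qed
  then show ?thesis using card_rows_submatrix_le[OF assms(2,1), of "\<lambda>j i. Q i j"] by simp
qed

text \<open>\<open>Max\<close> is informative only on a finite nonempty set. A partition has at most
  as many parts as there are rows, and the division into one cell, or into none for an empty matrix,
  shows that the set is inhabited.\<close>

lemma grid_rank_attained:
  assumes "dim_row M = dim_col M"
  shows "\<exists>\<R> \<C>. rank_division (grid_rank M) M \<R> \<C>"
proof -
  define K where "K = {k. \<exists>\<R> \<C>. rank_division k M \<R> \<C>}"
  have "k \<le> dim_row M" if "k \<in> K" for k
  proof -
    obtain \<R> where part: "partition_on {..<dim_row M} \<R>" and k: "card \<R> = k"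
      using \<open>k \<in> K\<close> unfolding K_def rank_division_def k_division_def interval_partition_def by blast
    define f where "f I = (SOME x. x \<in> I)" for I :: "nat set"
    have f: "f I \<in> I" if "I \<in> \<R>" for I
      using partition_onD3[OF part] that unfolding f_def by (metis some_in_eq)
    have "inj_on f \<R>"
    proof (rule inj_onI)
      fix I J assume IJ: "I \<in> \<R>" "J \<in> \<R>" "f I = f J"
      then have "f I \<in> I \<inter> J" using f[OF IJ(1)] f[OF IJ(2)] by simp
      then show "I = J" using disjointD[OF partition_onD2[OF part] IJ(1,2)] by blast
    qed
    moreover have "f ` \<R> \<subseteq> {..<dim_row M}"
    proof
      fix x assume "x \<in> f ` \<R>"
      then obtain I where "I \<in> \<R>" "x \<in> I" using f by auto
      then show "x \<in> {..<dim_row M}" using partition_onD1[OF part] by auto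
    qed
    ultimately have "card \<R> \<le> card {..<dim_row M}" by (intro card_inj_on_le) auto
    then show ?thesis using k by simp
  qed
  then have "finite K" using finite_nat_set_iff_bounded_le by blast
  moreover have "K \<noteq> {}"
  proof (cases "dim_row M = 0")
    case True
    have "rank_division 0 M {} {}"
      using True assms unfolding rank_division_def k_division_def interval_partition_def
      by (simp add: partition_on_empty)
    then show ?thesis unfolding K_def by blast
  next
    case False
    have "interval_partition 1 n {{..<n}}" if "0 < n" for n
      using that unfolding interval_partition_def
      by (auto simp: partition_on_def disjoint_def lessThan_atLeast0)
    then have "k_division 1 M {{..<dim_row M}} {{..<dim_col M}}"
      using False assms unfolding k_division_def by simp
    moreover have "1 \<le> card (set (rows (submatrix M {..<dim_row M} {..<dim_col M})))"
      using False by (simp add: rows_def dim_submatrix Suc_le_eq card_gt_0_iff)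
    ultimately have "rank_division 1 M {{..<dim_row M}} {{..<dim_col M}}"
      unfolding rank_division_def by simp
    then show ?thesis unfolding K_def by blast
  qed
  ultimately have "Max K \<in> K" by (rule Max_in)
  then show ?thesis unfolding grid_rank_def K_def by simp
qed

theorem theorem3p7:
  fixes t :: nat
    and G :: "'v pair_pre_digraph"
    and T :: "'n pair_pre_digraph" and r :: 'n and P :: "'v \<Rightarrow> 'n list"
    and ns :: "'n list" and vs :: "'v list"
  assumes "pair_graph G"
    and "minimal_tree_model G T r P"
    and "dfs_order G T r P ns"
    and "vertex_order G T P ns vs"
    and "grid_rank (adjacency_mat G vs) \<ge> 2 * g t"
  shows "semi_induced_transversal_pair t 0 G \<or> semi_induced_transversal_pair t 2 G"
proof (cases "t = 0")
  case True
  then show ?thesis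
    unfolding semi_induced_transversal_pair_def transversal_pair_def by (simp add: tp_verts_def)
next
  case False
  then have t: "0 < t" by simp
  obtain ch where ch: "\<forall>p\<in>pverts T. distinct (ch p) \<and> set (ch p) = {q. (p, q) \<in> parcs T} \<and>
      (\<forall>x\<in>set (ch p). \<forall>y\<in>set (ch p). explored_before G T P x y \<longrightarrow> precedes_in (ch p) x y)"
    and ns: "dfs_postorder ch r ns"
    using assms(3) unfolding dfs_order_def by blast
  note model = dfs_path_model_of_minimal_tree_model[OF assms(2) ch ns]
  interpret dfs_path_model "parcs T" G "high P" "low P" "pverts T" ch "list_index ns"
    by (rule model(1))
  have T: "pair_fin_digraph T"
    using assms(2) unfolding minimal_tree_model_def tree_model_def rooted_tree_def by blast
  have vs: "distinct vs" "set vs = pverts G" and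
    prec: "\<And>u v. u \<in> pverts G \<Longrightarrow> v \<in> pverts G \<Longrightarrow> precedes_in ns (low P u) (low P v) \<or>
        low P u = low P v \<and> ancestor T (high P u) (high P v) \<and> high P u \<noteq> high P v \<Longrightarrow> precedes_in vs u v"
    using assms(4) unfolding vertex_order_def by blast+
  have not_prec: "\<not> precedes_in vs (vs ! b) (vs ! a)" if "a < b" "b < length vs" for a b
    using precedes_in_iff[OF vs(1), of "vs ! b" "vs ! a"] list_index_nth[OF vs(1)] that by simp
  have nth_V: "vs ! a \<in> pverts G" if "a < length vs" for a using that vs(2) nth_mem by blast
  interpret ordered_dfs_path_model "parcs T" G "high P" "low P" "pverts T" ch "list_index ns" vs
  proof
    fix a b assume ab: "a < b" "b < length vs"
    have V: "vs ! a \<in> pverts G" "vs ! b \<in> pverts G" using ab by (auto intro: nth_V)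
    then have low: "low P (vs ! a) \<in> set ns" "low P (vs ! b) \<in> set ns" using lo_N model(2) by auto
    show "list_index ns (low P (vs ! a)) \<le> list_index ns (low P (vs ! b))"
      using prec[OF V(2,1)] not_prec[OF ab] precedes_in_iff[OF model(3) low(2,1)] by fastforce
    assume eq: "list_index ns (low P (vs ! a)) = list_index ns (low P (vs ! b))"
      and anc: "(high P (vs ! b), high P (vs ! a)) \<in> (parcs T)\<^sup>*"
    have low_eq: "low P (vs ! b) = low P (vs ! a)" using nth_list_index low eq by metis
    show "high P (vs ! b) = high P (vs ! a)"
    proof (rule ccontr)
      assume ne: "high P (vs ! b) \<noteq> high P (vs ! a)"
      then have "high P (vs ! b) \<in> pverts T" using anc E_N by (metis converse_rtranclE)
      then have "ancestor T (high P (vs ! b)) (high P (vs ! a))" using anc ancestor_iff[OF T] by blast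
      then show False using prec[OF V(2,1)] not_prec[OF ab] low_eq ne by blast
    qed
  qed (rule vs)+
  define M where "M = adjacency_mat G vs"
  define n where "n = length vs"
  \<comment> \<open>\<open>4 * h\<close> equals \<open>2 * g t\<close>. Half of the blocks are given
    up when rows are separated from columns, half of the rest in the comparison at the medians, and
    every second of the remaining \<open>h\<close>, which leaves \<open>g1 t ^ g2 t\<close>
    groups.\<close>
  define h where "h = 2 * g1 t ^ g2 t"
  have M: "M = mat n n (\<lambda>(i, j). if adj i j then 1 else 0)"
    unfolding M_def adjacency_mat_def n_def adj_def ..
  define K where "K = grid_rank M"
  have K: "4 * h \<le> K" using assms(5) unfolding K_def M_def h_def g_def by simp
  have t2: "1 \<le> t\<^sup>2" using t by simp
  have "1 \<le> g1 t" unfolding g1_def by simp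
  \<comment> \<open>\<open>g1 t\<close> dominates the threshold of \<open>branching_or_chain\<close>
    because t^2 + 1 is at most 2 t^2 for positive t, and \<open>g2 t\<close> dominates its exponent
    t^2 + 1.\<close>
  have "(2 * t\<^sup>2) ^ Suc (t\<^sup>2) + 2 \<le> g1 t"
    unfolding g1_def using t2 by (intro add_right_mono power_increasing) auto
  moreover have "Suc (t\<^sup>2) \<le> g2 t" unfolding g2_def using t2 by (simp add: power2_eq_square)
  ultimately have "((2 * t\<^sup>2) ^ Suc (t\<^sup>2) + 2) ^ Suc (t\<^sup>2) \<le> g1 t ^ g2 t"
    using \<open>1 \<le> g1 t\<close> by (meson le_trans power_increasing power_mono zero_le)
  then have h1: "2 * ((2 * t\<^sup>2) ^ Suc (t\<^sup>2) + 2) ^ Suc (t\<^sup>2) \<le> h" unfolding h_def by simp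
  have h2: "2 * t\<^sup>2 + 3 < h"
  proof -
    have "2 * t\<^sup>2 \<le> (2 * t\<^sup>2) ^ (2 * t\<^sup>2)" using t t2 by (intro self_le_power) auto
    then have "2 * t\<^sup>2 + 2 \<le> g1 t" unfolding g1_def by simp
    also have "\<dots> \<le> g1 t ^ g2 t" using \<open>1 \<le> g1 t\<close> by (intro self_le_power) (auto simp: g2_def)
    finally show ?thesis unfolding h_def by linarith
  qed
  obtain \<R> \<C> where "rank_division K M \<R> \<C>"
    using grid_rank_attained[of M] unfolding K_def M by auto
  then have \<R>: "interval_partition K n \<R>" and \<C>: "interval_partition K n \<C>"
    and rank: "\<And>I J. I \<in> \<R> \<Longrightarrow> J \<in> \<C> \<Longrightarrow> K \<le> card (set (rows (submatrix M I J))) \<or> K \<le> card (set (cols (submatrix M I J)))"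
    unfolding rank_division_def k_division_def by (auto simp: M)
  obtain R where R_mem: "\<forall>i<K. R i \<in> \<R> \<and> R i \<noteq> {} \<and> R i \<subseteq> {..<n}"
    and R_less: "\<forall>i j a b. i < j \<longrightarrow> j < K \<longrightarrow> a \<in> R i \<longrightarrow> b \<in> R j \<longrightarrow> a < b"
    using interval_partition_enumeration[OF \<R>] by (elim exE conjE)
  have R: "R i \<in> \<R>" "R i \<noteq> {} \<and> R i \<subseteq> {..<n}" if "i < K" for i
    using R_mem that by blast+
  have R_lt: "a < b" if "i < j" "j < K" "a \<in> R i" "b \<in> R j" for i j a b
    using R_less that by blast
  obtain C where C_mem: "\<forall>i<K. C i \<in> \<C> \<and> C i \<noteq> {} \<and> C i \<subseteq> {..<n}"
    and C_less: "\<forall>i j a b. i < j \<longrightarrow> j < K \<longrightarrow> a \<in> C i \<longrightarrow> b \<in> C j \<longrightarrow> a < b"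
    using interval_partition_enumeration[OF \<C>] by (elim exE conjE)
  have C: "C i \<in> \<C>" "C i \<noteq> {} \<and> C i \<subseteq> {..<n}" if "i < K" for i
    using C_mem that by blast+
  have C_lt: "a < b" if "i < j" "j < K" "a \<in> C i" "b \<in> C j" for i j a b
    using C_less that by blast
  have mixed: "mixed_cell (R i) (C j)" if "i < K" "j < K" for i j
  proof -
    have "3 \<le> K" using K h2 by linarith
    then show ?thesis
      using rank[OF R(1)[OF that(1)] C(1)[OF that(2)]]
        card_rows_submatrix_le[of "R i" n "C j" n adj] card_cols_submatrix_le[of "R i" n "C j" n adj]
        R(2)[OF that(1)] C(2)[OF that(2)]
      unfolding mixed_cell_def M by linarith
  qed
  define \<xi> where "\<xi> = Max (R (2 * h - 1))"
  have h0: "0 < h" using h2 by simp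
  have hK: "2 * h - 1 < K" "2 * h < K" using K h0 by linarith+
  have finR: "finite (R (2 * h - 1))" using R(2)[OF hK(1)] finite_subset by blast
  have \<xi>: "\<xi> \<in> R (2 * h - 1)" unfolding \<xi>_def using finR R(2)[OF hK(1)] by (intro Max_in) auto
  show ?thesis
  \<comment> \<open>Row and column blocks are compared at one place of the order: either the column
    blocks from \<open>2 * h\<close> on all lie after \<xi>, or a column of block
    \<open>2 * h\<close> comes no later than \<xi>, and then the first column blocks precede the row
    blocks from \<open>2 * h\<close> on.\<close>
  proof (cases "\<exists>y\<in>C (2 * h). y \<le> \<xi>")
    case no_y: False
    have less: "a < b" if "i < 2 * h" "j < 2 * h" "a \<in> R i" "b \<in> C (2 * h + j)" for i j a b
    proof -
      have "a \<le> \<xi>"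
      proof (cases "i = 2 * h - 1")
        case True
        then show ?thesis using that finR unfolding \<xi>_def by auto
      next
        case False
        then have "i < 2 * h - 1" using that by linarith
        then show ?thesis using R_lt[OF _ hK(1) that(3) \<xi>] by simp
      qed
      also have "\<xi> < b"
      proof (cases "j = 0")
        case True
        then have "b \<in> C (2 * h)" using that(4) by simp
        then show ?thesis using no_y not_le by blast
      next
        case j: False
        obtain y where y: "y \<in> C (2 * h)" using C(2)[OF hK(2)] by blast
        then have "\<xi> < y" using no_y not_le by blast
        also have "y < b"
        proof (rule C_lt[OF _ _ y that(4)])
          show "2 * h < 2 * h + j" "2 * h + j < K" using j that(2) K by linarith+
        qed
        finally show ?thesis .
      qed
      finally show ?thesis .
    qed
    show ?thesis
    proof (rule transversal_pair_of_blocks[OF t, where X = R and Y = "\<lambda>j. C (2 * h + j)" and h = h])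
      show "a < b" if "i < 2 * h" "j < 2 * h" "a \<in> R i" "b \<in> C (2 * h + j)" for i j a b
        using that by (rule less)
    next
      fix i assume i: "i < 2 * h"
      then have iK: "i < K" "2 * h + i < K" using K by linarith+
      show "R i \<subseteq> {..<length vs}" "C (2 * h + i) \<subseteq> {..<length vs}" "R i \<noteq> {}" "C (2 * h + i) \<noteq> {}"
        using R(2)[OF iK(1)] C(2)[OF iK(2)] by (auto simp: n_def)
      show "mixed_cell (R j) (C (2 * h + i))" if "j < 2 * h" for j
        using that K iK by (intro mixed) linarith+
      show "a < b" if "j < i" "a \<in> R j" "b \<in> R i" for j a b using R_lt[OF that(1) iK(1) that(2,3)] .
      show "a < b" if "j < i" "a \<in> C (2 * h + j)" "b \<in> C (2 * h + i)" for j a b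
        using C_lt[OF _ iK(2) that(2,3)] that(1) by simp
    qed (rule h1 h2)+
  next
    case True
    then obtain y where y: "y \<in> C (2 * h)" "y \<le> \<xi>" by blast
    have less: "a < b" if "i < 2 * h" "j < 2 * h" "a \<in> C i" "b \<in> R (2 * h + j)" for i j a b
    proof -
      have "a < y" using C_lt[OF that(1) hK(2) that(3) y(1)] .
      also note y(2)
      also have "\<xi> < b"
      proof (rule R_lt[OF _ _ \<xi> that(4)])
        show "2 * h - 1 < 2 * h + j" "2 * h + j < K" using that(2) K h0 by linarith+
      qed
      finally show ?thesis .
    qed
    show ?thesis
    proof (rule transversal_pair_of_blocks[OF t, where X = C and Y = "\<lambda>j. R (2 * h + j)" and h = h])
      show "a < b" if "i < 2 * h" "j < 2 * h" "a \<in> C i" "b \<in> R (2 * h + j)" for i j a b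
        using that by (rule less)
    next
      fix i assume i: "i < 2 * h"
      then have iK: "i < K" "2 * h + i < K" using K by linarith+
      show "C i \<subseteq> {..<length vs}" "R (2 * h + i) \<subseteq> {..<length vs}" "C i \<noteq> {}" "R (2 * h + i) \<noteq> {}"
        using C(2)[OF iK(1)] R(2)[OF iK(2)] by (auto simp: n_def)
      show "mixed_cell (C j) (R (2 * h + i))" if j: "j < 2 * h" for j
      proof (rule mixed_cell_sym)
        have jK: "j < K" using j K by linarith
        show "R (2 * h + i) \<subseteq> {..<length vs}" "C j \<subseteq> {..<length vs}"
          using C(2)[OF jK] R(2)[OF iK(2)] by (auto simp: n_def)
        show "R (2 * h + i) \<inter> C j = {}" using less[OF j i] by blast
        show "mixed_cell (R (2 * h + i)) (C j)" by (rule mixed[OF iK(2) jK])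
      qed
      show "a < b" if "j < i" "a \<in> C j" "b \<in> C i" for j a b using C_lt[OF that(1) iK(1) that(2,3)] .
      show "a < b" if "j < i" "a \<in> R (2 * h + j)" "b \<in> R (2 * h + i)" for j a b
        using R_lt[OF _ iK(2) that(2,3)] that(1) by simp
    qed (rule h1 h2)+
  qed
qed

end
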